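(* Let $R$ be a noetherian ring and $H\xrightarrow{\phi}G\xrightarrow{\psi}F$ a complex of free $R$-modules of finite ranks $l,n,m$ with $r=n-m\ge0$, $n-l\ge0$. Put $g=\operatorname{grade}I_\psi$, $h=\operatorname{grade}I_\phi$, $\rho=r-l$, $C=\operatorname{Coker}\psi$, and let $t\ge0$. Then the cohomology $\bar H^i$ of $\mathcal N(t)$ vanishes for $i=0,\ldots,\min(2,h-1)$. Suppose moreover $g>|\rho|+1$. Then: (i) if $3\le2t+1\le h$, there is an injection $S_t(C)\;(=D_0(H)\otimes S_t(C))\to\bar H^{2t+1}$, which is an isomorphism if $2t+1<h$; (ii) $\bar H^i=0$ for $2t+2\le i<\min(h,\,2t+g-|\rho|+1)$.
   Context: $I_\phi$ denotes the ideal of maximal minors of a matrix of $\phi$. Contraction: $\bigwedge G$ is a right $\bigwedge G^*$-module via $y_1\wedge\cdots\wedge y_n\leftharpoonup y_1^*\wedge\cdots\wedge y_p^*=\sum_\sigma\epsilon(\sigma)\det_{1\le i,j\le p}(y_j^*(y_{\sigma(i)}))\,y_{\sigma(p+1)}\wedge\cdots\wedge y_{\sigma(n)}$. $\mathcal D_\phi(t)$: with basis $h_1,\dots,h_l$ of $H$, dual basis $h_j^*$, $D(H)$ the divided power algebra on which $h^*\in H^*$ acts as a degree-lowering derivation with $h^*h^{(k)}=h^*(h)h^{(k-1)}$, and $S(H^* )$ acting on itself by multiplication, set $d_\phi(c\otimes y)=\sum_jh_j^*c\otimes\phi(h_j)\wedge y$, $x=\phi(h_1)\wedge\cdots\wedge\phi(h_l)$,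 $\nu^\phi(1\otimes y)=1\otimes x\wedge y$; $\mathcal D_\phi(t)$ is $0\to D_t(H)\otimes\bigwedge^0G\to\cdots\to D_0(H)\otimes\bigwedge^tG\xrightarrow{\nu^\phi}S_0(H^* )\otimes\bigwedge^{t+l}G\to\cdots\to S_p(H^* )\otimes\bigwedge^{t+l+p}G\to\cdots$. For $t\ge0$ its term in position $p$ is $D_{t-p}(H)\otimes\bigwedge^pG$ for $0\le p\le t$ and $S_{p-t-1}(H^* )\otimes\bigwedge^{p+l-1}G$ for $p\ge t+1$. The complex $\mathcal N(t)$: each term of $\mathcal D_\phi(t)$ has the form $A\otimes\bigwedge^jG$ ($A$ a divided or symmetric power); let $\partial_\psi:A\otimes\bigwedge^jG\to A\otimes\bigwedge^{j-1}G\otimes F$ be $1_A\otimes\partial$ with $\partial(y_1\wedge\cdots\wedge y_j)=\sum_i(-1)^{i+1}y_1\wedge\cdots\widehat{y_i}\cdots\wedge y_j\otimes\psi(y_i)$. Let $N^p$ be the kernel of $\partial_\psi$ on the term of $\mathcal D_\phi(t)$ in position $p$. Since $\psi\phi=0$, the differential of $\mathcal D_\phi(t)$ maps $N^p$ into $N^{p+1}$; $\mathcal N(t)$ is the resulting subcomplex $0\to N^0\to N^1\to\cdots$, with cohomology $\bar H^p$ at $N^p$. *)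

theory Defs
  imports "HOL-Combinatorics.Permutations" "HOL-Library.Extended_Nat"
begin

definition gen :: "'a::comm_ring_1 set \<Rightarrow> 'a set" where
  "gen X = {s. \<exists>c. s = (\<Sum>x\<in>X. c x * x)}"

definition is_ideal :: "'a::comm_ring_1 set \<Rightarrow> bool" where
  "is_ideal I \<longleftrightarrow> 0 \<in> I \<and> (\<forall>x\<in>I. \<forall>y\<in>I. x + y \<in> I) \<and> (\<forall>r. \<forall>x\<in>I. r * x \<in> I)"

definition noetherian :: "'a::comm_ring_1 itself \<Rightarrow> bool" where
  "noetherian _ \<longleftrightarrow> (\<forall>I::'a set. is_ideal I \<longrightarrow> (\<exists>X. finite X \<and> I = gen X))"

definition regular_seq :: "'a::comm_ring_1 list \<Rightarrow> bool" where
  "regular_seq xs \<longleftrightarrow>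
     (\<forall>i < length xs. \<forall>y. xs ! i * y \<in> gen (set (take i xs)) \<longrightarrow> y \<in> gen (set (take i xs)))
     \<and> gen (set xs) \<noteq> UNIV"

text \<open>grade of an ideal (infinity for the unit ideal, by the usual convention).\<close>
definition grade :: "'a::comm_ring_1 set \<Rightarrow> enat" where
  "grade I = (if I = UNIV then \<infinity>
              else Sup {enat (length xs) | xs. set xs \<subseteq> I \<and> regular_seq xs})"

definition det_sub :: "(nat \<Rightarrow> nat \<Rightarrow> 'a::comm_ring_1) \<Rightarrow> nat list \<Rightarrow> nat list \<Rightarrow> 'a" where
  "det_sub M rows cols =
     (\<Sum>\<sigma> | \<sigma> permutes {..<length rows}.
        of_int (sign \<sigma>) * (\<Prod>i<length rows. M (rows ! i) (cols ! \<sigma> i)))"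

text \<open>Matrices: phi i j (i < n, j < l) is the matrix of phi : H -> G, i.e.
  phi(h_j) = sum_i phi i j g_i;  psi k i (k < m, i < n) is the matrix of psi : G -> F,
  psi(g_i) = sum_k psi k i f_k.  Indices start at 0.\<close>

definition I_phi :: "(nat \<Rightarrow> nat \<Rightarrow> 'a::comm_ring_1) \<Rightarrow> nat \<Rightarrow> nat \<Rightarrow> 'a set" where
  "I_phi phi l n = gen {det_sub phi (sorted_list_of_set L) [0..<l] | L. L \<subseteq> {..<n} \<and> card L = l}"

definition I_psi :: "(nat \<Rightarrow> nat \<Rightarrow> 'a::comm_ring_1) \<Rightarrow> nat \<Rightarrow> nat \<Rightarrow> 'a set" where
  "I_psi psi m n = gen {det_sub psi [0..<m] (sorted_list_of_set L) | L. L \<subseteq> {..<n} \<and> card L = m}"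

text \<open>Exponent vectors of degree d in k variables: basis of D_d (resp. S_d) of a free module of rank k.\<close>
definition Mon :: "nat \<Rightarrow> nat \<Rightarrow> (nat \<Rightarrow> nat) set" where
  "Mon k d = {\<alpha>. (\<forall>i\<ge>k. \<alpha> i = 0) \<and> (\<Sum>i<k. \<alpha> i) = d}"

text \<open>Sign of g_i wedge e_J (J listed increasingly), and of e_L wedge e_J.\<close>
definition wsign :: "nat \<Rightarrow> nat set \<Rightarrow> 'a::comm_ring_1" where
  "wsign i J = (-1) ^ card {j\<in>J. j < i}"

definition wsign2 :: "nat set \<Rightarrow> nat set \<Rightarrow> 'a::comm_ring_1" where
  "wsign2 L J = (-1) ^ card {(a,b). a \<in> L \<and> b \<in> J \<and> b < a}"

text \<open>Basis of the term of D_phi(t) in position p: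
  D_{t-p}(H) (x) wedge^p G for p \<le> t, and S_{p-t-1}(H*) (x) wedge^{p+l-1} G for p > t.
  A basis element is (alpha, J): alpha the exponent of the divided/symmetric monomial,
  J the index set of the basis wedge e_J.\<close>
definition Bas :: "nat \<Rightarrow> nat \<Rightarrow> nat \<Rightarrow> nat \<Rightarrow> ((nat \<Rightarrow> nat) \<times> nat set) set" where
  "Bas l n t p = {(\<alpha>, J). \<alpha> \<in> Mon l (if p \<le> t then t - p else p - t - 1)
                        \<and> J \<subseteq> {..<n} \<and> card J = (if p \<le> t then p else p + l - 1)}"

definition Vec :: "nat \<Rightarrow> nat \<Rightarrow> nat \<Rightarrow> nat \<Rightarrow> ((nat \<Rightarrow> nat) \<times> nat set \<Rightarrow> 'a::comm_ring_1) set" where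
  "Vec l n t p = {v. \<forall>b. b \<notin> Bas l n t p \<longrightarrow> v b = 0}"

text \<open>Matrix coefficient of the differential of D_phi(t) from position p to p+1:
  coefficient of basis element b = (beta,K) in the image of c = (alpha,J).\<close>
definition dcoef :: "(nat \<Rightarrow> nat \<Rightarrow> 'a::comm_ring_1) \<Rightarrow> nat \<Rightarrow> nat \<Rightarrow> nat \<Rightarrow> nat
      \<Rightarrow> (nat \<Rightarrow> nat) \<times> nat set \<Rightarrow> (nat \<Rightarrow> nat) \<times> nat set \<Rightarrow> 'a" where
  "dcoef phi l n t p b c = (case b of (\<beta>, K) \<Rightarrow> case c of (\<alpha>, J) \<Rightarrow>
     if p < t then
       (\<Sum>j<l. \<Sum>i<n. if 0 < \<alpha> j \<and> \<beta> = \<alpha>(j := \<alpha> j - 1) \<and> i \<notin> J \<and> K = insert i J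
                      then wsign i J * phi i j else 0)
     else if p = t then
       (\<Sum>L\<in>{L. L \<subseteq> {..<n} \<and> card L = l}.
          if L \<inter> J = {} \<and> K = L \<union> J
          then wsign2 L J * det_sub phi (sorted_list_of_set L) [0..<l] else 0)
     else
       (\<Sum>j<l. \<Sum>i<n. if \<beta> = \<alpha>(j := Suc (\<alpha> j)) \<and> i \<notin> J \<and> K = insert i J
                      then wsign i J * phi i j else 0))"

definition dmap :: "(nat \<Rightarrow> nat \<Rightarrow> 'a::comm_ring_1) \<Rightarrow> nat \<Rightarrow> nat \<Rightarrow> nat \<Rightarrow> nat
      \<Rightarrow> ((nat \<Rightarrow> nat) \<times> nat set \<Rightarrow> 'a) \<Rightarrow> ((nat \<Rightarrow> nat) \<times> nat set \<Rightarrow> 'a)" where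
  "dmap phi l n t p v = (\<lambda>b. if b \<in> Bas l n t (Suc p)
      then (\<Sum>c\<in>Bas l n t p. dcoef phi l n t p b c * v c) else 0)"

text \<open>N^p: kernel of partial_psi = 1_A (x) partial on the term in position p.
  The coordinate of partial_psi(v) at e_alpha (x) e_K (x) f_k is
  sum_{i notin K} (-1)^{#{j in K, j<i}} psi k i v(alpha, K + {i}).\<close>
definition Nmod :: "(nat \<Rightarrow> nat \<Rightarrow> 'a::comm_ring_1) \<Rightarrow> nat \<Rightarrow> nat \<Rightarrow> nat \<Rightarrow> nat \<Rightarrow> nat
      \<Rightarrow> ((nat \<Rightarrow> nat) \<times> nat set \<Rightarrow> 'a) set" where
  "Nmod psi l n m t p = {v \<in> Vec l n t p.
      \<forall>\<alpha> K. \<forall>k<m. (\<Sum>i<n. if i \<notin> K then wsign i K * psi k i * v (\<alpha>, insert i K) else 0) = 0}"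

definition Zyc where
  "Zyc phi psi l n m t p = {v \<in> Nmod psi l n m t p. dmap phi l n t p v = (\<lambda>_. 0)}"

definition Bdy where
  "Bdy phi psi l n m t p = (if p = 0 then {\<lambda>_. 0}
      else dmap phi l n t (p - 1) ` Nmod psi l n m t (p - 1))"

definition cohom_vanishes where
  "cohom_vanishes phi psi l n m t p \<longleftrightarrow> Zyc phi psi l n m t p \<subseteq> Bdy phi psi l n m t p"

text \<open>S_t(C) = S_t(F) / (psi(G) * S_{t-1}(F)), S_t(F) with monomial basis Mon m t.
  Coordinate vectors of S_t(F):\<close>
definition SVec :: "nat \<Rightarrow> nat \<Rightarrow> ((nat \<Rightarrow> nat) \<Rightarrow> 'a::comm_ring_1) set" where
  "SVec m t = {u. \<forall>\<gamma>. \<gamma> \<notin> Mon m t \<longrightarrow> u \<gamma> = 0}"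

text \<open>The submodule psi(G) S_{t-1}(F) of S_t(F) (for t \<ge> 1), spanned by psi(g_i) x^delta.\<close>
definition SRel :: "(nat \<Rightarrow> nat \<Rightarrow> 'a::comm_ring_1) \<Rightarrow> nat \<Rightarrow> nat \<Rightarrow> nat \<Rightarrow> ((nat \<Rightarrow> nat) \<Rightarrow> 'a) set" where
  "SRel psi n m t = (if t = 0 then {\<lambda>_. 0} else
     {u. \<exists>c. u = (\<lambda>\<gamma>. if \<gamma> \<in> Mon m t then
        (\<Sum>i<n. \<Sum>\<delta>\<in>Mon m (t - 1). c i \<delta> *
            (\<Sum>k<m. if \<gamma> = \<delta>(k := Suc (\<delta> k)) then psi k i else 0)) else 0)})"

definition lin_apply :: "nat \<Rightarrow> nat \<Rightarrow> ((nat \<Rightarrow> nat) \<times> nat set \<Rightarrow> (nat \<Rightarrow> nat) \<Rightarrow> 'a::comm_ring_1)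
      \<Rightarrow> ((nat \<Rightarrow> nat) \<Rightarrow> 'a) \<Rightarrow> ((nat \<Rightarrow> nat) \<times> nat set \<Rightarrow> 'a)" where
  "lin_apply m t M u = (\<lambda>b. \<Sum>\<gamma>\<in>Mon m t. M b \<gamma> * u \<gamma>)"

text \<open>M induces a well-defined injective R-linear map S_t(C) -> cohomology at p
  (every such map lifts to S_t(F), which is free).\<close>
definition induces_injection where
  "induces_injection phi psi l n m t p M \<longleftrightarrow>
     (\<forall>u\<in>SVec m t. lin_apply m t M u \<in> Zyc phi psi l n m t p) \<and>
     (\<forall>u\<in>SRel psi n m t. lin_apply m t M u \<in> Bdy phi psi l n m t p) \<and>
     (\<forall>u\<in>SVec m t. lin_apply m t M u \<in> Bdy phi psi l n m t p \<longrightarrow> u \<in> SRel psi n m t)"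

definition induces_surjection where
  "induces_surjection phi psi l n m t p M \<longleftrightarrow>
     (\<forall>z\<in>Zyc phi psi l n m t p. \<exists>u\<in>SVec m t. z - lin_apply m t M u \<in> Bdy phi psi l n m t p)"

end

(* After inverting a maximal minor delta of phi, the complexes D_phi(t) split. Over the given ring this
   becomes an explicit null-homotopy of delta^l, built from the operators contracting with functionals
   dual to the columns of phi and raising (or lowering) exponents without coefficients. A complex of
   free modules on which the elements of a weakly regular sequence of length k are null-homotopic is
   exact in positions below k; this replaces any acyclicity criterion. The columns, the Koszul
   complexes of psi, are treated by the same argument with wedging and contraction exchanged.
   If the grade of I_psi exceeds |rho| + 1 then I_phi lies in the radical of I_psi, so that h
   also bounds the exactness of the columns. The theorem follows by zigzags in the bicomplex with rows
   D_phi(t - q) (x) S_q(F): the one starting at D_0 (x) S_t(F) in position (t, t) ends in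
   position (2t + 1, 0). *)

theory Submission
  imports Defs "Jordan_Normal_Form.Determinant"
begin

text \<open>Since h* sends h^(k) to h^(k-1), both halves of D_phi(t) act on monomial coordinates by
  coefficient-free shifts U and D with D U = 1, so splitting after inverting a minor involves no
  division by integers. A homotopy in one variable leaves a defect with the factor 1 - U D, the
  projection onto exponent 0. The product of the defects is therefore concentrated in degree 0, and
  there it factors through the splicing map, which joins the two halves. The numerical bounds come
  from the columns. The column in position p > t is the symmetric half of a complex of type D for
  psi with parameter u = max(0, rho - p + 1), so its term q + 1 sits in position u + q + 2 there. If
  rho < p, then u = 0 and the required length depends on q alone; it is supplied by h rather than g,
  which is why I_phi must lie in the radical of I_psi. If p <= rho, the length has to come from g;
  the worst column met by a zigzag gives the bound 2t + g - |rho| + 1. All zigzags stop at the same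
  obstacle: for p <= t and p < q the term contains an exterior power of negative degree and is
  0.\<close>

section \<open>Homotopies for Koszul-type differentials\<close>

lemma sum_antisymmetric_eq_0:
  fixes f :: "nat \<Rightarrow> nat \<Rightarrow> 'r::ab_group_add"
  assumes "\<And>j k. j < l \<Longrightarrow> k < l \<Longrightarrow> f j k = - f k j" and "\<And>j. j < l \<Longrightarrow> f j j = 0"
  shows "(\<Sum>j<l. \<Sum>k<l. f j k) = 0"
  using assms
proof (induction l)
  case (Suc l)
  have "(\<Sum>j<Suc l. \<Sum>k<Suc l. f j k)
      = (\<Sum>j<l. \<Sum>k<l. f j k) + (\<Sum>j<l. f j l) + (\<Sum>k<l. f l k) + f l l"
    by (simp add: sum.distrib algebra_simps)
  also have "(\<Sum>k<l. f l k) = - (\<Sum>j<l. f j l)"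
    unfolding sum_negf[symmetric] by (intro sum.cong) (auto intro: Suc.prems)
  also have "(\<Sum>j<l. \<Sum>k<l. f j k) = 0"
    by (rule Suc.IH) (meson Suc.prems less_SucI)+
  finally show ?case using Suc.prems(2)[of l] by simp
qed simp

section \<open>Ordered products of commuting and anticommuting elements\<close>

primrec lprod :: "(nat \<Rightarrow> 'r::ring_1) \<Rightarrow> nat \<Rightarrow> 'r" where
  "lprod f 0 = 1"
| "lprod f (Suc k) = lprod f k * f k"

primrec rprod :: "(nat \<Rightarrow> 'r::ring_1) \<Rightarrow> nat \<Rightarrow> 'r" where
  "rprod f 0 = 1"
| "rprod f (Suc k) = f k * rprod f k"

text \<open>The homotopy accumulated from \<open>k\<close> partial ones: \<open>s k\<close> acts on
  what its predecessors have left over, \<open>rprod \<pi> k\<close>, and the earlier terms are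
  rescaled by the central \<open>\<delta>\<close>.\<close>

primrec hsum :: "'r::ring_1 \<Rightarrow> (nat \<Rightarrow> 'r) \<Rightarrow> (nat \<Rightarrow> 'r) \<Rightarrow> nat \<Rightarrow> 'r" where
  "hsum \<delta> s \<pi> 0 = 0"
| "hsum \<delta> s \<pi> (Suc k) = \<delta> * hsum \<delta> s \<pi> k + s k * rprod \<pi> k"

lemma commute_rprod:
  assumes "\<And>j. j < k \<Longrightarrow> x * f j = f j * x"
  shows "x * rprod f k = rprod f k * x"
  using assms
proof (induction k)
  case (Suc k)
  have "x * rprod f (Suc k) = (x * f k) * rprod f k" by (simp add: mult.assoc)
  also have "\<dots> = f k * (x * rprod f k)" using Suc.prems by (simp add: mult.assoc)
  also have "\<dots> = rprod f (Suc k) * x" using Suc by (simp add: mult.assoc)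
  finally show ?case .
qed simp

lemma commute_lprod:
  assumes "\<And>j. j < k \<Longrightarrow> x * f j = f j * x"
  shows "x * lprod f k = lprod f k * x"
  using assms
proof (induction k)
  case (Suc k)
  have "x * lprod f (Suc k) = (x * lprod f k) * f k" by (simp add: mult.assoc)
  also have "\<dots> = lprod f k * (x * f k)" using Suc by (simp add: mult.assoc)
  also have "\<dots> = lprod f (Suc k) * x" using Suc.prems by (simp add: mult.assoc)
  finally show ?case .
qed simp

lemma minus_one_power_commute: "x * (- 1) ^ n = (- 1) ^ n * (x::'r::ring_1)"
  by (cases "even n") simp_all

lemma anticommute_lprod:
  fixes x :: "'r::ring_1"
  assumes "\<And>j. j < k \<Longrightarrow> x * f j = - (f j * x)"
  shows "x * lprod f k = (- 1) ^ k * (lprod f k * x)"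
  using assms
proof (induction k)
  case (Suc k)
  have "x * lprod f (Suc k) = (x * lprod f k) * f k" by (simp add: mult.assoc)
  also have "\<dots> = (- 1) ^ k * (lprod f k * (x * f k))" using Suc by (simp add: mult.assoc)
  also have "\<dots> = (- 1) ^ Suc k * (lprod f (Suc k) * x)" using Suc.prems by (simp add: mult.assoc)
  finally show ?case .
qed simp

lemma anticommute_rprod:
  fixes x :: "'r::ring_1"
  assumes "\<And>j. j < k \<Longrightarrow> x * f j = - (f j * x)"
  shows "x * rprod f k = (- 1) ^ k * (rprod f k * x)"
  using assms
proof (induction k)
  case (Suc k)
  have "x * rprod f (Suc k) = (x * f k) * rprod f k" by (simp add: mult.assoc)
  also have "\<dots> = - (f k * (x * rprod f k))" using Suc.prems by (simp add: mult.assoc)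
  also have "\<dots> = - (f k * (- 1) ^ k * (rprod f k * x))" using Suc by (simp add: mult.assoc)
  also have "\<dots> = (- 1) ^ Suc k * (rprod f (Suc k) * x)" unfolding minus_one_power_commute by (simp add: mult.assoc)
  finally show ?case .
qed simp

lemma lprod_mult_eq_0:
  fixes f :: "nat \<Rightarrow> 'r::ring_1"
  assumes "\<And>i. i < k \<Longrightarrow> f i * f i = 0"
    and "\<And>i j. i < k \<Longrightarrow> j < k \<Longrightarrow> f i * f j = - (f j * f i)" and "j < k"
  shows "lprod f k * f j = 0" "f j * lprod f k = 0"
proof -
  show 1: "lprod f k * f j = 0"
    using assms
  proof (induction k)
    case 0
    from 0(3) show ?case by simp
  next
    case (Suc k)
    show ?case
    proof (cases "j = k")
      case True
      then show ?thesis using Suc.prems(1)[of k] by (simp add: mult.assoc)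
    next
      case False
      have "lprod f (Suc k) * f j = - (lprod f k * f j * f k)"
        using Suc.prems(2)[of k j] Suc.prems(3) by (simp add: mult.assoc)
      also have "lprod f k * f j = 0"
        using Suc.prems(3) False by (intro Suc.IH) (auto intro: Suc.prems)
      finally show ?thesis by simp
    qed
  qed
  have "f j * lprod f k = (- 1) ^ k * (lprod f k * f j)"
    by (rule anticommute_lprod) (auto intro: assms)
  then show "f j * lprod f k = 0" using 1 by simp
qed

text \<open>The asymmetry lies in \<open>DU\<close>: raising an exponent and then lowering it is the
  identity, whereas lowering first annihilates exponent 0. The elements \<open>e j\<close> will be
  wedge products for the rows and contractions for the columns.\<close>

locale koszul_ops =
  fixes l :: nat and e U D :: "nat \<Rightarrow> 'r::ring_1"
  assumes ee: "\<And>j k. j < l \<Longrightarrow> k < l \<Longrightarrow> e j * e k = - (e k * e j)"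
    and e2: "\<And>j. j < l \<Longrightarrow> e j * e j = 0"
    and UU: "\<And>j k. j < l \<Longrightarrow> k < l \<Longrightarrow> U j * U k = U k * U j"
    and DD: "\<And>j k. j < l \<Longrightarrow> k < l \<Longrightarrow> D j * D k = D k * D j"
    and UD: "\<And>j k. j < l \<Longrightarrow> k < l \<Longrightarrow> j \<noteq> k \<Longrightarrow> U j * D k = D k * U j"
    and DU: "\<And>j. j < l \<Longrightarrow> D j * U j = 1"
    and Ue: "\<And>j k. j < l \<Longrightarrow> k < l \<Longrightarrow> U j * e k = e k * U j"
    and De: "\<And>j k. j < l \<Longrightarrow> k < l \<Longrightarrow> D j * e k = e k * D j"
begin

text \<open>\<open>X\<close> is the splicing map, \<open>dS\<close> and \<open>dD\<close> are the
  differentials of the symmetric and of the divided half.\<close>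

definition X where "X = lprod e l"
definition dS where "dS = (\<Sum>j<l. U j * e j)"
definition dD where "dD = (\<Sum>j<l. D j * e j)"

lemma dS_dS: "dS * dS = 0"
proof -
  have "dS * dS = (\<Sum>j<l. \<Sum>k<l. U j * U k * (e j * e k))"
    unfolding dS_def sum_product
    by (intro sum.cong refl) (simp add: mult.assoc, metis Ue lessThan_iff mult.assoc)
  also have "\<dots> = 0"
    by (rule sum_antisymmetric_eq_0)
      (metis ee UU mult_minus_right, simp add: e2)
  finally show ?thesis .
qed

lemma dD_dD: "dD * dD = 0"
proof -
  have "dD * dD = (\<Sum>j<l. \<Sum>k<l. D j * D k * (e j * e k))"
    unfolding dD_def sum_product
    by (intro sum.cong refl) (simp add: mult.assoc, metis De lessThan_iff mult.assoc)
  also have "\<dots> = 0"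
    by (rule sum_antisymmetric_eq_0)
      (metis ee DD mult_minus_right, simp add: e2)
  finally show ?thesis .
qed

lemma e_X: "j < l \<Longrightarrow> e j * X = 0" and X_e: "j < l \<Longrightarrow> X * e j = 0"
  unfolding X_def by (rule lprod_mult_eq_0; blast intro: ee e2)+

lemma X_dD: "X * dD = 0"
proof -
  have "X * (D j * e j) = 0" if "j < l" for j
  proof -
    have "D j * X = X * D j" unfolding X_def by (rule commute_lprod) (use De that in auto)
    then have "X * (D j * e j) = D j * (X * e j)" by (metis mult.assoc)
    then show ?thesis by (simp add: X_e that)
  qed
  then show ?thesis by (simp add: dD_def sum_distrib_left)
qed

lemma dS_X: "dS * X = 0"
  unfolding dS_def sum_distrib_right by (simp add: mult.assoc e_X)

end

text \<open>In the model for rows, \<open>\<iota> k\<close> is contraction with a functional that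
  takes the value \<open>\<delta>\<close> on the \<open>k\<close>-th column and 0 on the others;
  \<open>ei\<close> is the resulting Clifford relation.\<close>

locale koszul_homotopy = koszul_ops l e U D
  for l :: nat and e U D :: "nat \<Rightarrow> 'r::ring_1" +
  fixes \<iota> :: "nat \<Rightarrow> 'r" and \<delta> :: 'r
  assumes ei: "\<And>j k. j < l \<Longrightarrow> k < l \<Longrightarrow> e j * \<iota> k + \<iota> k * e j = (if j = k then \<delta> else 0)"
    and Ui: "\<And>j k. j < l \<Longrightarrow> k < l \<Longrightarrow> U j * \<iota> k = \<iota> k * U j"
    and Di: "\<And>j k. j < l \<Longrightarrow> k < l \<Longrightarrow> D j * \<iota> k = \<iota> k * D j"
    and central: "\<And>x. \<delta> * x = x * \<delta>"
begin

lemma mixed: "j < l \<Longrightarrow> k < l \<Longrightarrow> j \<noteq> k \<Longrightarrow> \<iota> k * e j = - (e j * \<iota> k)"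
  using ei[of j k] by (simp add: eq_neg_iff_add_eq_0 add.commute)

lemma e_i_commute_e:
  assumes "j < l" "k < l" "j \<noteq> k"
  shows "e k * \<iota> k * e j = e j * (e k * \<iota> k)" "\<iota> k * e k * e j = e j * (\<iota> k * e k)"
proof -
  have "e k * \<iota> k * e j = - (e k * e j * \<iota> k)" using mixed assms by (simp add: mult.assoc)
  also have "\<dots> = e j * (e k * \<iota> k)" using ee[of k j] assms by (simp add: mult.assoc)
  finally show "e k * \<iota> k * e j = e j * (e k * \<iota> k)" .
  have "\<iota> k * e k * e j = - (\<iota> k * e j * e k)" using ee[of k j] assms by (simp add: mult.assoc)
  also have "\<dots> = e j * (\<iota> k * e k)" using mixed assms by (simp add: mult.assoc)
  finally show "\<iota> k * e k * e j = e j * (\<iota> k * e k)" .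
qed

definition K where "K = rprod \<iota> l"

text \<open>No sign appears because the second product runs in the opposite order:
  \<open>e k * \<iota> k\<close> is even, so it slides past the \<open>e j\<close> with
  \<open>j < k\<close>.\<close>

lemma rprod_e_i: "k \<le> l \<Longrightarrow> rprod (\<lambda>j. e j * \<iota> j) k = lprod e k * rprod \<iota> k"
proof (induction k)
  case (Suc k)
  have "e k * \<iota> k * lprod e k = lprod e k * (e k * \<iota> k)"
    by (rule commute_lprod) (use Suc.prems e_i_commute_e in auto)
  then have "rprod (\<lambda>j. e j * \<iota> j) (Suc k) = lprod e k * (e k * \<iota> k) * rprod \<iota> k"
    using Suc by (simp add: mult.assoc[symmetric])
  then show ?case by (simp add: mult.assoc)
qed simp

text \<open>Here \<open>e k\<close> has to cross both products, and the two signs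
  \<open>(-1)^k\<close> cancel.\<close>

lemma rprod_i_e: "k \<le> l \<Longrightarrow> rprod (\<lambda>j. \<iota> j * e j) k = rprod \<iota> k * lprod e k"
proof (induction k)
  case (Suc k)
  have 1: "e k * lprod e k = (- 1) ^ k * (lprod e k * e k)"
    by (rule anticommute_lprod) (use Suc.prems in \<open>auto intro: ee\<close>)
  have 2: "e k * rprod \<iota> k = (- 1) ^ k * (rprod \<iota> k * e k)"
    by (rule anticommute_rprod) (use Suc.prems mixed in \<open>simp add: eq_neg_iff_add_eq_0 ei\<close>)
  have "e k * (rprod \<iota> k * lprod e k) = (- 1) ^ k * (rprod \<iota> k * (e k * lprod e k))"
    using 2 by (simp add: mult.assoc[symmetric])
  also have "\<dots> = (- 1) ^ k * (rprod \<iota> k * (- 1) ^ k * (lprod e k * e k))"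
    unfolding 1 by (simp add: mult.assoc)
  also have "\<dots> = ((- 1) ^ k * (- 1) ^ k) * (rprod \<iota> k * (lprod e k * e k))"
    unfolding minus_one_power_commute[of "rprod \<iota> k"] by (simp add: mult.assoc)
  also have "\<dots> = rprod \<iota> k * (lprod e k * e k)"
    by (simp flip: power_add mult_2)
  finally show ?case using Suc by (simp add: mult.assoc)
qed simp

section \<open>Homotopies in one variable and their product\<close>

definition sS where "sS k = D k * \<iota> k"
definition sD where "sD k = U k * \<iota> k"

text \<open>The defects of the two homotopies. They equal \<open>e k * \<iota> k\<close>,
  respectively \<open>\<iota> k * e k\<close>, times \<open>1 - U k * D k\<close>, the projection
  onto exponent 0 in the \<open>k\<close>-th variable.\<close>

definition piS where "piS k = \<delta> - (U k * D k * (e k * \<iota> k) + \<iota> k * e k)"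
definition piD where "piD k = \<delta> - (e k * \<iota> k + U k * D k * (\<iota> k * e k))"

text \<open>The terms with \<open>j \<noteq> k\<close> cancel, because \<open>e j\<close> and
  \<open>\<iota> k\<close> anticommute while all the shifts involved commute.\<close>

lemma dS_sS: assumes "k < l" shows "dS * sS k + sS k * dS = \<delta> - piS k"
proof -
  have "dS * sS k + sS k * dS = (\<Sum>j<l. U j * e j * (D k * \<iota> k) + D k * \<iota> k * (U j * e j))"
    unfolding dS_def sS_def by (simp add: sum_distrib_left sum_distrib_right sum.distrib)
  also have "\<dots> = (\<Sum>j<l. if j = k then U k * D k * (e k * \<iota> k) + \<iota> k * e k else 0)"
  proof (intro sum.cong refl)
    fix j assume "j \<in> {..<l}"
    then have j: "j < l" by simp
    have a: "U j * e j * (D k * \<iota> k) = U j * D k * (e j * \<iota> k)"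
      by (metis De assms j mult.assoc)
    have b: "D k * \<iota> k * (U j * e j) = D k * U j * (\<iota> k * e j)"
      by (metis Ui assms j mult.assoc)
    show "U j * e j * (D k * \<iota> k) + D k * \<iota> k * (U j * e j)
        = (if j = k then U k * D k * (e k * \<iota> k) + \<iota> k * e k else 0)"
      unfolding a b using assms j
      by (cases "j = k") (simp_all add: DU UD mixed)
  qed
  also have "\<dots> = \<delta> - piS k" using assms by (simp add: piS_def)
  finally show ?thesis .
qed

lemma dD_sD: assumes "k < l" shows "dD * sD k + sD k * dD = \<delta> - piD k"
proof -
  have "dD * sD k + sD k * dD = (\<Sum>j<l. D j * e j * (U k * \<iota> k) + U k * \<iota> k * (D j * e j))"
    unfolding dD_def sD_def by (simp add: sum_distrib_left sum_distrib_right sum.distrib)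
  also have "\<dots> = (\<Sum>j<l. if j = k then e k * \<iota> k + U k * D k * (\<iota> k * e k) else 0)"
  proof (intro sum.cong refl)
    fix j assume "j \<in> {..<l}"
    then have j: "j < l" by simp
    have a: "D j * e j * (U k * \<iota> k) = D j * U k * (e j * \<iota> k)"
      by (metis Ue assms j mult.assoc)
    have b: "U k * \<iota> k * (D j * e j) = U k * D j * (\<iota> k * e j)"
      by (metis Di assms j mult.assoc)
    show "D j * e j * (U k * \<iota> k) + U k * \<iota> k * (D j * e j)
        = (if j = k then e k * \<iota> k + U k * D k * (\<iota> k * e k) else 0)"
      unfolding a b using assms j
      by (cases "j = k") (simp_all add: DU UD mixed)
  qed
  also have "\<dots> = \<delta> - piD k" using assms by (simp add: piD_def)
  finally show ?thesis .
qed

text \<open>Each \<open>\<pi> j\<close> differs from the central \<open>\<delta>\<close> by a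
  homotopy, hence commutes with \<open>d\<close>. So the next homotopy relation may be multiplied by
  \<open>rprod \<pi> k\<close> and remains a homotopy relation.\<close>

lemma homotopy_product:
  assumes d: "d * d = 0" and ds: "\<And>k. k < l \<Longrightarrow> d * s k + s k * d = \<delta> - \<pi> k" and "k \<le> l"
  shows "\<delta> ^ k = d * hsum \<delta> s \<pi> k + hsum \<delta> s \<pi> k * d + rprod \<pi> k"
  using \<open>k \<le> l\<close>
proof (induction k)
  case (Suc k)
  have com: "d * \<pi> j = \<pi> j * d" if "j < l" for j
  proof -
    have p: "\<pi> j = \<delta> - (d * s j + s j * d)" using ds[OF that] by (simp add: algebra_simps)
    have dd: "d * (d * z) = 0" for z using d by (simp add: mult.assoc[symmetric])
    show ?thesis unfolding p using central d dd by (simp add: algebra_simps)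
  qed
  have comr: "d * rprod \<pi> k = rprod \<pi> k * d"
    by (rule commute_rprod) (use com Suc.prems in auto)
  have "d * hsum \<delta> s \<pi> (Suc k) + hsum \<delta> s \<pi> (Suc k) * d
      = \<delta> * (d * hsum \<delta> s \<pi> k + hsum \<delta> s \<pi> k * d) + (d * s k * rprod \<pi> k + s k * (rprod \<pi> k * d))"
    using central[of d] by (simp add: algebra_simps) (metis mult.assoc)
  also have "d * s k * rprod \<pi> k + s k * (rprod \<pi> k * d) = (d * s k + s k * d) * rprod \<pi> k"
    unfolding comr[symmetric] by (simp add: algebra_simps)
  also have "\<dots> = (\<delta> - \<pi> k) * rprod \<pi> k" using ds Suc.prems by simp
  also have "d * hsum \<delta> s \<pi> k + hsum \<delta> s \<pi> k * d = \<delta> ^ k - rprod \<pi> k"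
    using Suc by simp
  finally show ?case by (simp add: algebra_simps)
qed simp

definition SS where "SS = hsum \<delta> sS piS l"
definition SD where "SD = hsum \<delta> sD piD l"
definition AS where "AS = rprod piS l"
definition AD where "AD = rprod piD l"

lemma homotopy_S: "\<delta> ^ l = dS * SS + SS * dS + AS"
  unfolding SS_def AS_def by (rule homotopy_product) (use dS_dS dS_sS in auto)

lemma homotopy_D: "\<delta> ^ l = dD * SD + SD * dD + AD"
  unfolding SD_def AD_def by (rule homotopy_product) (use dD_dD dD_sD in auto)

lemma D_piS: assumes "j < l" "k < l"
  shows "D j * piS k = (if j = k then 0 else piS k * D j)"
proof (cases "j = k")
  case True
  have "D k * (U k * D k * (e k * \<iota> k)) = D k * (e k * \<iota> k)"
    using DU[OF assms(2)] by (simp add: mult.assoc[symmetric])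
  then have "D k * piS k = D k * (\<delta> - (e k * \<iota> k + \<iota> k * e k))"
    unfolding piS_def by (simp add: algebra_simps)
  also have "\<dots> = 0" using ei[of k k] assms by simp
  finally show ?thesis using True by simp
next
  case False
  have 1: "D j * (e k * \<iota> k) = (e k * \<iota> k) * D j" "D j * (\<iota> k * e k) = (\<iota> k * e k) * D j"
    by (metis De Di assms mult.assoc)+
  have 2: "D j * (U k * D k) = U k * D k * D j"
    by (metis DD UD assms False mult.assoc)
  have "D j * (U k * D k * (e k * \<iota> k)) = U k * D k * (e k * \<iota> k) * D j"
    by (metis 1(1) 2 mult.assoc)
  then show ?thesis using False 1 central[of "D j"] unfolding piS_def by (simp add: algebra_simps)
qed

lemma D_piD: assumes "j < l" "k < l"
  shows "D j * piD k = (if j = k then 0 else piD k * D j)"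
proof (cases "j = k")
  case True
  have "D k * (U k * D k * (\<iota> k * e k)) = D k * (\<iota> k * e k)"
    using DU[OF assms(2)] by (simp add: mult.assoc[symmetric])
  then have "D k * piD k = D k * (\<delta> - (e k * \<iota> k + \<iota> k * e k))"
    unfolding piD_def by (simp add: algebra_simps)
  also have "\<dots> = 0" using ei[of k k] assms by simp
  finally show ?thesis using True by simp
next
  case False
  have 1: "D j * (e k * \<iota> k) = (e k * \<iota> k) * D j" "D j * (\<iota> k * e k) = (\<iota> k * e k) * D j"
    by (metis De Di assms mult.assoc)+
  have 2: "D j * (U k * D k) = U k * D k * D j"
    by (metis DD UD assms False mult.assoc)
  have "D j * (U k * D k * (\<iota> k * e k)) = U k * D k * (\<iota> k * e k) * D j"
    by (metis 1(2) 2 mult.assoc)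
  then show ?thesis using False 1 central[of "D j"] unfolding piD_def by (simp add: algebra_simps)
qed

lemma D_rprod_eq_0:
  assumes "\<And>k. k < l \<Longrightarrow> D j * \<pi> k = (if j = k then 0 else \<pi> k * D j)" and "j < m" "m \<le> l"
  shows "D j * rprod \<pi> m = 0"
  using assms(2,3)
proof (induction m)
  case (Suc m)
  show ?case
  proof (cases "j = m")
    case True
    then show ?thesis using assms(1)[of m] Suc.prems by (simp add: mult.assoc[symmetric])
  next
    case False
    then have "D j * rprod \<pi> (Suc m) = \<pi> m * (D j * rprod \<pi> m)"
      using assms(1)[of m] Suc.prems by (simp add: mult.assoc[symmetric])
    then show ?thesis using Suc False by simp
  qed
qed simp

text \<open>\<open>D j\<close> passes the factors with other indices and kills the factor with index
  \<open>j\<close>, where \<open>D j * U j = 1\<close> turns the defect into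
  \<open>\<delta> - (e j * \<iota> j + \<iota> j * e j) = 0\<close>. Thus \<open>AS\<close> only
  produces elements with all exponents 0.\<close>

lemma D_AS: "j < l \<Longrightarrow> D j * AS = 0"
  unfolding AS_def by (rule D_rprod_eq_0) (auto simp: D_piS)

lemma D_AD: "j < l \<Longrightarrow> D j * AD = 0"
  unfolding AD_def by (rule D_rprod_eq_0) (auto simp: D_piD)

lemma piS_eq: "k < l \<Longrightarrow> piS k = e k * \<iota> k - e k * \<iota> k * (U k * D k)"
proof -
  assume k: "k < l"
  have "D k * (e k * \<iota> k) = e k * \<iota> k * D k" "U k * (e k * \<iota> k) = e k * \<iota> k * U k"
    by (metis De Di k mult.assoc, metis Ue Ui k mult.assoc)
  then have "U k * D k * (e k * \<iota> k) = e k * \<iota> k * (U k * D k)"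
    by (metis mult.assoc)
  then show ?thesis using ei[OF k k] unfolding piS_def by (simp add: algebra_simps)
qed

lemma piD_eq: "k < l \<Longrightarrow> piD k = \<iota> k * e k - \<iota> k * e k * (U k * D k)"
proof -
  assume k: "k < l"
  have "D k * (\<iota> k * e k) = \<iota> k * e k * D k" "U k * (\<iota> k * e k) = \<iota> k * e k * U k"
    by (metis De Di k mult.assoc, metis Ue Ui k mult.assoc)
  then have "U k * D k * (\<iota> k * e k) = \<iota> k * e k * (U k * D k)"
    by (metis mult.assoc)
  then show ?thesis using ei[OF k k] unfolding piD_def by (simp add: algebra_simps)
qed

end

section \<open>Linear operators on functions\<close>

text \<open>The third clause allows an operator to be applied modulo an ideal, which is how
  exactness is pushed through the quotients by a weakly regular sequence.\<close>

definition lin :: "(('i \<Rightarrow> 'a::comm_ring_1) \<Rightarrow> 'i \<Rightarrow> 'a) \<Rightarrow> bool" where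
  "lin T \<longleftrightarrow> (\<forall>f g. T (\<lambda>x. f x + g x) = (\<lambda>x. T f x + T g x))
     \<and> (\<forall>c f. T (\<lambda>x. c * f x) = (\<lambda>x. c * T f x))
     \<and> (\<forall>J f. is_ideal J \<longrightarrow> (\<forall>x. f x \<in> J) \<longrightarrow> (\<forall>x. T f x \<in> J))"

lemma is_ideal_0: "is_ideal J \<Longrightarrow> 0 \<in> J"
  and is_ideal_add: "is_ideal J \<Longrightarrow> x \<in> J \<Longrightarrow> y \<in> J \<Longrightarrow> x + y \<in> J"
  and is_ideal_mult: "is_ideal J \<Longrightarrow> x \<in> J \<Longrightarrow> r * x \<in> J"
  by (auto simp: is_ideal_def)

lemma is_ideal_mult_right: "is_ideal J \<Longrightarrow> x \<in> J \<Longrightarrow> x * r \<in> J"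
  using is_ideal_mult[of J x r] by (simp add: mult.commute)

lemma is_ideal_uminus: "is_ideal J \<Longrightarrow> x \<in> J \<Longrightarrow> - x \<in> J"
  using is_ideal_mult[of J x "- 1"] by simp

lemma is_ideal_diff: "is_ideal J \<Longrightarrow> x \<in> J \<Longrightarrow> y \<in> J \<Longrightarrow> x - y \<in> J"
  using is_ideal_add[of J x "- y"] is_ideal_uminus[of J y] by simp

lemma is_ideal_sum: "is_ideal J \<Longrightarrow> (\<And>i. i \<in> A \<Longrightarrow> f i \<in> J) \<Longrightarrow> sum f A \<in> J"
  by (induction A rule: infinite_finite_induct) (auto simp: is_ideal_0 is_ideal_add)

lemma lin_add: "lin T \<Longrightarrow> T (\<lambda>x. f x + g x) = (\<lambda>x. T f x + T g x)"
  and lin_scale: "lin T \<Longrightarrow> T (\<lambda>x. c * f x) = (\<lambda>x. c * T f x)"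
  and lin_ideal: "lin T \<Longrightarrow> is_ideal J \<Longrightarrow> (\<And>x. f x \<in> J) \<Longrightarrow> T f x \<in> J"
  by (auto simp: lin_def)

text \<open>As a type of their own the operators form a ring under composition, so that the
  identities of the abstract locales apply to them.\<close>

typedef (overloaded) ('i, 'a::comm_ring_1) op = "{T :: ('i \<Rightarrow> 'a) \<Rightarrow> 'i \<Rightarrow> 'a. lin T}"
  morphisms ap Op
  by (rule exI[of _ "\<lambda>f. f"]) (simp add: lin_def)

lemma lin_ap: "lin (ap T)"
  using ap[of T] by simp

lemma ap_Op: "lin T \<Longrightarrow> ap (Op T) = T"
  by (simp add: Op_inverse)

lemma op_eqI: "(\<And>f x. ap S f x = ap T f x) \<Longrightarrow> S = T"
  by (metis ap_inject ext)

lemmas ap_add = lin_add[OF lin_ap]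
  and ap_scale = lin_scale[OF lin_ap]
  and ap_ideal = lin_ideal[OF lin_ap]

lemma ap_zero: "ap T (\<lambda>_. 0) = (\<lambda>_. 0)"
  using ap_scale[of T 0 "\<lambda>_. 0"] by simp

lemma ap_uminus: "ap T (\<lambda>x. - f x) = (\<lambda>x. - ap T f x)"
  using ap_scale[of T "- 1" f] by simp

lemma ap_diff: "ap T (\<lambda>x. f x - g x) = (\<lambda>x. ap T f x - ap T g x)"
  using ap_add[of T f "\<lambda>x. - g x"] by (simp add: ap_uminus)

instantiation op :: (type, comm_ring_1) ring_1
begin

definition "0 = Op (\<lambda>f x. 0)"
definition "1 = Op (\<lambda>f. f)"
definition "S + T = Op (\<lambda>f x. ap S f x + ap T f x)"
definition "- T = Op (\<lambda>f x. - ap T f x)"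
definition "S - T = Op (\<lambda>f x. ap S f x - ap T f x)"
definition "S * T = Op (\<lambda>f. ap S (ap T f))"

lemma ap_op:
  "ap 0 f = (\<lambda>x. 0)" "ap 1 f = f"
  "ap (S + T) f = (\<lambda>x. ap S f x + ap T f x)"
  "ap (- T) f = (\<lambda>x. - ap T f x)"
  "ap (S - T) f = (\<lambda>x. ap S f x - ap T f x)"
  "ap (S * T) f = ap S (ap T f)"
proof -
  show "ap 0 f = (\<lambda>x. 0)"
    unfolding zero_op_def by (subst ap_Op) (auto simp: lin_def is_ideal_0)
  show "ap 1 f = f"
    unfolding one_op_def by (subst ap_Op) (auto simp: lin_def)
  have "lin (\<lambda>f x. ap S f x + ap T f x)"
    by (auto simp: lin_def ap_add ap_scale algebra_simps intro!: is_ideal_add ap_ideal)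
  then show "ap (S + T) f = (\<lambda>x. ap S f x + ap T f x)" unfolding plus_op_def by (simp add: ap_Op)
  have "lin (\<lambda>f x. - ap T f x)"
    by (auto simp: lin_def ap_add ap_scale algebra_simps intro!: is_ideal_uminus ap_ideal)
  then show "ap (- T) f = (\<lambda>x. - ap T f x)" unfolding uminus_op_def by (simp add: ap_Op)
  have "lin (\<lambda>f x. ap S f x - ap T f x)"
    by (auto simp: lin_def ap_add ap_scale algebra_simps intro!: is_ideal_diff ap_ideal)
  then show "ap (S - T) f = (\<lambda>x. ap S f x - ap T f x)" unfolding minus_op_def by (simp add: ap_Op)
  have "lin (\<lambda>f. ap S (ap T f))"
    by (auto simp: lin_def ap_add ap_scale intro!: ap_ideal)
  then show "ap (S * T) f = ap S (ap T f)" unfolding times_op_def by (simp add: ap_Op)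
qed

instance
proof
  show "(0::('a, 'b) op) \<noteq> 1"
  proof
    assume "(0::('a, 'b) op) = 1"
    then have "ap (0::('a, 'b) op) (\<lambda>_. 1) = ap 1 (\<lambda>_. 1)" by simp
    then show False by (simp add: ap_op fun_eq_iff)
  qed
qed (auto intro!: op_eqI simp: ap_op ap_add algebra_simps)

end

lemma ap_sum_op: "ap (\<Sum>i\<in>A. T i) f = (\<lambda>x. \<Sum>i\<in>A. ap (T i) f x)"
  by (induction A rule: infinite_finite_induct) (simp_all add: ap_op)

definition scal :: "'a::comm_ring_1 \<Rightarrow> ('i, 'a) op" where
  "scal c = Op (\<lambda>f x. c * f x)"

lemma ap_scal: "ap (scal c) f = (\<lambda>x. c * f x)"
  unfolding scal_def by (subst ap_Op) (auto simp: lin_def algebra_simps is_ideal_mult)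

lemma scal_commute: "scal c * T = T * scal c"
  by (rule op_eqI) (simp add: ap_op ap_scal ap_scale)

lemma scal_0: "scal 0 = 0" and scal_1: "scal 1 = 1"
  and scal_mult: "scal (c * d) = scal c * scal d"
  and scal_add: "scal (c + d) = scal c + scal d"
  by (rule op_eqI, simp add: ap_op ap_scal algebra_simps)+

lemma scal_power: "scal (c ^ n) = scal c ^ n"
  by (induction n) (simp_all add: scal_1 scal_mult)

lemma scal_sum: "scal (\<Sum>i\<in>A. c i) = (\<Sum>i\<in>A. scal (c i))"
  by (induction A rule: infinite_finite_induct) (simp_all add: scal_0 scal_add)

section \<open>Weakly regular sequences\<close>

definition adjoin :: "'a::comm_ring_1 set \<Rightarrow> 'a \<Rightarrow> 'a set" where
  "adjoin J a = {j + a * r | j r. j \<in> J}"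

text \<open>In contrast to \<open>regular_seq\<close> the final ideal may be the whole ring; the
  unit ideal, whose grade is infinite, then contains such sequences of every length.\<close>

primrec wreg :: "'a::comm_ring_1 set \<Rightarrow> 'a list \<Rightarrow> bool" where
  "wreg J [] \<longleftrightarrow> True"
| "wreg J (a # xs) \<longleftrightarrow> (\<forall>y. a * y \<in> J \<longrightarrow> y \<in> J) \<and> wreg (adjoin J a) xs"

definition rad :: "'a::comm_ring_1 set \<Rightarrow> 'a set" where
  "rad Q = {a. \<exists>N. a ^ N \<in> Q}"

lemma is_ideal_adjoin:
  assumes "is_ideal J" shows "is_ideal (adjoin J a)"
  unfolding is_ideal_def
proof (intro conjI ballI allI)
  show "0 \<in> adjoin J a"
    unfolding adjoin_def using is_ideal_0[OF assms] by (intro CollectI exI[of _ 0]) simp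
next
  fix x y assume "x \<in> adjoin J a" "y \<in> adjoin J a"
  then obtain j r k s where "x = j + a * r" "y = k + a * s" "j \<in> J" "k \<in> J"
    by (auto simp: adjoin_def)
  then show "x + y \<in> adjoin J a"
    unfolding adjoin_def using is_ideal_add[OF assms]
    by (intro CollectI exI[of _ "j + k"] exI[of _ "r + s"]) (simp add: algebra_simps)
next
  fix c x assume "x \<in> adjoin J a"
  then obtain j r where "x = j + a * r" "j \<in> J" by (auto simp: adjoin_def)
  then show "c * x \<in> adjoin J a"
    unfolding adjoin_def using is_ideal_mult[OF assms, of j c]
    by (intro CollectI exI[of _ "c * j"] exI[of _ "c * r"]) (simp add: distrib_left mult.left_commute)
qed

lemma adjoin_superset: "j \<in> J \<Longrightarrow> j \<in> adjoin J a"
  unfolding adjoin_def by (intro CollectI exI[of _ j] exI[of _ 0]) simp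

lemma adjoin_generator: "is_ideal J \<Longrightarrow> a * r \<in> adjoin J a"
  unfolding adjoin_def by (intro CollectI exI[of _ 0] exI[of _ r]) (simp add: is_ideal_0)

lemma adjoin_commute: "adjoin (adjoin J a) b = adjoin (adjoin J b) a"
  unfolding adjoin_def by (auto simp: algebra_simps) (metis add.assoc add.commute)+

text \<open>The hypothesis on quotients by powers of \<open>a\<close> is the colon ideal identity
  \<open>(J + (a\<^sup>N)) : a = J + (a\<^sup>N\<^sup>-\<^sup>1)\<close>, which is inherited by \<open>J + (b)\<close> for \<open>b\<close> regular modulo \<open>J + (a)\<close>.\<close>

lemma wreg_colon:
  assumes J: "is_ideal J"
    and colon: "\<And>y N. a * y \<in> adjoin J (a ^ Suc N) \<Longrightarrow> y \<in> adjoin J (a ^ N)"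
    and "wreg (adjoin J a) xs"
  shows "wreg (adjoin J (a ^ N)) xs"
  using assms
proof (induction xs arbitrary: J)
  case (Cons b xs)
  note J = Cons.prems(1) and colon = Cons.prems(2)
  have reg: "\<And>y. b * y \<in> adjoin J a \<Longrightarrow> y \<in> adjoin J a"
    and rest: "wreg (adjoin (adjoin J b) a) xs"
    using Cons.prems(3) by (auto simp: adjoin_commute[of J a b])
  have Jb: "is_ideal (adjoin J b)" by (rule is_ideal_adjoin[OF J])
  \<comment> \<open>Modulo \<open>a\<close> the element \<open>b\<close> cancels, leaving
    \<open>y = j' + a * y'\<close>; the colon hypothesis strips this factor \<open>a\<close> and
    lowers \<open>N\<close> by one.\<close>
  have regN: "b * y \<in> adjoin J (a ^ N) \<Longrightarrow> y \<in> adjoin J (a ^ N)" for y N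
  proof (induction N arbitrary: y)
    case 0
    have "1 * y \<in> adjoin J 1" by (rule adjoin_generator[OF J])
    then show ?case by simp
  next
    case (Suc N)
    then obtain j r where jr: "b * y = j + a ^ Suc N * r" "j \<in> J" by (auto simp: adjoin_def)
    have "b * y \<in> adjoin J a"
      unfolding jr adjoin_def using jr(2) by (auto simp: mult.assoc)
    from reg[OF this] obtain j' y' where y: "y = j' + a * y'" "j' \<in> J" by (auto simp: adjoin_def)
    have "a * (b * y') = (j - b * j') + a ^ Suc N * r"
      using jr(1) unfolding y(1) by (simp add: algebra_simps)
    then have "a * (b * y') \<in> adjoin J (a ^ Suc N)"
      unfolding adjoin_def using jr(2) y(2) J is_ideal_diff is_ideal_mult by blast
    from Suc.IH[OF colon[OF this]] obtain k s where "y' = k + a ^ N * s" "k \<in> J"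
      by (auto simp: adjoin_def)
    then have "y = (j' + a * k) + a ^ Suc N * s" "j' + a * k \<in> J"
      using y is_ideal_add[OF J] is_ideal_mult[OF J] by (auto simp: distrib_left mult.assoc)
    then show ?case unfolding adjoin_def by blast
  qed
  \<comment> \<open>Regularity of \<open>b\<close> modulo \<open>J + (a)\<close> splits the
    coefficient \<open>w\<close> into an element of \<open>J\<close> and a multiple of
    \<open>a\<close>. The multiple is moved into \<open>y\<close>, and the colon property of
    \<open>J\<close> itself applies.\<close>
  have colon': "y \<in> adjoin (adjoin J b) (a ^ N)"
    if "a * y \<in> adjoin (adjoin J b) (a ^ Suc N)" for y N
  proof -
    from that obtain j w r where e: "a * y = j + b * w + a ^ Suc N * r" "j \<in> J"
      by (auto simp: adjoin_def)
    have "b * w = - j + a * (y - a ^ N * r)" using e(1) by (simp add: algebra_simps)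
    then have "b * w \<in> adjoin J a"
      unfolding adjoin_def using is_ideal_uminus[OF J e(2)] by blast
    from reg[OF this] obtain k w' where w: "w = k + a * w'" "k \<in> J" by (auto simp: adjoin_def)
    have "a * (y - b * w') = (j + b * k) + a ^ Suc N * r"
      using e(1) unfolding w(1) by (simp add: algebra_simps)
    then have "a * (y - b * w') \<in> adjoin J (a ^ Suc N)"
      unfolding adjoin_def using is_ideal_add[OF J e(2) is_ideal_mult[OF J w(2)]] by blast
    from colon[OF this] have "y - b * w' \<in> adjoin J (a ^ N)" .
    then have "b * w' + (y - b * w') \<in> adjoin (adjoin J b) (a ^ N)"
      using is_ideal_add[OF is_ideal_adjoin[OF Jb]] adjoin_superset adjoin_generator[OF J]
      by (metis adjoin_commute)
    then show ?thesis by simp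
  qed
  show ?case
    using regN Cons.IH[OF Jb colon' rest] by (simp add: adjoin_commute)
qed simp

lemma wreg_power:
  assumes J: "is_ideal J" and "wreg J (a # xs)"
  shows "wreg J (a ^ N # xs)"
proof -
  have reg: "\<And>y. a * y \<in> J \<Longrightarrow> y \<in> J" and rest: "wreg (adjoin J a) xs" using assms(2) by auto
  have "a ^ N * y \<in> J \<Longrightarrow> y \<in> J" for y
    by (induction N) (auto simp: mult.assoc intro: reg)
  moreover have "y \<in> adjoin J (a ^ N)" if "a * y \<in> adjoin J (a ^ Suc N)" for y N
  proof -
    from that obtain j r where e: "a * y = j + a ^ Suc N * r" "j \<in> J" by (auto simp: adjoin_def)
    then have "a * (y - a ^ N * r) \<in> J" by (simp add: algebra_simps)
    from reg[OF this] have "(y - a ^ N * r) + a ^ N * r \<in> adjoin J (a ^ N)"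
      unfolding adjoin_def by blast
    then show ?thesis by simp
  qed
  ultimately show ?thesis using wreg_colon[OF J _ rest] by simp
qed

text \<open>The entries are replaced by powers from left to right, each replacement keeping the tail
  weakly regular. This matters because only powers of minors are known to be null-homotopic.\<close>

lemma wreg_in_radical:
  assumes "is_ideal J" "wreg J xs" "set xs \<subseteq> rad Q"
  shows "\<exists>ys. length ys = length xs \<and> set ys \<subseteq> Q \<and> wreg J ys"
  using assms
proof (induction xs arbitrary: J)
  case (Cons a xs)
  then obtain N where N: "a ^ N \<in> Q" by (auto simp: rad_def)
  have w: "wreg J (a ^ N # xs)" by (rule wreg_power) (use Cons.prems in auto)
  obtain ys where "length ys = length xs" "set ys \<subseteq> Q" "wreg (adjoin J (a ^ N)) ys"
    using Cons.IH[of "adjoin J (a ^ N)"] is_ideal_adjoin w Cons.prems by auto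
  then show ?case using N w by (intro exI[of _ "a ^ N # ys"]) auto
qed simp

lemma is_ideal_rad:
  assumes Q: "is_ideal Q" shows "is_ideal (rad Q)"
  unfolding is_ideal_def
proof (intro conjI ballI allI)
  have "(0::'a) ^ 1 \<in> Q" using is_ideal_0[OF Q] by simp
  then show "0 \<in> rad Q" unfolding rad_def by blast
next
  fix x y assume "x \<in> rad Q" "y \<in> rad Q"
  then obtain M N where MN: "x ^ M \<in> Q" "y ^ N \<in> Q" by (auto simp: rad_def)
  have "(x + y) ^ (M + N) = (\<Sum>k\<le>M + N. of_nat (M + N choose k) * x ^ k * y ^ (M + N - k))"
    by (rule binomial_ring)
  also have "\<dots> \<in> Q"
  proof (rule is_ideal_sum[OF Q])
    fix k assume "k \<in> {..M + N}"
    show "of_nat (M + N choose k) * x ^ k * y ^ (M + N - k) \<in> Q"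
    proof (cases "M \<le> k")
      case True
      then have "x ^ k = x ^ (k - M) * x ^ M" by (simp flip: power_add)
      then show ?thesis using MN(1) is_ideal_mult[OF Q] is_ideal_mult_right[OF Q] by simp
    next
      case False
      then have "y ^ (M + N - k) = y ^ (M - k) * y ^ N" by (simp flip: power_add)
      then show ?thesis using MN(2) is_ideal_mult[OF Q] by simp
    qed
  qed
  finally show "x + y \<in> rad Q" by (auto simp: rad_def)
next
  fix r x assume "x \<in> rad Q"
  then show "r * x \<in> rad Q"
    by (auto simp: rad_def power_mult_distrib intro: is_ideal_mult[OF Q])
qed

section \<open>Exactness from null-homotopies\<close>

text \<open>The term with basis \<open>S\<close> is encoded by the functions vanishing off
  \<open>S\<close>, so that all terms of a complex share one ring of operators.\<close>

definition on :: "'i set \<Rightarrow> ('i \<Rightarrow> 'a::zero) \<Rightarrow> bool" where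
  "on S f \<longleftrightarrow> (\<forall>x. x \<notin> S \<longrightarrow> f x = 0)"

lemma on_zero: "on S (\<lambda>_. 0)"
  and on_add: "on S f \<Longrightarrow> on S g \<Longrightarrow> on S (\<lambda>x. f x + g x :: 'a::comm_ring_1)"
  and on_diff: "on S f \<Longrightarrow> on S g \<Longrightarrow> on S (\<lambda>x. f x - g x :: 'a::comm_ring_1)"
  and on_scale: "on S f \<Longrightarrow> on S (\<lambda>x. c * f x :: 'a::comm_ring_1)"
  and on_empty: "on {} f \<longleftrightarrow> f = (\<lambda>_. 0)"
  by (auto simp: on_def)

definition nullh :: "(nat \<Rightarrow> 'i set) \<Rightarrow> (nat \<Rightarrow> ('i, 'a::comm_ring_1) op) \<Rightarrow> 'a \<Rightarrow> bool" where
  "nullh B d a \<longleftrightarrow> (\<exists>k. (\<forall>p f. on (B (Suc p)) f \<longrightarrow> on (B p) (ap (k p) f))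
     \<and> (\<forall>f. on (B 0) f \<longrightarrow> ap (scal a) f = ap (k 0 * d 0) f)
     \<and> (\<forall>p f. on (B (Suc p)) f \<longrightarrow> ap (scal a) f = ap (k (Suc p) * d (Suc p) + d p * k p) f))"

lemma nullh_add: "nullh B d a \<Longrightarrow> nullh B d b \<Longrightarrow> nullh B d (a + b)"
  unfolding nullh_def
proof (elim exE conjE, goal_cases)
  case (1 k k')
  then show ?case
    by (intro exI[of _ "\<lambda>p. k p + k' p"])
      (simp add: scal_add ap_op ap_add on_add, simp add: algebra_simps)
qed

lemma nullh_mult: "nullh B d a \<Longrightarrow> nullh B d (c * a)"
  unfolding nullh_def
proof (elim exE conjE, goal_cases)
  case (1 k)
  then show ?case
    by (intro exI[of _ "\<lambda>p. scal c * k p"])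
      (simp add: scal_mult ap_op ap_scal ap_scale on_scale, simp add: algebra_simps)
qed

lemma nullh_0: "nullh B d 0"
  unfolding nullh_def by (rule exI[of _ "\<lambda>_. 0"]) (simp add: ap_op on_zero ap_zero scal_0)

text \<open>Null-homotopy up to powers of \<open>\<delta>\<close> stands for null-homotopy after
  inverting \<open>\<delta>\<close>. The ideal property extends what is known for single minors to
  the ideal they generate.\<close>

lemma is_ideal_nullh: "is_ideal {a. \<exists>N. nullh B d (\<delta> ^ N * a)}"
proof -
  have "nullh B d (\<delta> ^ (M + N) * (x + y))"
    if "nullh B d (\<delta> ^ M * x)" "nullh B d (\<delta> ^ N * y)" for x y M N
  proof -
    have "nullh B d (\<delta> ^ N * (\<delta> ^ M * x) + \<delta> ^ M * (\<delta> ^ N * y))"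
      using that by (intro nullh_add) (auto intro: nullh_mult)
    then show ?thesis by (simp add: algebra_simps power_add)
  qed
  moreover have "nullh B d (\<delta> ^ N * (r * x))" if "nullh B d (\<delta> ^ N * x)" for r x N
    using nullh_mult[OF that, of r] by (simp add: mult.left_commute)
  ultimately show ?thesis
    unfolding is_ideal_def by (auto simp: nullh_0 simp del: power_Suc) blast+
qed

text \<open>Up to powers of \<open>\<delta>\<close>, the homotopy for the head \<open>a\<close>
  gives \<open>a * f \<equiv> d w\<close> modulo \<open>J\<close>. Hence \<open>w\<close> is a cycle
  modulo \<open>J + (a)\<close>, one position lower and for a sequence shorter by one. By induction
  \<open>w \<equiv> z + a * v\<close> modulo \<open>J\<close> with \<open>z\<close> a boundary.
  Applying \<open>d\<close> removes \<open>z\<close>, and \<open>a\<close> cancels from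
  \<open>a * f \<equiv> a * d v\<close> because it is regular modulo \<open>J\<close>.\<close>

lemma exact_up_to_power:
  fixes B :: "nat \<Rightarrow> 'i set" and d :: "nat \<Rightarrow> ('i, 'a::comm_ring_1) op"
  assumes dB: "\<And>p f. on (B p) f \<Longrightarrow> on (B (Suc p)) (ap (d p) f)"
    and dd: "\<And>p f. on (B p) f \<Longrightarrow> ap (d (Suc p)) (ap (d p) f) = (\<lambda>_. 0)"
    and J: "is_ideal J" and "wreg J xs" "\<And>a. a \<in> set xs \<Longrightarrow> \<exists>N. nullh B d (\<delta> ^ N * a)"
    and "p < length xs" and "on (B p) f" and "\<And>x. ap (d p) f x \<in> J"
  shows "\<exists>M. case p of 0 \<Rightarrow> \<forall>x. \<delta> ^ M * f x \<in> J
    | Suc q \<Rightarrow> \<exists>y. on (B q) y \<and> (\<forall>x. \<delta> ^ M * f x - ap (d q) y x \<in> J)"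
  using assms(3-)
proof (induction p arbitrary: J xs f)
  case 0
  then obtain a xs' where xs: "xs = a # xs'" by (cases xs) auto
  from 0(3)[of a] obtain N where N: "nullh B d (\<delta> ^ N * a)" by (auto simp: xs)
  then obtain k where "ap (scal (\<delta> ^ N * a)) f = ap (k 0) (ap (d 0) f)"
    using 0 by (auto simp: nullh_def ap_op)
  then have "a * (\<delta> ^ N * f x) \<in> J" for x
    using ap_ideal[OF 0(1), of "ap (d 0) f" "k 0" x] 0(6)
    by (simp add: ap_scal fun_eq_iff algebra_simps)
  then have "\<delta> ^ N * f x \<in> J" for x using 0(2) by (auto simp: xs)
  then show ?case by auto
next
  case (Suc p)
  then obtain a xs' where xs: "xs = a # xs'" by (cases xs) auto
  define J' where "J' = adjoin J a"
  have J': "is_ideal J'" unfolding J'_def by (rule is_ideal_adjoin) (use Suc in auto)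
  from Suc.prems(3)[of a] obtain N where N: "nullh B d (\<delta> ^ N * a)" by (auto simp: xs)
  then obtain k where k: "ap (scal (\<delta> ^ N * a)) f = ap (k (Suc p) * d (Suc p) + d p * k p) f"
    "on (B p) (ap (k p) f)"
    using Suc.prems by (auto simp: nullh_def)
  define w where "w = ap (k p) f"
  define c where "c = ap (k (Suc p)) (ap (d (Suc p)) f)"
  have cJ: "c x \<in> J" for x unfolding c_def by (rule ap_ideal) (use Suc.prems in auto)
  have kf: "a * (\<delta> ^ N * f x) = c x + ap (d p) w x" for x
    using k(1) by (simp add: ap_op ap_scal fun_eq_iff c_def w_def algebra_simps)
  have dw: "ap (d p) w x \<in> J'" for x
  proof -
    have "ap (d p) w x = - c x + a * (\<delta> ^ N * f x)" using kf[of x] by simp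
    then show ?thesis unfolding J'_def adjoin_def using is_ideal_uminus[OF Suc.prems(1) cJ] by blast
  qed
  have ex: "\<exists>M. case p of 0 \<Rightarrow> \<forall>x. \<delta> ^ M * w x \<in> J'
      | Suc q \<Rightarrow> \<exists>y. on (B q) y \<and> (\<forall>x. \<delta> ^ M * w x - ap (d q) y x \<in> J')"
  proof (rule Suc.IH[OF J'])
    show "wreg J' xs'" using Suc.prems(2) by (simp add: xs J'_def)
    show "\<exists>N. nullh B d (\<delta> ^ N * b)" if "b \<in> set xs'" for b
      by (rule Suc.prems(3)) (use that in \<open>simp add: xs\<close>)
    show "p < length xs'" using Suc.prems(4) by (simp add: xs)
    show "on (B p) w" using k(2) by (simp add: w_def)
  qed (rule dw)
  then obtain M z where z: "on (B p) z" "ap (d p) z = (\<lambda>_. 0)" "\<And>x. \<delta> ^ M * w x - z x \<in> J'"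
  proof (cases p)
    case 0
    with ex obtain M where "\<forall>x. \<delta> ^ M * w x \<in> J'" by auto
    then show ?thesis using that[of "\<lambda>_. 0" M] by (simp add: on_zero ap_zero)
  next
    case (Suc q)
    with ex obtain M y where y: "on (B q) y" "\<forall>x. \<delta> ^ M * w x - ap (d q) y x \<in> J'" by auto
    show ?thesis using that[of "ap (d q) y" M] dB[OF y(1)] dd[OF y(1)] y(2) Suc by simp
  qed
  have "\<exists>r. \<delta> ^ M * w x - z x - a * r \<in> J" for x
  proof -
    obtain j s where "\<delta> ^ M * w x - z x = j + a * s" "j \<in> J"
      using z(3)[of x] by (auto simp: J'_def adjoin_def)
    then have "\<delta> ^ M * w x - z x - a * s \<in> J" by simp
    then show ?thesis by blast
  qed
  then obtain r where r: "\<And>x. \<delta> ^ M * w x - z x - a * r x \<in> J" by metis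
  \<comment> \<open>The coefficients \<open>r\<close> are chosen pointwise and may be nonzero
    outside the basis \<open>B p\<close>; there \<open>w\<close> and \<open>z\<close> vanish, so
    truncation does no harm.\<close>
  define v where "v x = (if x \<in> B p then r x else 0)" for x
  define u where "u x = \<delta> ^ M * w x - z x - a * v x" for x
  have v: "on (B p) v" by (simp add: on_def v_def)
  have u: "u x \<in> J" for x
    using r[of x] k(2) z(1) is_ideal_0[OF Suc.prems(1)]
    by (cases "x \<in> B p") (auto simp: u_def v_def w_def on_def)
  have "(\<lambda>x. \<delta> ^ M * w x) = (\<lambda>x. u x + (z x + a * v x))" by (simp add: u_def algebra_simps)
  from arg_cong[where f = "ap (d p)", OF this]
  have dv: "\<delta> ^ M * ap (d p) w x = ap (d p) u x + a * ap (d p) v x" for x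
    by (simp add: ap_add ap_scale z(2) fun_eq_iff)
  have "a * (\<delta> ^ (M + N) * f x - ap (d p) v x) \<in> J" for x
  proof -
    have "a * (\<delta> ^ (M + N) * f x - ap (d p) v x)
        = \<delta> ^ M * (a * (\<delta> ^ N * f x)) - a * ap (d p) v x"
      by (simp add: algebra_simps power_add)
    also have "\<dots> = \<delta> ^ M * c x + ap (d p) u x"
      unfolding kf using dv[of x] by (simp add: algebra_simps)
    also have "\<dots> \<in> J"
      by (intro is_ideal_add is_ideal_mult Suc.prems(1) cJ ap_ideal u)
    finally show ?thesis .
  qed
  then have "\<delta> ^ (M + N) * f x - ap (d p) v x \<in> J" for x using Suc.prems(2) by (auto simp: xs)
  then show ?case using v by auto
qed

section \<open>Graded Koszul complexes\<close>

text \<open>\<open>B a c\<close> is the basis in exponent degree \<open>a\<close> and exterior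
  degree \<open>c\<close>. Integer degrees make every step out of range land in an empty component.
  \<open>D_inj\<close> is the property that forces the homotopy defects to vanish off degree
  0.\<close>

locale graded_koszul_ops = koszul_ops l e U D
  for l :: nat and e U D :: "nat \<Rightarrow> ('i, 'a::comm_ring_1) op" +
  fixes B :: "int \<Rightarrow> int \<Rightarrow> 'i set"
  assumes B_neg: "a < 0 \<or> c < 0 \<Longrightarrow> B a c = {}"
    and on_e: "\<And>a c f j. j < l \<Longrightarrow> on (B a c) f \<Longrightarrow> on (B a (c + 1)) (ap (e j) f)"
    and on_U: "\<And>a c f j. j < l \<Longrightarrow> on (B a c) f \<Longrightarrow> on (B (a + 1) c) (ap (U j) f)"
    and on_D: "\<And>a c f j. j < l \<Longrightarrow> on (B a c) f \<Longrightarrow> on (B (a - 1) c) (ap (D j) f)"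
    and D_inj: "\<And>a c f. a \<noteq> 0 \<Longrightarrow> on (B a c) f \<Longrightarrow> (\<And>j. j < l \<Longrightarrow> ap (D j) f = (\<lambda>_. 0)) \<Longrightarrow> f = (\<lambda>_. 0)"
begin

definition gr :: "('i, 'a) op \<Rightarrow> int \<Rightarrow> int \<Rightarrow> bool" where
  "gr T a c \<longleftrightarrow> (\<forall>x y f. on (B x y) f \<longrightarrow> on (B (x + a) (y + c)) (ap T f))"

lemma grD: "gr T a c \<Longrightarrow> on (B x y) f \<Longrightarrow> x' = x + a \<Longrightarrow> y' = y + c \<Longrightarrow> on (B x' y') (ap T f)"
  by (auto simp: gr_def)

lemma gr_mult: "gr S a c \<Longrightarrow> gr T a' c' \<Longrightarrow> x = a + a' \<Longrightarrow> y = c + c' \<Longrightarrow> gr (S * T) x y"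
  unfolding gr_def[of "S * T"] ap_op by (auto intro: grD)

lemma gr_add: "gr S a c \<Longrightarrow> gr T a c \<Longrightarrow> gr (S + T) a c"
  and gr_diff: "gr S a c \<Longrightarrow> gr T a c \<Longrightarrow> gr (S - T) a c"
  and gr_0: "gr 0 a c" and gr_1: "gr 1 0 0" and gr_scal: "gr (scal r) 0 0"
  by (auto simp: gr_def ap_op ap_scal on_add on_diff on_zero on_scale)

lemma gr_sum: "(\<And>i. i \<in> A \<Longrightarrow> gr (T i) a c) \<Longrightarrow> gr (sum T A) a c"
  by (induction A rule: infinite_finite_induct) (auto simp: gr_0 gr_add)

lemma gr_e: "j < l \<Longrightarrow> gr (e j) 0 1" and gr_U: "j < l \<Longrightarrow> gr (U j) 1 0"
  and gr_D: "j < l \<Longrightarrow> gr (D j) (- 1) 0"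
  using on_e on_U on_D by (auto simp: gr_def)

lemma gr_lprod_e: "k \<le> l \<Longrightarrow> gr (lprod e k) 0 (int k)"
  by (induction k) (auto intro!: gr_1 gr_mult[OF _ gr_e])

lemma gr_X: "gr X 0 (int l)"
  unfolding X_def by (simp add: gr_lprod_e)

lemma gr_dS: "gr dS 1 1" and gr_dD: "gr dD (- 1) 1"
  unfolding dS_def dD_def by (auto intro!: gr_sum gr_mult gr_e gr_U gr_D)

lemma on_neg: "on (B a c) f \<Longrightarrow> a < 0 \<or> c < 0 \<Longrightarrow> f = (\<lambda>_. 0)"
  using B_neg[of a c] by (auto simp: on_def)

text \<open>The paper's \<open>\<D>\<^sub>\<phi>(u)\<close> in position \<open>p\<close>, for an arbitrary bigraded family \<open>B\<close>.\<close>

definition Cx :: "nat \<Rightarrow> nat \<Rightarrow> 'i set" where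
  "Cx u p = (if p \<le> u then B (int u - int p) (int p) else B (int p - int u - 1) (int p + int l - 1))"

definition dx :: "nat \<Rightarrow> nat \<Rightarrow> ('i, 'a) op" where
  "dx u p = (if p < u then dD else if p = u then X else dS)"

lemma on_dx: "on (Cx u p) f \<Longrightarrow> on (Cx u (Suc p)) (ap (dx u p) f)"
  by (auto simp: Cx_def dx_def intro: grD[OF gr_dS] grD[OF gr_dD] grD[OF gr_X])

lemma dx_dx: "dx u (Suc p) * dx u p = 0"
  by (auto simp: dx_def dS_dS dD_dD X_dD dS_X)

end

locale graded_koszul_homotopy =
  graded_koszul_ops l e U D B + koszul_homotopy l e U D \<iota> "scal \<delta>"
  for l :: nat and e U D :: "nat \<Rightarrow> ('i, 'a::comm_ring_1) op" and B
    and \<iota> :: "nat \<Rightarrow> ('i, 'a) op" and \<delta> :: 'a +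
  assumes on_i: "\<And>a c f j. j < l \<Longrightarrow> on (B a c) f \<Longrightarrow> on (B a (c - 1)) (ap (\<iota> j) f)"
begin

lemma gr_i: "j < l \<Longrightarrow> gr (\<iota> j) 0 (- 1)"
  using on_i by (auto simp: gr_def)

lemma gr_rprod: "(\<And>j. j < k \<Longrightarrow> gr (f j) 0 c) \<Longrightarrow> gr (rprod f k) 0 (int k * c)"
proof (induction k)
  case (Suc k)
  then have "gr (f k) 0 c" "gr (rprod f k) 0 (int k * c)" by auto
  then show ?case by (auto intro!: gr_mult[of "f k" 0 c] simp: algebra_simps)
qed (simp add: gr_1)

lemma gr_K: "gr K 0 (- int l)"
  using gr_rprod[of l \<iota> "- 1"] gr_i by (simp add: K_def)

lemma gr_piS: "k < l \<Longrightarrow> gr (piS k) 0 0" and gr_piD: "k < l \<Longrightarrow> gr (piD k) 0 0"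
proof -
  assume k: "k < l"
  have "gr (e k * \<iota> k) 0 0" "gr (\<iota> k * e k) 0 0" "gr (U k * D k) 0 0"
    using gr_mult[OF gr_e gr_i, OF k k] gr_mult[OF gr_i gr_e, OF k k] gr_mult[OF gr_U gr_D, OF k k]
    by auto
  then show "gr (piS k) 0 0" "gr (piD k) 0 0"
    unfolding piS_def piD_def
    by (auto intro!: gr_diff gr_add gr_scal) (auto intro: gr_mult)
qed

lemma gr_AS: "gr AS 0 0" and gr_AD: "gr AD 0 0"
  using gr_rprod[of l piS 0] gr_rprod[of l piD 0] gr_piS gr_piD by (auto simp: AS_def AD_def)

lemma gr_hsum:
  assumes "\<And>j. j < k \<Longrightarrow> gr (s j) a c" "\<And>j. j < k \<Longrightarrow> gr (\<pi> j) 0 0"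
  shows "gr (hsum (scal \<delta>) s \<pi> k) a c"
  using assms
proof (induction k)
  case (Suc k)
  have "gr (rprod \<pi> k) 0 0" using gr_rprod[of k \<pi> 0] Suc.prems by simp
  then show ?case
    using Suc by (auto intro!: gr_add gr_mult[OF gr_scal] gr_mult[of "s k" a c])
qed (simp add: gr_0)

lemma gr_SS: "gr SS (- 1) (- 1)" and gr_SD: "gr SD 1 (- 1)"
  unfolding SS_def SD_def sS_def sD_def
  by (rule gr_hsum; auto intro: gr_piS gr_piD gr_mult[OF gr_D gr_i] gr_mult[OF gr_U gr_i])+

lemma AS_eq_0: "on (B a c) f \<Longrightarrow> a \<noteq> 0 \<Longrightarrow> ap AS f = (\<lambda>_. 0)"
  and AD_eq_0: "on (B a c) f \<Longrightarrow> a \<noteq> 0 \<Longrightarrow> ap AD f = (\<lambda>_. 0)"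
proof -
  assume f: "on (B a c) f" "a \<noteq> 0"
  have "ap (D j) (ap AS f) = (\<lambda>_. 0)" "ap (D j) (ap AD f) = (\<lambda>_. 0)" if "j < l" for j
    using D_AS[OF that] D_AD[OF that] by (metis ap_op(1,6))+
  then show "ap AS f = (\<lambda>_. 0)" "ap AD f = (\<lambda>_. 0)"
    using D_inj[OF f(2) grD[OF gr_AS f(1)]] D_inj[OF f(2) grD[OF gr_AD f(1)]] by auto
qed

text \<open>In degree 0 each \<open>D j\<close> leads to degree -1, which is empty, so the factors
  \<open>1 - U j * D j\<close> act as the identity.\<close>

lemma rprod_cong_on_degree_0:
  assumes "\<And>j. j < l \<Longrightarrow> \<pi> j = \<sigma> j - \<sigma> j * (U j * D j)" "\<And>j. j < l \<Longrightarrow> gr (\<pi> j) 0 0"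
    and "on (B 0 c) f" "k \<le> l"
  shows "ap (rprod \<pi> k) f = ap (rprod \<sigma> k) f"
  using assms(4)
proof (induction k)
  case (Suc k)
  let ?g = "ap (rprod \<pi> k) f"
  have "gr (rprod \<pi> k) 0 0" using gr_rprod[of k \<pi> 0] assms(2) Suc.prems by simp
  then have g: "on (B 0 c) ?g" using grD assms(3) by fastforce
  have "ap (D k) ?g = (\<lambda>_. 0)" by (rule on_neg[OF grD[OF gr_D g]]) (use Suc.prems in auto)
  then have "ap (\<pi> k) ?g = ap (\<sigma> k) ?g"
    using assms(1)[of k] Suc.prems by (simp add: ap_op ap_zero)
  then show ?case using Suc by (simp add: ap_op)
qed simp

lemma AS_degree_0: "on (B 0 c) f \<Longrightarrow> ap AS f = ap (X * K) f"
  unfolding AS_def X_def K_def rprod_e_i[OF order_refl, symmetric]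
  by (rule rprod_cong_on_degree_0) (auto intro: gr_piS piS_eq)

lemma AD_degree_0: "on (B 0 c) f \<Longrightarrow> ap AD f = ap (K * X) f"
  unfolding AD_def X_def K_def rprod_i_e[OF order_refl, symmetric]
  by (rule rprod_cong_on_degree_0) (auto intro: gr_piD piD_eq)

lemma ap_homotopy_S: "ap (scal (\<delta> ^ l)) f = (\<lambda>x. ap (dS * SS) f x + ap (SS * dS) f x + ap AS f x)"
  unfolding scal_power homotopy_S by (simp add: ap_op(3))

lemma ap_homotopy_D: "ap (scal (\<delta> ^ l)) f = (\<lambda>x. ap (dD * SD) f x + ap (SD * dD) f x + ap AD f x)"
  unfolding scal_power homotopy_D by (simp add: ap_op(3))

text \<open>The defects vanish in nonzero degree. At the splice they are \<open>K * X\<close> on the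
  last divided term and \<open>X * K\<close> on the first symmetric term, exactly the contributions
  of the homotopy \<open>K\<close> running against the splicing map.\<close>

theorem nullh_power: "nullh (Cx u) (dx u) (\<delta> ^ l)"
  unfolding nullh_def
proof (intro exI[of _ "\<lambda>p. if p < u then SD else if p = u then K else SS"] conjI allI impI)
  fix p and f :: "'i \<Rightarrow> 'a" assume "on (Cx u (Suc p)) f"
  then show "on (Cx u p) (ap (if p < u then SD else if p = u then K else SS) f)"
    by (auto simp: Cx_def split: if_splits intro: grD[OF gr_SD] grD[OF gr_SS] grD[OF gr_K])
next
  fix f :: "'i \<Rightarrow> 'a" assume "on (Cx u 0) f"
  then have f: "on (B (int u) 0) f" by (simp add: Cx_def)
  have "on (B (int u + 1) (- 1)) (ap SD f)" by (rule grD[OF gr_SD f]) auto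
  then have SD: "ap SD f = (\<lambda>_. 0)" by (rule on_neg) simp
  show "ap (scal (\<delta> ^ l)) f = ap ((if 0 < u then SD else if 0 = u then K else SS) * dx u 0) f"
  proof (cases "u = 0")
    case True
    have "on (B (- 1) 1) (ap dD f)" by (rule grD[OF gr_dD f]) (use True in auto)
    then have "ap dD f = (\<lambda>_. 0)" by (rule on_neg) simp
    then show ?thesis
      using f SD AD_degree_0[of 0 f] True by (simp add: ap_homotopy_D ap_op(6) ap_zero dx_def)
  next
    case False
    then show ?thesis
      using SD AD_eq_0[OF f] by (simp add: ap_homotopy_D ap_op(6) ap_zero dx_def)
  qed
next
  fix p and f :: "'i \<Rightarrow> 'a" assume f: "on (Cx u (Suc p)) f"
  let ?k = "\<lambda>p. if p < u then SD else if p = u then K else SS"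
  consider "Suc p < u" | "Suc p = u" | "p = u" | "u < p" by linarith
  then show "ap (scal (\<delta> ^ l)) f = ap (?k (Suc p) * dx u (Suc p) + dx u p * ?k p) f"
  proof cases
    case 1
    then have "ap AD f = (\<lambda>_. 0)" using f by (intro AD_eq_0) (auto simp: Cx_def)
    then show ?thesis using 1 by (simp add: ap_homotopy_D dx_def ap_op(3)) (simp add: add.commute)
  next
    case 2
    then have f0: "on (B 0 (int u)) f" using f by (auto simp: Cx_def)
    have "on (B (- 1) (int u + 1)) (ap dD f)" by (rule grD[OF gr_dD f0]) auto
    then have "ap dD f = (\<lambda>_. 0)" by (rule on_neg) simp
    then show ?thesis using 2 AD_degree_0[OF f0]
      by (auto simp: ap_homotopy_D dx_def ap_op(3) ap_op(6) ap_zero add.commute)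
  next
    case 3
    then have f0: "on (B 0 (int u + int l)) f" using f by (auto simp: Cx_def)
    have "on (B (- 1) (int u + int l - 1)) (ap SS f)" by (rule grD[OF gr_SS f0]) auto
    then have "ap SS f = (\<lambda>_. 0)" by (rule on_neg) simp
    then show ?thesis using 3 AS_degree_0[OF f0]
      by (auto simp: ap_homotopy_S dx_def ap_op(3) ap_op(6) ap_zero)
  next
    case 4
    then have "ap AS f = (\<lambda>_. 0)" using f by (intro AS_eq_0) (auto simp: Cx_def)
    then show ?thesis using 4 by (simp add: ap_homotopy_S dx_def ap_op(3)) (simp add: add.commute)
  qed
qed

end

section \<open>Wedge, contraction and shift operators\<close>

text \<open>The first exponent belongs to the divided or symmetric power of \<open>H\<close> or its
  dual, the second to the symmetric power of \<open>F\<close>, and the set to the exterior power of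
  \<open>G\<close>.\<close>

type_synonym idx = "(nat \<Rightarrow> nat) \<times> (nat \<Rightarrow> nat) \<times> nat set"

text \<open>Operators act on coefficient functions, so the index moves opposite to the basis
  element: raising an exponent reads the coefficient at the lowered exponent, wedging with g_i the
  one at \<open>J - {i}\<close>.\<close>

definition pull :: "('i \<Rightarrow> 'a::comm_ring_1) \<Rightarrow> ('i \<Rightarrow> 'i) \<Rightarrow> ('i, 'a) op" where
  "pull w s = Op (\<lambda>f x. w x * f (s x))"

lemma ap_pull: "ap (pull w s) f = (\<lambda>x. w x * f (s x))"
  unfolding pull_def by (subst ap_Op) (auto simp: lin_def algebra_simps is_ideal_mult)

definition gE :: "nat \<Rightarrow> (idx, 'a::comm_ring_1) op" where
  "gE i = pull (\<lambda>(\<alpha>, \<gamma>, J). if i \<in> J then wsign i J else 0) (\<lambda>(\<alpha>, \<gamma>, J). (\<alpha>, \<gamma>, J - {i}))"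

definition gI :: "nat \<Rightarrow> (idx, 'a::comm_ring_1) op" where
  "gI i = pull (\<lambda>(\<alpha>, \<gamma>, J). if i \<notin> J then wsign i J else 0) (\<lambda>(\<alpha>, \<gamma>, J). (\<alpha>, \<gamma>, insert i J))"

definition uA :: "nat \<Rightarrow> (idx, 'a::comm_ring_1) op" where
  "uA j = pull (\<lambda>(\<alpha>, \<gamma>, J). if 0 < \<alpha> j then 1 else 0) (\<lambda>(\<alpha>, \<gamma>, J). (\<alpha>(j := \<alpha> j - 1), \<gamma>, J))"

definition dA :: "nat \<Rightarrow> (idx, 'a::comm_ring_1) op" where
  "dA j = pull (\<lambda>_. 1) (\<lambda>(\<alpha>, \<gamma>, J). (\<alpha>(j := Suc (\<alpha> j)), \<gamma>, J))"

definition uC :: "nat \<Rightarrow> (idx, 'a::comm_ring_1) op" where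
  "uC j = pull (\<lambda>(\<alpha>, \<gamma>, J). if 0 < \<gamma> j then 1 else 0) (\<lambda>(\<alpha>, \<gamma>, J). (\<alpha>, \<gamma>(j := \<gamma> j - 1), J))"

definition dC :: "nat \<Rightarrow> (idx, 'a::comm_ring_1) op" where
  "dC j = pull (\<lambda>_. 1) (\<lambda>(\<alpha>, \<gamma>, J). (\<alpha>, \<gamma>(j := Suc (\<gamma> j)), J))"

lemma ap_gE: "ap (gE i) f (\<alpha>, \<gamma>, J) = (if i \<in> J then wsign i J * f (\<alpha>, \<gamma>, J - {i}) else 0)"
  and ap_gI: "ap (gI i) f (\<alpha>, \<gamma>, J) = (if i \<notin> J then wsign i J * f (\<alpha>, \<gamma>, insert i J) else 0)"
  and ap_uA: "ap (uA j) f (\<alpha>, \<gamma>, J) = (if 0 < \<alpha> j then f (\<alpha>(j := \<alpha> j - 1), \<gamma>, J) else 0)"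
  and ap_dA: "ap (dA j) f (\<alpha>, \<gamma>, J) = f (\<alpha>(j := Suc (\<alpha> j)), \<gamma>, J)"
  and ap_uC: "ap (uC j) f (\<alpha>, \<gamma>, J) = (if 0 < \<gamma> j then f (\<alpha>, \<gamma>(j := \<gamma> j - 1), J) else 0)"
  and ap_dC: "ap (dC j) f (\<alpha>, \<gamma>, J) = f (\<alpha>, \<gamma>(j := Suc (\<gamma> j)), J)"
  by (simp_all add: gE_def gI_def uA_def dA_def uC_def dC_def ap_pull)

lemmas ap_gens = ap_gE ap_gI ap_uA ap_dA ap_uC ap_dC

lemma op_eqI3: "(\<And>f \<alpha> \<gamma> J. ap S f (\<alpha>, \<gamma>, J) = ap T f (\<alpha>, \<gamma>, J)) \<Longrightarrow> S = (T :: (idx, 'a::comm_ring_1) op)"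
  by (rule op_eqI) (metis prod_cases3)

lemma wsign_remove: "wsign k (J - {i}) = (if i \<in> J \<and> i < k then - wsign k J else wsign k J)"
proof (cases "i \<in> J \<and> i < k")
  case True
  then have e: "{j \<in> J. j < k} = insert i {j \<in> J - {i}. j < k}" by auto
  have "finite {j \<in> J - {i}. j < k}" by (rule finite_subset[of _ "{..<k}"]) auto
  then have "card {j \<in> J. j < k} = Suc (card {j \<in> J - {i}. j < k})"
    by (subst e, subst card_insert_disjoint) auto
  then show ?thesis using True by (simp add: wsign_def)
next
  case False
  then have "{j \<in> J - {i}. j < k} = {j \<in> J. j < k}" by auto
  then show ?thesis using False by (auto simp: wsign_def)
qed

lemma wsign_insert:
  "wsign k (insert i J) = (if i \<notin> J \<and> i < k then - wsign k J else wsign k J :: 'a::comm_ring_1)"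
  using wsign_remove[of k "insert i J" i, where 'a = 'a]
  by (cases "i \<in> J") (auto simp: insert_absorb split: if_splits)

lemma wsign_sq:
  fixes x :: "'a::comm_ring_1"
  shows "wsign k J * wsign k J = (1::'a)" "wsign k J * (wsign k J * x) = x"
proof -
  show "wsign k J * wsign k J = (1::'a)" by (simp add: wsign_def flip: power_add mult_2)
  then show "wsign k J * (wsign k J * x) = x" by (simp add: mult.assoc[symmetric])
qed

lemma gE_gE: "gE i * gE k = - (gE k * gE i)" and gE_sq: "gE i * gE i = 0"
proof -
  have c: "J - {i} - {k} = J - {k} - {i}" for J :: "nat set" by auto
  show "gE i * gE k = - (gE k * gE i)"
    by (rule op_eqI3, cases "i = k")
      (auto simp: ap_op ap_gens wsign_remove c linorder_neq_iff)
  show "gE i * gE i = 0" by (rule op_eqI3) (auto simp: ap_op ap_gens)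
qed

lemma gI_gI: "gI i * gI k = - (gI k * gI i)" and gI_sq: "gI i * gI i = 0"
proof -
  show "gI i * gI k = - (gI k * gI i)"
    by (rule op_eqI3, cases "i = k")
      (auto simp: ap_op ap_gens wsign_insert insert_commute linorder_neq_iff)
  show "gI i * gI i = 0" by (rule op_eqI3) (auto simp: ap_op ap_gens)
qed

lemma gE_gI: "gE i * gI k + gI k * gE i = (if i = k then 1 else 0)"
proof (rule op_eqI3)
  fix f :: "idx \<Rightarrow> 'a" and \<alpha> \<gamma> J
  show "ap (gE i * gI k + gI k * gE i) f (\<alpha>, \<gamma>, J) = ap (if i = k then 1 else 0) f (\<alpha>, \<gamma>, J)"
  proof (cases "i = k")
    case True
    then show ?thesis
      by (cases "i \<in> J") (auto simp: ap_op ap_gens wsign_insert wsign_remove wsign_sq insert_absorb)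
  next
    case False
    then have "insert k (J - {i}) = insert k J - {i}" by auto
    then show ?thesis using False
      by (auto simp: ap_op ap_gens wsign_insert wsign_remove linorder_neq_iff)
  qed
qed

lemma shift_commute_exterior:
  "uA j * gE i = gE i * uA j" "uA j * gI i = gI i * uA j"
  "dA j * gE i = gE i * dA j" "dA j * gI i = gI i * dA j"
  "uC j * gE i = gE i * uC j" "uC j * gI i = gI i * uC j"
  "dC j * gE i = gE i * dC j" "dC j * gI i = gI i * dC j"
  by (rule op_eqI3, auto simp: ap_op ap_gens)+

lemma shift_relations:
  "uA j * uA k = uA k * uA j" "dA j * dA k = dA k * dA j" "dA j * uA j = 1"
  "j \<noteq> k \<Longrightarrow> uA j * dA k = dA k * uA j"
  "uC j * uC k = uC k * uC j" "dC j * dC k = dC k * dC j" "dC j * uC j = 1"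
  "j \<noteq> k \<Longrightarrow> uC j * dC k = dC k * uC j"
  "uC j * uA k = uA k * uC j" "uC j * dA k = dA k * uC j"
  by (cases "j = k"; rule op_eqI3; auto simp: ap_op ap_gens fun_upd_twist)+

section \<open>Wedging with a vector and contracting with a functional\<close>

definition gEv :: "nat \<Rightarrow> (nat \<Rightarrow> 'a::comm_ring_1) \<Rightarrow> (idx, 'a) op" where
  "gEv n v = (\<Sum>i<n. scal (v i) * gE i)"

definition gIv :: "nat \<Rightarrow> (nat \<Rightarrow> 'a::comm_ring_1) \<Rightarrow> (idx, 'a) op" where
  "gIv n v = (\<Sum>i<n. scal (v i) * gI i)"

lemma scal_product: "scal a * S * (scal b * T) = scal (a * b) * (S * T)"
  by (metis mult.assoc scal_commute scal_mult)

lemma commute_scal_product: "T * S = S * T \<Longrightarrow> T * (scal c * S) = scal c * S * T"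
  by (metis mult.assoc scal_commute)

lemma commute_vec:
  assumes "\<And>i. T * gE i = gE i * T" shows "T * gEv n v = gEv n v * T"
  unfolding gEv_def sum_distrib_left sum_distrib_right
  by (intro sum.cong refl) (simp add: commute_scal_product assms)

lemma commute_covec:
  assumes "\<And>i. T * gI i = gI i * T" shows "T * gIv n v = gIv n v * T"
  unfolding gIv_def sum_distrib_left sum_distrib_right
  by (intro sum.cong refl) (simp add: commute_scal_product assms)

lemma gEv_gEv: "gEv n v * gEv n w = - (gEv n w * gEv n v)"
proof -
  have "gEv n v * gEv n w = (\<Sum>i<n. \<Sum>k<n. scal (v i * w k) * (gE i * gE k))"
    by (simp add: gEv_def sum_product scal_product)
  also have "\<dots> = (\<Sum>k<n. \<Sum>i<n. scal (v i * w k) * (gE i * gE k))" by (rule sum.swap)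
  also have "\<dots> = (\<Sum>k<n. \<Sum>i<n. - (scal (w k * v i) * (gE k * gE i)))"
    by (intro sum.cong refl, subst gE_gE) (simp add: mult.commute[of "v _"])
  also have "\<dots> = - (gEv n w * gEv n v)"
    by (simp add: gEv_def sum_product scal_product sum_negf)
  finally show ?thesis .
qed

lemma gIv_gIv: "gIv n v * gIv n w = - (gIv n w * gIv n v)"
proof -
  have "gIv n v * gIv n w = (\<Sum>i<n. \<Sum>k<n. scal (v i * w k) * (gI i * gI k))"
    by (simp add: gIv_def sum_product scal_product)
  also have "\<dots> = (\<Sum>k<n. \<Sum>i<n. scal (v i * w k) * (gI i * gI k))" by (rule sum.swap)
  also have "\<dots> = (\<Sum>k<n. \<Sum>i<n. - (scal (w k * v i) * (gI k * gI i)))"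
    by (intro sum.cong refl, subst gI_gI) (simp add: mult.commute[of "v _"])
  also have "\<dots> = - (gIv n w * gIv n v)"
    by (simp add: gIv_def sum_product scal_product sum_negf)
  finally show ?thesis .
qed

lemma gEv_sq: "gEv n v * gEv n v = 0"
  unfolding gEv_def sum_product scal_product
  by (rule sum_antisymmetric_eq_0) (subst gE_gE, simp add: mult.commute, simp add: gE_sq)

lemma gIv_sq: "gIv n v * gIv n v = 0"
  unfolding gIv_def sum_product scal_product
  by (rule sum_antisymmetric_eq_0) (subst gI_gI, simp add: mult.commute, simp add: gI_sq)

lemma gEv_gIv: "gEv n v * gIv n w + gIv n w * gEv n v = scal (\<Sum>i<n. v i * w i)"
proof -
  have "gIv n w * gEv n v = (\<Sum>i<n. \<Sum>k<n. scal (v i * w k) * (gI k * gE i))"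
    unfolding gIv_def gEv_def sum_product scal_product by (subst sum.swap) (simp add: mult.commute)
  then have "gEv n v * gIv n w + gIv n w * gEv n v
      = (\<Sum>i<n. \<Sum>k<n. scal (v i * w k) * (gE i * gI k + gI k * gE i))"
    by (simp add: gEv_def gIv_def sum_product scal_product sum.distrib distrib_left)
  also have "\<dots> = (\<Sum>i<n. \<Sum>k<n. if i = k then scal (v i * w k) else 0)"
    by (intro sum.cong refl) (simp add: gE_gI)
  also have "\<dots> = scal (\<Sum>i<n. v i * w i)" by (simp add: scal_sum)
  finally show ?thesis .
qed

section \<open>Trigraded components and the degrees of the operators\<close>

definition MonZ :: "nat \<Rightarrow> int \<Rightarrow> (nat \<Rightarrow> nat) set" where
  "MonZ k a = {\<alpha>. (\<forall>i\<ge>k. \<alpha> i = 0) \<and> int (\<Sum>i<k. \<alpha> i) = a}"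

definition Bt :: "nat \<Rightarrow> nat \<Rightarrow> nat \<Rightarrow> int \<Rightarrow> int \<Rightarrow> int \<Rightarrow> idx set" where
  "Bt l m n a b c = {(\<alpha>, \<gamma>, J). \<alpha> \<in> MonZ l a \<and> \<gamma> \<in> MonZ m b \<and> J \<subseteq> {..<n} \<and> int (card J) = c}"

lemma on_BtD:
  "on (Bt l m n a b c) f \<Longrightarrow> \<alpha> \<in> MonZ l a \<and> \<gamma> \<in> MonZ m b \<and> J \<subseteq> {..<n} \<and> int (card J) = c
    \<or> f (\<alpha>, \<gamma>, J) = 0"
  by (auto simp: on_def Bt_def)

lemma on_BtI:
  "(\<And>\<alpha> \<gamma> J. f (\<alpha>, \<gamma>, J) \<noteq> 0 \<Longrightarrow> \<alpha> \<in> MonZ l a \<and> \<gamma> \<in> MonZ m b \<and> J \<subseteq> {..<n} \<and> int (card J) = c)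
    \<Longrightarrow> on (Bt l m n a b c) f"
  by (fastforce simp: on_def Bt_def)

lemma MonZ_upd: "j < k \<Longrightarrow> \<alpha>(j := x) \<in> MonZ k a \<longleftrightarrow> \<alpha> \<in> MonZ k (a + int (\<alpha> j) - int x)"
proof -
  assume j: "j < k"
  have "(\<Sum>i<k. (\<alpha>(j := x)) i) = x + (\<Sum>i\<in>{..<k} - {j}. \<alpha> i)"
    using j by (subst sum.remove[of _ j]) auto
  moreover have "(\<Sum>i<k. \<alpha> i) = \<alpha> j + (\<Sum>i\<in>{..<k} - {j}. \<alpha> i)"
    using j by (subst sum.remove[of _ j]) auto
  ultimately show ?thesis using j by (auto simp: MonZ_def simp del: of_nat_sum fun_upd_apply) (auto simp: fun_upd_def simp del: of_nat_sum)
qed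

lemma Bt_empty:
  assumes "a < 0 \<or> b < 0 \<or> c < 0 \<or> int n < c" shows "Bt l m n a b c = {}"
proof -
  have "(\<alpha>, \<gamma>, J) \<notin> Bt l m n a b c" for \<alpha> \<gamma> J
  proof
    assume "(\<alpha>, \<gamma>, J) \<in> Bt l m n a b c"
    then have *: "\<alpha> \<in> MonZ l a" "\<gamma> \<in> MonZ m b" "J \<subseteq> {..<n}" "int (card J) = c"
      by (auto simp: Bt_def)
    have "card J \<le> n" using card_mono[OF _ *(3)] by simp
    then show False using assms * by (auto simp: MonZ_def simp del: of_nat_sum)
  qed
  then show ?thesis by auto
qed

context
  fixes l m n :: nat and a b c :: int and f :: "idx \<Rightarrow> 'a::comm_ring_1"
  assumes f: "on (Bt l m n a b c) f"
begin

lemma on_uA: "j < l \<Longrightarrow> on (Bt l m n (a + 1) b c) (ap (uA j) f)"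
proof (rule on_BtI)
  fix \<alpha> \<gamma> J assume j: "j < l" and "ap (uA j) f (\<alpha>, \<gamma>, J) \<noteq> 0"
  then have *: "0 < \<alpha> j" "f (\<alpha>(j := \<alpha> j - 1), \<gamma>, J) \<noteq> 0" by (auto simp: ap_gens split: if_splits)
  then have "a + int (\<alpha> j) - int (\<alpha> j - 1) = a + 1" by simp
  then show "\<alpha> \<in> MonZ l (a + 1) \<and> \<gamma> \<in> MonZ m (b) \<and> J \<subseteq> {..<n} \<and> int (card J) = c"
    using on_BtD[OF f, of "\<alpha>(j := \<alpha> j - 1)" \<gamma> J] * j by (auto simp: MonZ_upd)
qed

lemma on_dA: "j < l \<Longrightarrow> on (Bt l m n (a - 1) b c) (ap (dA j) f)"
  using on_BtD[OF f, of "\<alpha>(j := Suc (\<alpha> j))" \<gamma> J for \<alpha> \<gamma> J]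
  by (intro on_BtI) (auto simp: ap_gens MonZ_upd of_nat_diff algebra_simps split: if_splits)

lemma on_uC: "j < m \<Longrightarrow> on (Bt l m n a (b + 1) c) (ap (uC j) f)"
proof (rule on_BtI)
  fix \<alpha> \<gamma> J assume j: "j < m" and "ap (uC j) f (\<alpha>, \<gamma>, J) \<noteq> 0"
  then have *: "0 < \<gamma> j" "f (\<alpha>, \<gamma>(j := \<gamma> j - 1), J) \<noteq> 0" by (auto simp: ap_gens split: if_splits)
  then have "b + int (\<gamma> j) - int (\<gamma> j - 1) = b + 1" by simp
  then show "\<alpha> \<in> MonZ l (a) \<and> \<gamma> \<in> MonZ m (b + 1) \<and> J \<subseteq> {..<n} \<and> int (card J) = c"
    using on_BtD[OF f, of \<alpha> "\<gamma>(j := \<gamma> j - 1)" J] * j by (auto simp: MonZ_upd)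
qed

lemma on_dC: "j < m \<Longrightarrow> on (Bt l m n a (b - 1) c) (ap (dC j) f)"
  using on_BtD[OF f, of \<alpha> "\<gamma>(j := Suc (\<gamma> j))" J for \<alpha> \<gamma> J]
  by (intro on_BtI) (auto simp: ap_gens MonZ_upd of_nat_diff algebra_simps split: if_splits)

lemma on_gE: assumes "i < n" shows "on (Bt l m n a b (c + 1)) (ap (gE i) f)"
proof (rule on_BtI)
  fix \<alpha> \<gamma> J assume "ap (gE i) f (\<alpha>, \<gamma>, J) \<noteq> 0"
  then have "i \<in> J" "f (\<alpha>, \<gamma>, J - {i}) \<noteq> 0" by (auto simp: ap_gens split: if_splits)
  with on_BtD[OF f, of \<alpha> \<gamma> "J - {i}"]
  have *: "\<alpha> \<in> MonZ l a" "\<gamma> \<in> MonZ m b" "J - {i} \<subseteq> {..<n}" "int (card (J - {i})) = c" by auto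
  then have "J \<subseteq> {..<n}" using assms by auto
  moreover from this have "finite J" by (rule finite_subset) simp
  then have "int (card J) = c + 1" using *(4) card_Suc_Diff1[OF _ \<open>i \<in> J\<close>] by linarith
  ultimately show "\<alpha> \<in> MonZ l a \<and> \<gamma> \<in> MonZ m b \<and> J \<subseteq> {..<n} \<and> int (card J) = c + 1" using * by simp
qed

lemma on_gI: "on (Bt l m n a b (c - 1)) (ap (gI i) f)"
proof (rule on_BtI)
  fix \<alpha> \<gamma> J assume "ap (gI i) f (\<alpha>, \<gamma>, J) \<noteq> 0"
  then have "i \<notin> J" "f (\<alpha>, \<gamma>, insert i J) \<noteq> 0" by (auto simp: ap_gens split: if_splits)
  with on_BtD[OF f, of \<alpha> \<gamma> "insert i J"]
  have *: "\<alpha> \<in> MonZ l a" "\<gamma> \<in> MonZ m b" "insert i J \<subseteq> {..<n}" "int (card (insert i J)) = c" by auto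
  then have "finite J" using finite_subset by auto
  then show "\<alpha> \<in> MonZ l a \<and> \<gamma> \<in> MonZ m b \<and> J \<subseteq> {..<n} \<and> int (card J) = c - 1"
    using * \<open>i \<notin> J\<close> by auto
qed

lemma on_gEv: "on (Bt l m n a b (c + 1)) (ap (gEv n v) f)"
  unfolding on_def gEv_def using on_gE
  by (auto simp: ap_sum_op ap_op ap_scal on_def intro!: sum.neutral)

lemma on_gIv: "on (Bt l m n a b (c - 1)) (ap (gIv n v) f)"
  unfolding on_def gIv_def using on_gI
  by (auto simp: ap_sum_op ap_op ap_scal on_def intro!: sum.neutral)

lemma dA_inj: "a \<noteq> 0 \<Longrightarrow> (\<And>j. j < l \<Longrightarrow> ap (dA j) f = (\<lambda>_. 0)) \<Longrightarrow> f = (\<lambda>_. 0)"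
proof (rule ext, clarify, rule ccontr)
  fix \<alpha> \<gamma> J assume *: "a \<noteq> 0" "\<And>j. j < l \<Longrightarrow> ap (dA j) f = (\<lambda>_. 0)" "f (\<alpha>, \<gamma>, J) \<noteq> 0"
  then have "int (\<Sum>i<l. \<alpha> i) = a" using on_BtD[OF f, of \<alpha> \<gamma> J] by (simp add: MonZ_def)
  with \<open>a \<noteq> 0\<close> obtain j where j: "j < l" "\<alpha> j \<noteq> 0"
    by (metis (no_types, lifting) lessThan_iff of_nat_0 sum.neutral)
  have "ap (dA j) f (\<alpha>(j := \<alpha> j - 1), \<gamma>, J) = f (\<alpha>, \<gamma>, J)"
    using j by (simp add: ap_gens fun_upd_idem)
  then show False using * j by simp
qed

lemma dC_inj: "b \<noteq> 0 \<Longrightarrow> (\<And>j. j < m \<Longrightarrow> ap (dC j) f = (\<lambda>_. 0)) \<Longrightarrow> f = (\<lambda>_. 0)"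
proof (rule ext, clarify, rule ccontr)
  fix \<alpha> \<gamma> J assume *: "b \<noteq> 0" "\<And>j. j < m \<Longrightarrow> ap (dC j) f = (\<lambda>_. 0)" "f (\<alpha>, \<gamma>, J) \<noteq> 0"
  then have "int (\<Sum>i<m. \<gamma> i) = b" using on_BtD[OF f, of \<alpha> \<gamma> J] by (simp add: MonZ_def)
  with \<open>b \<noteq> 0\<close> obtain j where j: "j < m" "\<gamma> j \<noteq> 0"
    by (metis (no_types, lifting) lessThan_iff of_nat_0 sum.neutral)
  have "ap (dC j) f (\<alpha>, \<gamma>(j := \<gamma> j - 1), J) = f (\<alpha>, \<gamma>, J)"
    using j by (simp add: ap_gens fun_upd_idem)
  then show False using * j by simp
qed

end

text \<open>Shifting the exterior degree by \<open>q\<close> puts row \<open>q\<close> of the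
  bicomplex into the same form \<open>Cx t\<close> as row 0.\<close>

lemma row_ops:
  "graded_koszul_ops l (\<lambda>j. gEv n (\<phi> j)) uA dA (\<lambda>a c. Bt l m n a (int q) (c - int q))"
proof unfold_locales
  fix a c :: int and f :: "idx \<Rightarrow> 'a"
  assume "on (Bt l m n a (int q) (c - int q)) f"
  then show "on (Bt l m n a (int q) (c + 1 - int q)) (ap (gEv n (\<phi> j)) f)" for j
    using on_gEv[of l m n a "int q" "c - int q" f "\<phi> j"] by (simp add: algebra_simps)
qed (auto simp: gEv_sq shift_relations commute_vec shift_commute_exterior Bt_empty
    intro: gEv_gEv on_uA on_dA dA_inj)

text \<open>Contraction lowers the exterior degree, so the degree is counted downwards from
  \<open>s\<close>. The bound \<open>n \<le> s\<close> turns negative degrees into exterior powers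
  beyond the rank of \<open>G\<close>.\<close>

lemma column_ops:
  assumes "int n \<le> s"
  shows "graded_koszul_ops m (\<lambda>k. gIv n (\<psi> k)) uC dC (\<lambda>a c. Bt l m n x a (s - c))"
proof unfold_locales
  fix a c :: int and f :: "idx \<Rightarrow> 'a"
  assume "on (Bt l m n x a (s - c)) f"
  then show "on (Bt l m n x a (s - (c + 1))) (ap (gIv n (\<psi> j)) f)" for j
    using on_gIv[of l m n x a "s - c" f "\<psi> j"] by (simp add: algebra_simps)
qed (use assms in \<open>auto simp: gIv_sq shift_relations commute_covec shift_commute_exterior
    intro!: Bt_empty intro: gIv_gIv on_uC on_dC dC_inj\<close>)

lemma row_homotopy:
  assumes "\<And>j k. j < l \<Longrightarrow> k < l \<Longrightarrow> (\<Sum>i<n. \<phi> j i * \<sigma> k i) = (if j = k then \<delta> else 0)"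
  shows "graded_koszul_homotopy l (\<lambda>j. gEv n (\<phi> j)) uA dA
    (\<lambda>a c. Bt l m n a (int q) (c - int q)) (\<lambda>k. gIv n (\<sigma> k)) \<delta>"
proof -
  interpret graded_koszul_ops l "\<lambda>j. gEv n (\<phi> j)" uA dA "\<lambda>a c. Bt l m n a (int q) (c - int q)"
    by (rule row_ops)
  show ?thesis
  proof unfold_locales
    fix a c :: int and f :: "idx \<Rightarrow> 'a"
    assume "on (Bt l m n a (int q) (c - int q)) f"
    then show "on (Bt l m n a (int q) (c - 1 - int q)) (ap (gIv n (\<sigma> j)) f)" for j
      using on_gIv[of l m n a "int q" "c - int q" f "\<sigma> j"] by (simp add: algebra_simps)
  qed (simp_all add: gEv_gIv assms commute_covec shift_commute_exterior scal_commute scal_0)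
qed

lemma column_homotopy:
  assumes "int n \<le> s"
    and "\<And>j k. j < m \<Longrightarrow> k < m \<Longrightarrow> (\<Sum>i<n. \<psi> j i * \<tau> k i) = (if j = k then \<delta> else 0)"
  shows "graded_koszul_homotopy m (\<lambda>k. gIv n (\<psi> k)) uC dC
    (\<lambda>a c. Bt l m n x a (s - c)) (\<lambda>k. gEv n (\<tau> k)) \<delta>"
proof -
  interpret graded_koszul_ops m "\<lambda>k. gIv n (\<psi> k)" uC dC "\<lambda>a c. Bt l m n x a (s - c)"
    by (rule column_ops[OF assms(1)])
  show ?thesis
  proof unfold_locales
    show "gIv n (\<psi> j) * gEv n (\<tau> k) + gEv n (\<tau> k) * gIv n (\<psi> j) = (if j = k then scal \<delta> else 0)"
      if "j < m" "k < m" for j k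
      using gEv_gIv[of n "\<tau> k" "\<psi> j"] assms(2)[OF that]
      by (simp add: add.commute mult.commute scal_0)
    fix a c :: int and f :: "idx \<Rightarrow> 'a"
    assume "on (Bt l m n x a (s - c)) f"
    then show "on (Bt l m n x a (s - (c - 1))) (ap (gEv n (\<tau> j)) f)" for j
      using on_gEv[of l m n x a "s - c" f "\<tau> j"] by (simp add: algebra_simps)
  qed (simp_all add: commute_vec shift_commute_exterior scal_commute)
qed

section \<open>Zigzags in a bicomplex\<close>

text \<open>The sign \<open>\<epsilon> p\<close> varies with \<open>p\<close> because the splicing
  map is a product of \<open>l\<close> odd operators. The empty triangle \<open>p \<le> t\<close>,
  \<open>p < q\<close> consists of exterior powers of negative degree.\<close>

locale bicomplex =
  fixes X :: "nat \<Rightarrow> nat \<Rightarrow> 'i set" and d :: "nat \<Rightarrow> ('i, 'a::comm_ring_1) op"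
    and b :: "('i, 'a) op" and \<epsilon> :: "nat \<Rightarrow> 'a" and t :: nat and h :: enat
  assumes on_d: "on (X p q) f \<Longrightarrow> on (X (Suc p) q) (ap (d p) f)"
    and on_b: "on (X p q) f \<Longrightarrow> on (X p (Suc q)) (ap b f)"
    and dd: "d (Suc p) * d p = 0" and bb: "b * b = 0"
    and bd: "b * d p = scal (\<epsilon> p) * (d p * b)" and \<epsilon>_sq: "\<epsilon> p * \<epsilon> p = 1"
    and X_empty: "p \<le> t \<Longrightarrow> p < q \<Longrightarrow> X p q = {}"
    and row_exact_0: "0 < h \<Longrightarrow> on (X 0 q) f \<Longrightarrow> ap (d 0) f = (\<lambda>_. 0) \<Longrightarrow> f = (\<lambda>_. 0)"
    and row_exact: "enat (Suc p) < h \<Longrightarrow> on (X (Suc p) q) f \<Longrightarrow> ap (d (Suc p)) f = (\<lambda>_. 0)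
      \<Longrightarrow> \<exists>y. on (X p q) y \<and> ap (d p) y = f"
begin

lemma ap_dd: "ap (d (Suc p)) (ap (d p) f) = (\<lambda>_. 0)"
  using dd[of p] by (metis ap_op(1,6))

lemma ap_bb: "ap b (ap b f) = (\<lambda>_. 0)"
  using bb by (metis ap_op(1,6))

lemma ap_bd: "ap b (ap (d p) f) = ap (d p) (ap b (\<lambda>x. \<epsilon> p * f x))"
proof -
  have "ap (b * d p) f = ap (scal (\<epsilon> p) * (d p * b)) f" by (simp only: bd)
  then show ?thesis by (simp add: ap_op ap_scal ap_scale)
qed

lemma ap_db: "ap (d p) (ap b f) = ap b (ap (d p) (\<lambda>x. \<epsilon> p * f x))"
  unfolding ap_bd by (simp add: mult.assoc[symmetric] \<epsilon>_sq)

lemma on_X_empty: "on (X p q) f \<Longrightarrow> p \<le> t \<Longrightarrow> p < q \<Longrightarrow> f = (\<lambda>_. 0)"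
  using X_empty[of p q] by (auto simp: on_def)

definition column_exact :: "nat \<Rightarrow> nat \<Rightarrow> bool" where
  "column_exact p q \<longleftrightarrow> (\<forall>f. on (X p (Suc q)) f \<longrightarrow> ap b f = (\<lambda>_. 0)
     \<longrightarrow> (\<exists>w. on (X p q) w \<and> ap b w = f))"

text \<open>The kernel of \<open>b\<close> on the bottom row is N(t), so this and the next
  definition are its cocycles and coboundaries.\<close>

definition cocyc :: "nat \<Rightarrow> ('i \<Rightarrow> 'a) \<Rightarrow> bool" where
  "cocyc p z \<longleftrightarrow> on (X p 0) z \<and> ap b z = (\<lambda>_. 0) \<and> ap (d p) z = (\<lambda>_. 0)"

definition cobdy :: "nat \<Rightarrow> ('i \<Rightarrow> 'a) \<Rightarrow> bool" where
  "cobdy p z \<longleftrightarrow> (case p of 0 \<Rightarrow> z = (\<lambda>_. 0)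
     | Suc c \<Rightarrow> \<exists>y. on (X c 0) y \<and> ap b y = (\<lambda>_. 0) \<and> ap (d c) y = z)"

text \<open>\<open>zigzag c q y z\<close>: \<open>z\<close> in position \<open>(c + 1, 0)\<close> is reached from \<open>y\<close> in position \<open>(c - q, q)\<close>
  by alternately applying \<open>d\<close> and lifting along \<open>b\<close>.\<close>

primrec zigzag :: "nat \<Rightarrow> nat \<Rightarrow> ('i \<Rightarrow> 'a) \<Rightarrow> ('i \<Rightarrow> 'a) \<Rightarrow> bool" where
  "zigzag c 0 y z \<longleftrightarrow> on (X c 0) y \<and> z = ap (d c) y"
| "zigzag c (Suc q) y z \<longleftrightarrow> Suc q \<le> c \<and> on (X (c - Suc q) (Suc q)) y
     \<and> (\<exists>y'. zigzag c q y' z \<and> ap b y' = ap (d (c - Suc q)) y)"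

lemma zigzag_on: "zigzag c q y z \<Longrightarrow> on (X (c - q) q) y"
  by (cases q) auto

lemma zigzag_combination:
  "zigzag c q y z \<Longrightarrow> zigzag c q y' z' \<Longrightarrow> zigzag c q (\<lambda>x. a * y x + y' x) (\<lambda>x. a * z x + z' x)"
proof (induction q arbitrary: y y')
  case 0
  then show ?case by (simp add: on_add on_scale ap_add ap_scale)
next
  case (Suc q)
  then obtain w w' where w: "zigzag c q w z" "ap b w = ap (d (c - Suc q)) y"
    "zigzag c q w' z'" "ap b w' = ap (d (c - Suc q)) y'" by auto
  have "zigzag c q (\<lambda>x. a * w x + w' x) (\<lambda>x. a * z x + z' x)" using Suc.IH w by blast
  then show ?case using Suc.prems w
    by (auto simp: on_add on_scale ap_add ap_scale intro!: exI[of _ "\<lambda>x. a * w x + w' x"])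
qed

lemma zigzag_zero: "q \<le> c \<Longrightarrow> zigzag c q (\<lambda>_. 0) (\<lambda>_. 0)"
  by (induction q) (auto simp: on_zero ap_zero intro!: exI[of _ "\<lambda>_. 0"])

lemma zigzag_sum:
  assumes "q \<le> c" "\<And>i. i \<in> A \<Longrightarrow> zigzag c q (y i) (z i)"
  shows "zigzag c q (\<lambda>x. \<Sum>i\<in>A. r i * y i x) (\<lambda>x. \<Sum>i\<in>A. r i * z i x)"
  using assms(2)
proof (induction A rule: infinite_finite_induct)
  case (insert i A)
  then show ?case using zigzag_combination[of c q "y i" "z i" _ _ "r i"] by simp
qed (simp_all add: zigzag_zero assms(1))

text \<open>The rest of the zigzag depends on \<open>y\<close> only through \<open>d y\<close>,
  which a change of \<open>y\<close> by a \<open>d\<close>-boundary does not affect.\<close>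

lemma zigzag_modify:
  assumes "zigzag c q y z" "Suc q \<le> c" "on (X (c - Suc q) q) w"
  shows "zigzag c q (\<lambda>x. y x - ap (d (c - Suc q)) w x) z"
proof -
  have e: "Suc (c - Suc q) = c - q" using assms(2) by simp
  have "ap (d (c - q)) (\<lambda>x. y x - ap (d (c - Suc q)) w x) = ap (d (c - q)) y"
    using ap_dd[of "c - Suc q" w] by (simp add: ap_diff e)
  moreover have "on (X (c - q) q) (\<lambda>x. y x - ap (d (c - Suc q)) w x)"
    using on_d[OF assms(3)] zigzag_on[OF assms(1)] by (simp add: on_diff e)
  ultimately show ?thesis using assms(1) by (cases q) auto
qed

text \<open>As \<open>b\<close> and \<open>d\<close> commute up to sign, subtracting a suitable
  multiple of \<open>d w\<close> from the next element makes that element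
  \<open>b\<close>-closed.\<close>

lemma zigzag_image:
  assumes "zigzag c (Suc q) (ap b w) z" "on (X (c - Suc q) q) w"
  shows "\<exists>y. zigzag c q y z \<and> ap b y = (\<lambda>_. 0)"
proof -
  obtain y' where y': "Suc q \<le> c" "zigzag c q y' z" "ap b y' = ap (d (c - Suc q)) (ap b w)"
    using assms(1) by auto
  let ?w = "\<lambda>x. \<epsilon> (c - Suc q) * w x"
  have "zigzag c q (\<lambda>x. y' x - ap (d (c - Suc q)) ?w x) z"
    using assms(2) y' by (intro zigzag_modify on_scale)
  moreover have "ap b (\<lambda>x. y' x - ap (d (c - Suc q)) ?w x) = (\<lambda>_. 0)"
    unfolding ap_diff y'(3) ap_db by simp
  ultimately show ?thesis by blast
qed

text \<open>Column exactness writes the \<open>b\<close>-closed start as \<open>b w\<close>, and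
  \<open>b\<close>-closedness moves one row down. In the bottom row it says that \<open>y\<close>
  itself belongs to N(t).\<close>

lemma zigzag_cobdy:
  assumes "zigzag c q y z" "ap b y = (\<lambda>_. 0)" "\<And>r. r < q \<Longrightarrow> column_exact (c - Suc r) r"
  shows "cobdy (Suc c) z"
  using assms
proof (induction q arbitrary: y)
  case 0
  then show ?case by (auto simp: cobdy_def)
next
  case (Suc q)
  have "column_exact (c - Suc q) q" by (rule Suc.prems(3)) simp
  then obtain w where "on (X (c - Suc q) q) w" "ap b w = y"
    using zigzag_on[OF Suc.prems(1)] Suc.prems(2) by (auto simp: column_exact_def)
  then obtain y' where "zigzag c q y' z" "ap b y' = (\<lambda>_. 0)"
    using zigzag_image Suc.prems(1) by blast
  then show ?case using Suc.IH Suc.prems(3) by simp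
qed

lemma zigzag_image_cobdy:
  assumes "zigzag c (Suc q) (ap b w) z" "on (X (c - Suc q) q) w"
    "\<And>r. r < q \<Longrightarrow> column_exact (c - Suc r) r"
  shows "cobdy (Suc c) z"
  using zigzag_image[OF assms(1,2)] zigzag_cobdy assms(3) by blast

lemma zigzag_b_d: "zigzag c q y z \<Longrightarrow> ap b z = (\<lambda>_. 0) \<Longrightarrow> ap b (ap (d (c - q)) y) = (\<lambda>_. 0)"
  by (cases q) (auto simp: ap_bb dest!: sym[of "ap b _"])

lemma zigzag_d_b: "zigzag c q y z \<Longrightarrow> ap b z = (\<lambda>_. 0) \<Longrightarrow> ap (d (c - q)) (ap b y) = (\<lambda>_. 0)"
  using zigzag_b_d[of c q y z] by (simp add: ap_db ap_scale)

text \<open>At each stage \<open>b y\<close> is \<open>d\<close>-closed, because \<open>z\<close> is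
  \<open>b\<close>-closed, and row exactness provides the next element.\<close>

lemma zigzag_exists_down:
  assumes "cocyc (Suc c) z" "enat (Suc c) < h" "q \<le> c"
  shows "\<exists>y. zigzag c q y z"
  using assms(3)
proof (induction q)
  case 0
  then show ?case using row_exact[of c 0 z] assms by (auto simp: cocyc_def)
next
  case (Suc q)
  then obtain y where y: "zigzag c q y z" by auto
  have e: "Suc (c - Suc q) = c - q" using Suc.prems by simp
  have "ap (d (c - q)) (ap b y) = (\<lambda>_. 0)" using zigzag_d_b[OF y] assms(1) by (simp add: cocyc_def)
  moreover have "on (X (c - q) (Suc q)) (ap b y)" by (rule on_b[OF zigzag_on[OF y]])
  moreover have "enat (c - q) < h" using assms(2) by (metis diff_le_self enat_ord_simps(1) le_SucI order_le_less_trans)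
  ultimately obtain y' where "on (X (c - Suc q) (Suc q)) y'" "ap (d (c - Suc q)) y' = ap b y"
    using row_exact[of "c - Suc q" "Suc q" "ap b y"] by (auto simp: e)
  then have "zigzag c (Suc q) y' z" using y Suc.prems by auto
  then show ?case by blast
qed

text \<open>The same chase in the other direction: \<open>d y\<close> is \<open>b\<close>-closed and
  is lifted along \<open>b\<close> by column exactness.\<close>

lemma zigzag_exists_up:
  assumes "on (X (c - q) q) y" "q \<le> c" "ap b (ap (d (c - q)) y) = (\<lambda>_. 0)"
    "\<And>r. r < q \<Longrightarrow> column_exact (c - r) r"
  shows "\<exists>z. zigzag c q y z"
  using assms
proof (induction q arbitrary: y)
  case (Suc q)
  have e: "Suc (c - Suc q) = c - q" using Suc.prems by simp
  have "on (X (c - q) (Suc q)) (ap (d (c - Suc q)) y)" using on_d[OF Suc.prems(1)] by (simp add: e)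
  then obtain y' where y': "on (X (c - q) q) y'" "ap b y' = ap (d (c - Suc q)) y"
    using Suc.prems(3) Suc.prems(4)[of q] by (auto simp: column_exact_def)
  have "ap (d (c - q)) (ap b y') = (\<lambda>_. 0)"
    unfolding y'(2) using ap_dd[of "c - Suc q" y] by (simp add: e)
  then have "ap b (ap (d (c - q)) y') = (\<lambda>_. 0)" by (simp add: ap_bd ap_scale)
  then obtain z where "zigzag c q y' z" using Suc.IH[OF y'(1)] Suc.prems by auto
  then show ?case using Suc.prems y' by auto
qed auto

lemma zigzag_cocyc:
  assumes "zigzag c q y z" "ap b (ap (d (c - q)) y) = (\<lambda>_. 0)"
  shows "cocyc (Suc c) z"
  using assms
proof (induction q arbitrary: y)
  case 0
  then show ?case by (simp add: cocyc_def ap_dd on_d)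
next
  case (Suc q)
  then obtain y' where y': "zigzag c q y' z" "ap b y' = ap (d (c - Suc q)) y" "Suc q \<le> c" by auto
  then have "Suc (c - Suc q) = c - q" by simp
  then have "ap (d (c - q)) (ap b y') = (\<lambda>_. 0)"
    unfolding y'(2) using ap_dd[of "c - Suc q" y] by simp
  then show ?case using Suc.IH[OF y'(1)] by (simp add: ap_bd ap_scale)
qed

text \<open>A zigzag ending in a coboundary is \<open>d\<close>-closed at its start up to a
  correction \<open>e\<close>. Going up one row, row exactness writes the \<open>d\<close>-closed
  \<open>y' - e\<close> as \<open>d w\<close>, and \<open>b w\<close> up to sign is the new
  correction. The last clause records that above row 0 it is even a \<open>b\<close>-image.\<close>

lemma zigzag_of_cobdy:
  assumes "zigzag c q y z" "cobdy (Suc c) z" "enat c < h"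
  shows "\<exists>e. on (X (c - q) q) e \<and> ap b e = (\<lambda>_. 0) \<and> ap (d (c - q)) (\<lambda>x. y x - e x) = (\<lambda>_. 0)
    \<and> (\<forall>q'. q = Suc q' \<longrightarrow> (\<exists>w. on (X (c - q) q') w \<and> e = ap b w))"
  using assms(1)
proof (induction q arbitrary: y)
  case 0
  then show ?case using assms(2) by (auto simp: cobdy_def ap_diff)
next
  case (Suc q)
  then obtain y' where y': "zigzag c q y' z" "ap b y' = ap (d (c - Suc q)) y" "Suc q \<le> c" by auto
  have s: "Suc (c - Suc q) = c - q" using y'(3) by simp
  obtain e where e: "on (X (c - q) q) e" "ap b e = (\<lambda>_. 0)" "ap (d (c - q)) (\<lambda>x. y' x - e x) = (\<lambda>_. 0)"
    using Suc.IH[OF y'(1)] by auto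
  have "on (X (c - q) q) (\<lambda>x. y' x - e x)" using zigzag_on[OF y'(1)] e(1) by (rule on_diff)
  moreover have "enat (c - q) < h" using assms(3) by (metis diff_le_self enat_ord_simps(1) order_le_less_trans)
  ultimately obtain w where w: "on (X (c - Suc q) q) w" "ap (d (c - Suc q)) w = (\<lambda>x. y' x - e x)"
    using row_exact[of "c - Suc q" q "\<lambda>x. y' x - e x"] e(3) by (auto simp: s)
  let ?w = "\<lambda>x. \<epsilon> (c - Suc q) * w x"
  have "ap (d (c - Suc q)) y = ap b (\<lambda>x. y' x - e x)" by (simp add: ap_diff e(2) y'(2))
  also have "\<dots> = ap (d (c - Suc q)) (ap b ?w)" unfolding w(2)[symmetric] ap_bd ..
  finally have "ap (d (c - Suc q)) (\<lambda>x. y x - ap b ?w x) = (\<lambda>_. 0)" by (simp add: ap_diff)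
  moreover have "on (X (c - Suc q) q) ?w" by (rule on_scale[OF w(1)])
  moreover from this have "on (X (c - Suc q) (Suc q)) (ap b ?w)" by (intro on_b)
  ultimately show ?case
    by (intro exI[of _ "ap b ?w"] conjI allI impI exI[of _ ?w]) (simp_all add: ap_bb)
qed

text \<open>Row exactness lifts the cocycle to \<open>y\<close>, and the obstruction
  \<open>b y\<close> either lies at (0, 1) or comes from there, a position in the empty triangle.
  For position 3 it would come from (1, 1), outside the triangle.\<close>

theorem cocyc_cobdy_low:
  assumes "i \<le> 2" "enat i < h" "cocyc i z"
  shows "cobdy i z"
proof -
  note z = assms(3)[unfolded cocyc_def]
  consider "i = 0" | "i = Suc 0" | "i = Suc (Suc 0)" using assms(1) by linarith
  then show ?thesis
  proof cases
    case 1
    then show ?thesis using z row_exact_0[of 0 z] assms(2) by (simp add: cobdy_def zero_enat_def)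
  next
    case 2
    then obtain y where y: "on (X 0 0) y" "ap (d 0) y = z" using row_exact[of 0 0 z] z assms(2) by auto
    have "ap b y = (\<lambda>_. 0)" by (rule on_X_empty[OF on_b[OF y(1)]]) auto
    then show ?thesis using y 2 by (auto simp: cobdy_def)
  next
    case 3
    then obtain y where y: "on (X 1 0) y" "ap (d 1) y = z" using row_exact[of 1 0 z] z assms(2) by auto
    have "zigzag 1 0 y z" using y by simp
    then have "ap (d 1) (ap b y) = (\<lambda>_. 0)" using zigzag_d_b[of 1 0 y z] z by simp
    moreover have "on (X 1 1) (ap b y)" using on_b[OF y(1)] by simp
    moreover have "enat (Suc 0) < h" 
      using assms(2) 3 by (intro le_less_trans[of "enat (Suc 0)" "enat i" h]) auto
    ultimately obtain w where w: "on (X 0 1) w" "ap (d 0) w = ap b y"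
      using row_exact[of 0 1 "ap b y"] by auto
    have "w = (\<lambda>_. 0)" by (rule on_X_empty[OF w(1)]) auto
    then have "ap b y = (\<lambda>_. 0)" using w(2) by (simp add: ap_zero)
    then show ?thesis using y 3 by (auto simp: cobdy_def)
  qed
qed

text \<open>The zigzag is followed to column \<open>t + 1\<close>, which it meets in row
  \<open>c - t - 1 \<ge> t\<close>. One more lift would land in column \<open>t\<close> above the
  diagonal, where the terms vanish; so the zigzag is \<open>b\<close>-closed here, and column
  exactness carries this back to the bottom row.\<close>

theorem cocyc_cobdy_high:
  assumes "2 * t + 1 \<le> c" "enat (Suc c) < h" "\<And>r. r < c - t - 1 \<Longrightarrow> column_exact (c - Suc r) r"
    and z: "cocyc (Suc c) z"
  shows "cobdy (Suc c) z"
proof -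
  define q where "q = c - t - 1"
  have q: "q \<le> c" "c - q = Suc t" "t < Suc q" using assms(1) by (auto simp: q_def)
  obtain y where y: "zigzag c q y z" using zigzag_exists_down[OF z assms(2) q(1)] by auto
  have "ap (d (Suc t)) (ap b y) = (\<lambda>_. 0)" using zigzag_d_b[OF y] z q(2) by (simp add: cocyc_def)
  moreover have "on (X (Suc t) (Suc q)) (ap b y)" using on_b[OF zigzag_on[OF y]] q(2) by simp
  moreover have "enat (Suc t) < h"
    using assms(1,2) by (intro le_less_trans[of "enat (Suc t)" "enat (Suc c)"]) auto
  ultimately obtain w where w: "on (X t (Suc q)) w" "ap (d t) w = ap b y"
    using row_exact by metis
  have "w = (\<lambda>_. 0)" by (rule on_X_empty[OF w(1)]) (use q in auto)
  then have "ap b y = (\<lambda>_. 0)" using w(2) by (simp add: ap_zero)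
  then show ?thesis using zigzag_cobdy[OF y] assms(3) by (simp add: q_def)
qed

section \<open>Classes arising from the diagonal term (t, t)\<close>

lemma b_diagonal: "on (X t t) u \<Longrightarrow> ap b u = (\<lambda>_. 0)"
  using on_X_empty[OF on_b] by blast

lemma diagonal_zigzag:
  assumes "on (X t t) u" "\<And>r. r < t \<Longrightarrow> column_exact (2 * t - r) r"
  shows "\<exists>z. zigzag (2 * t) t u z"
  using assms by (intro zigzag_exists_up) (auto simp: ap_bd ap_scale b_diagonal ap_zero)

lemma diagonal_cocyc: "zigzag (2 * t) t u z \<Longrightarrow> cocyc (Suc (2 * t)) z"
  using zigzag_cocyc[of "2 * t" t u z] zigzag_on[of "2 * t" t u z]
  by (simp add: ap_bd ap_scale b_diagonal ap_zero)

text \<open>After subtracting some \<open>b w\<close> the element \<open>u\<close> is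
  \<open>d\<close>-closed, hence the image of an element at (t - 1, t), in the empty triangle. So
  \<open>u = b w\<close>.\<close>

lemma diagonal_cobdyD:
  assumes "zigzag (2 * t) t u z" "cobdy (Suc (2 * t)) z" "enat (2 * t) < h" "1 \<le> t"
  shows "\<exists>w. on (X t (t - 1)) w \<and> u = ap b w"
proof -
  obtain q where q: "t = Suc q" using assms(4) by (cases t) auto
  obtain w where w: "on (X t q) w" "ap (d t) (\<lambda>x. u x - ap b w x) = (\<lambda>_. 0)"
    using zigzag_of_cobdy[OF assms(1-3)] q by auto
  have "on (X t t) (\<lambda>x. u x - ap b w x)"
    using zigzag_on[OF assms(1)] on_b[OF w(1)] q by (simp add: on_diff)
  moreover have "enat t < h" using assms(3) by (metis enat_ord_simps(1) le_add1 mult_2 order_le_less_trans)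
  ultimately obtain y where y: "on (X q t) y" "ap (d q) y = (\<lambda>x. u x - ap b w x)"
    using row_exact[of q t "\<lambda>x. u x - ap b w x"] w(2) by (auto simp: q)
  have "y = (\<lambda>_. 0)" by (rule on_X_empty[OF y(1)]) (auto simp: q)
  then have "(\<lambda>x. u x - ap b w x) = (\<lambda>_. 0)" using y(2) by (simp add: ap_zero)
  then have "u = ap b w" by (simp add: fun_eq_iff)
  then show ?thesis using w(1) q by auto
qed

end

section \<open>Minors\<close>

definition DL :: "(nat \<Rightarrow> nat \<Rightarrow> 'a::comm_ring_1) \<Rightarrow> nat \<Rightarrow> nat set \<Rightarrow> 'a" where
  "DL v l L = det (mat l l (\<lambda>(a, b). v b (sorted_list_of_set L ! a)))"

lemma det_sub_rows:
  assumes "finite L" "card L = l"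
  shows "det_sub \<phi> (sorted_list_of_set L) [0..<l] = DL (\<lambda>j i. \<phi> i j) l L"
  unfolding det_sub_def DL_def using assms permutes_in_image
  by (subst det_def'[of _ l])
    (fastforce simp: atLeast0LessThan intro!: sum.cong arg_cong2[of _ _ _ _ "(*)"] prod.cong)+

lemma det_sub_columns:
  assumes "finite L" "card L = m"
  shows "det_sub \<psi> [0..<m] (sorted_list_of_set L) = DL \<psi> m L"
proof -
  let ?A = "mat m m (\<lambda>(a, b). \<psi> b (sorted_list_of_set L ! a))"
  have T: "transpose_mat ?A = mat m m (\<lambda>(a, b). \<psi> a (sorted_list_of_set L ! b))"
    by (rule eq_matI) auto
  have "DL \<psi> m L = det (mat m m (\<lambda>(a, b). \<psi> a (sorted_list_of_set L ! b)))"
    unfolding DL_def T[symmetric] by (rule det_transpose[symmetric]) auto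
  also have "\<dots> = det_sub \<psi> [0..<m] (sorted_list_of_set L)"
    unfolding det_sub_def using assms permutes_in_image
    by (subst det_def'[of _ m])
      (fastforce simp: atLeast0LessThan intro!: sum.cong arg_cong2[of _ _ _ _ "(*)"] prod.cong)+
  finally show ?thesis ..
qed

section \<open>Laplace expansion and functionals dual to a minor\<close>

lemma sorted_list_of_set_position:
  assumes "finite (L :: nat set)" "a < card L"
  shows "card {j \<in> L. j < sorted_list_of_set L ! a} = a"
    "card {j \<in> L. sorted_list_of_set L ! a < j} = card L - Suc a"
    "sorted_list_of_set (L - {sorted_list_of_set L ! a})
      = take a (sorted_list_of_set L) @ drop (Suc a) (sorted_list_of_set L)"
proof -
  let ?xs = "sorted_list_of_set L"
  have xs: "set ?xs = L" "distinct ?xs" "length ?xs = card L" "sorted_wrt (<) ?xs"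
    using assms by (auto simp: strict_sorted_iff)
  have lt: "?xs ! i < ?xs ! j \<longleftrightarrow> i < j" if "i < card L" "j < card L" for i j
    using sorted_wrt_nth_less[OF xs(4), of i j] sorted_wrt_nth_less[OF xs(4), of j i] that xs(3)
    by (metis linorder_neqE_nat order_less_asym order_less_irrefl)
  have im: "(\<lambda>i. ?xs ! i) ` {..<card L} = L"
    using nth_image[of "length ?xs" ?xs] xs(1,3) by (simp add: lessThan_atLeast0)
  have sub: "{j \<in> L. P j} = (\<lambda>i. ?xs ! i) ` {i. i < card L \<and> P (?xs ! i)}" for P
  proof -
    have "{j \<in> L. P j} = {j \<in> (\<lambda>i. ?xs ! i) ` {..<card L}. P j}" by (simp only: im)
    also have "\<dots> = (\<lambda>i. ?xs ! i) ` {i. i < card L \<and> P (?xs ! i)}" by auto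
    finally show ?thesis .
  qed
  have "{j \<in> L. j < ?xs ! a} = (\<lambda>i. ?xs ! i) ` {..<a}"
    unfolding sub using lt assms(2) by (intro arg_cong2[of _ _ _ _ "(`)"] refl) auto
  moreover have inj: "inj_on (\<lambda>i. ?xs ! i) {..<card L}"
    using xs by (auto simp: inj_on_def nth_eq_iff_index_eq)
  ultimately show c: "card {j \<in> L. j < ?xs ! a} = a"
    using assms(2) by (auto simp: card_image inj_on_subset[OF inj])
  have "{j \<in> L. ?xs ! a < j} = (\<lambda>i. ?xs ! i) ` {Suc a..<card L}"
    unfolding sub using lt assms(2) by (intro arg_cong2[of _ _ _ _ "(`)"] refl) auto
  then show "card {j \<in> L. ?xs ! a < j} = card L - Suc a"
    using card_image[OF inj_on_subset[OF inj, of "{Suc a..<card L}"]] by (simp add: subset_eq)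
  let ?ys = "take a ?xs @ drop (Suc a) ?xs"
  have e: "?xs = take a ?xs @ ?xs ! a # drop (Suc a) ?xs"
    using assms(2) xs(3) by (simp add: id_take_nth_drop)
  have "sorted_wrt (<) (take a ?xs @ ?xs ! a # drop (Suc a) ?xs)" "distinct (take a ?xs @ ?xs ! a # drop (Suc a) ?xs)"
    "set (take a ?xs @ ?xs ! a # drop (Suc a) ?xs) = L"
    using xs by (simp_all flip: e)
  then have "sorted_wrt (<) ?ys" "set ?ys = L - {?xs ! a}"
    by (auto simp: sorted_wrt_append)
  then show "sorted_list_of_set (L - {?xs ! a}) = ?ys"
    by (metis assms(1) finite_Diff sorted_list_of_set.idem_if_sorted_distinct strict_sorted_iff)
qed

lemma DL_Suc:
  assumes "finite L" "card L = Suc l"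
  shows "DL v (Suc l) L = (\<Sum>i\<in>L. (- 1) ^ card {j \<in> L. i < j} * v l i * DL v l (L - {i}))"
proof -
  let ?xs = "sorted_list_of_set L"
  let ?A = "mat (Suc l) (Suc l) (\<lambda>(a, b). v b (?xs ! a))"
  have len: "length ?xs = Suc l" using assms by simp
  have "DL v (Suc l) L = (\<Sum>a<Suc l. ?A $$ (a, l) * cofactor ?A a l)"
    unfolding DL_def by (rule laplace_expansion_column) auto
  also have "\<dots> = (\<Sum>a<Suc l. (- 1) ^ card {j \<in> L. ?xs ! a < j} * v l (?xs ! a) * DL v l (L - {?xs ! a}))"
  proof (intro sum.cong refl)
    fix a assume "a \<in> {..<Suc l}"
    then have a: "a < Suc l" "a < card L" using assms by auto
    note p = sorted_list_of_set_position[OF assms(1) a(2)]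
    have "mat_delete ?A a l = mat l l (\<lambda>(i, j). v j (sorted_list_of_set (L - {?xs ! a}) ! i))"
      unfolding p(3) using a len by (intro eq_matI) (auto simp: mat_delete_def nth_append min_def)
    then have "cofactor ?A a l = (- 1) ^ (a + l) * DL v l (L - {?xs ! a})"
      by (simp add: cofactor_def DL_def)
    moreover have "(- 1 :: 'a) ^ (a + l) = (- 1) ^ card {j \<in> L. ?xs ! a < j}"
    proof -
      have "a + l = (l - a) + 2 * a" using a by simp
      then show ?thesis unfolding p(2) assms(2) by (simp only: power_add power_mult) simp
    qed
    ultimately show "?A $$ (a, l) * cofactor ?A a l
        = (- 1) ^ card {j \<in> L. ?xs ! a < j} * v l (?xs ! a) * DL v l (L - {?xs ! a})"
      using a by simp
  qed
  also have "\<dots> = (\<Sum>i\<in>L. (- 1) ^ card {j \<in> L. i < j} * v l i * DL v l (L - {i}))"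
  proof (rule sum.reindex_bij_betw)
    show "bij_betw ((!) ?xs) {..<Suc l} L"
      using bij_betw_nth[of ?xs "{..<Suc l}" L] assms len by simp
  qed
  finally show ?thesis .
qed

lemma DL_0: "DL v 0 L = 1"
  unfolding DL_def by simp

text \<open>The rows of the adjugate of the selected submatrix, extended by 0 outside
  \<open>L\<close>, are the required functionals.\<close>

lemma minor_dual:
  assumes "L \<subseteq> {..<n}" "card L = l"
  shows "\<exists>\<sigma>. \<forall>j<l. \<forall>k<l. (\<Sum>i<n. v j i * \<sigma> k i) = (if j = k then DL v l L else 0)"
proof -
  let ?xs = "sorted_list_of_set L"
  let ?A = "mat l l (\<lambda>(a, b). v b (?xs ! a))"
  have fin: "finite L" using assms(1) by (rule finite_subset) simp
  have A: "?A \<in> carrier_mat l l" by simp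
  have xs: "?xs ! a < n" if "a < l" for a
    using nth_mem[of a ?xs] fin assms that by auto
  define \<sigma> where "\<sigma> k i = (\<Sum>a<l. if ?xs ! a = i then adj_mat ?A $$ (k, a) else 0)" for k i
  have "(\<Sum>i<n. v j i * \<sigma> k i) = (if j = k then DL v l L else 0)" if "j < l" "k < l" for j k
  proof -
    have "(\<Sum>i<n. v j i * \<sigma> k i) = (\<Sum>a<l. \<Sum>i<n. if ?xs ! a = i then v j i * adj_mat ?A $$ (k, a) else 0)"
      unfolding \<sigma>_def sum_distrib_left by (subst sum.swap) (intro sum.cong refl, auto)
    also have "\<dots> = (\<Sum>a<l. v j (?xs ! a) * adj_mat ?A $$ (k, a))"
      using xs by (intro sum.cong refl) auto
    also have "\<dots> = (adj_mat ?A * ?A) $$ (k, j)"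
      using that adj_mat(1)[OF A] by (auto simp: scalar_prod_def atLeast0LessThan mult.commute intro!: sum.cong)
    also have "\<dots> = (if j = k then DL v l L else 0)"
      using that unfolding adj_mat(3)[OF A] by (auto simp: DL_def)
    finally show ?thesis .
  qed
  then show ?thesis by blast
qed

lemma subsets_card_0: "finite N \<Longrightarrow> {L. L \<subseteq> N \<and> card L = 0} = {{}}"
  by (auto simp: card_eq_0_iff dest: finite_subset)

lemma sum_card_insert:
  assumes "finite N"
  shows "(\<Sum>L\<in>{L. L \<subseteq> N \<and> card L = l}. \<Sum>i\<in>N - L. F L i)
    = (\<Sum>L\<in>{L. L \<subseteq> N \<and> card L = Suc l}. \<Sum>i\<in>L. F (L - {i}) i)"
proof -
  have fin: "finite L" if "L \<subseteq> N" for L using assms that by (rule finite_subset[rotated])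
  have "(\<Sum>L\<in>{L. L \<subseteq> N \<and> card L = l}. \<Sum>i\<in>N - L. F L i)
      = (\<Sum>(L, i)\<in>Sigma {L. L \<subseteq> N \<and> card L = l} (\<lambda>L. N - L). F L i)"
    using assms by (intro sum.Sigma) auto
  also have "\<dots> = (\<Sum>(L, i)\<in>Sigma {L. L \<subseteq> N \<and> card L = Suc l} (\<lambda>L. L). F (L - {i}) i)"
    by (rule sum.reindex_bij_witness[of _ "\<lambda>(L, i). (L - {i}, i)" "\<lambda>(L, i). (insert i L, i)"])
      (auto simp: insert_absorb fin)
  also have "\<dots> = (\<Sum>L\<in>{L. L \<subseteq> N \<and> card L = Suc l}. \<Sum>i\<in>L. F (L - {i}) i)"
    using assms by (intro sum.Sigma[symmetric]) (auto simp: fin)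
  finally show ?thesis .
qed

section \<open>Products of wedges and of contractions in coordinates\<close>

lemma ap_gEv:
  assumes "K \<subseteq> {..<n}"
  shows "ap (gEv n v) f (\<alpha>, \<gamma>, K) = (\<Sum>i\<in>K. wsign i K * v i * f (\<alpha>, \<gamma>, K - {i}))"
proof -
  have "ap (gEv n v) f (\<alpha>, \<gamma>, K) = (\<Sum>i<n. if i \<in> K then wsign i K * v i * f (\<alpha>, \<gamma>, K - {i}) else 0)"
    unfolding gEv_def ap_sum_op by (intro sum.cong refl) (auto simp: ap_op ap_scal ap_gens)
  also have "\<dots> = (\<Sum>i\<in>{..<n} \<inter> K. wsign i K * v i * f (\<alpha>, \<gamma>, K - {i}))"
    by (rule sum.inter_restrict[symmetric]) simp
  also have "{..<n} \<inter> K = K" using assms by blast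
  finally show ?thesis .
qed

lemma ap_gIv:
  "ap (gIv n v) f (\<alpha>, \<gamma>, K) = (\<Sum>i\<in>{..<n} - K. wsign i K * v i * f (\<alpha>, \<gamma>, insert i K))"
proof -
  have "ap (gIv n v) f (\<alpha>, \<gamma>, K)
      = (\<Sum>i<n. if i \<in> - K then wsign i K * v i * f (\<alpha>, \<gamma>, insert i K) else 0)"
    unfolding gIv_def ap_sum_op by (intro sum.cong refl) (auto simp: ap_op ap_scal ap_gens)
  also have "\<dots> = (\<Sum>i\<in>{..<n} \<inter> - K. wsign i K * v i * f (\<alpha>, \<gamma>, insert i K))"
    by (rule sum.inter_restrict[symmetric]) simp
  finally show ?thesis by (simp add: Diff_eq)
qed

lemma wsign2_insert:
  assumes "finite L" "finite J" "i \<notin> L" "i \<notin> J"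
  shows "wsign2 (insert i L) J = wsign2 L J * wsign i J"
    and "wsign2 L (insert i J) = wsign2 L J * (- 1) ^ card {j \<in> L. i < j}"
proof -
  have f: "finite {(a, b). a \<in> L \<and> b \<in> J \<and> b < a}"
    by (rule finite_subset[of _ "L \<times> J"]) (use assms in auto)
  have 1: "{(a, b). a \<in> insert i L \<and> b \<in> J \<and> b < a}
      = {(a, b). a \<in> L \<and> b \<in> J \<and> b < a} \<union> Pair i ` {j \<in> J. j < i}" by auto
  have "card {(a, b). a \<in> insert i L \<and> b \<in> J \<and> b < a}
      = card {(a, b). a \<in> L \<and> b \<in> J \<and> b < a} + card {j \<in> J. j < i}"
    unfolding 1 using assms f by (subst card_Un_disjoint) (auto simp: card_image inj_on_def)
  then show "wsign2 (insert i L) J = wsign2 L J * wsign i J"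
    by (simp add: wsign2_def wsign_def power_add)
  have 2: "{(a, b). a \<in> L \<and> b \<in> insert i J \<and> b < a}
      = {(a, b). a \<in> L \<and> b \<in> J \<and> b < a} \<union> (\<lambda>a. (a, i)) ` {j \<in> L. i < j}" by auto
  have "card {(a, b). a \<in> L \<and> b \<in> insert i J \<and> b < a}
      = card {(a, b). a \<in> L \<and> b \<in> J \<and> b < a} + card {j \<in> L. i < j}"
    unfolding 2 using assms f by (subst card_Un_disjoint) (auto simp: card_image inj_on_def)
  then show "wsign2 L (insert i J) = wsign2 L J * (- 1) ^ card {j \<in> L. i < j}"
    by (simp add: wsign2_def power_add)
qed

text \<open>This identifies the operator product with the explicit matrix of the splicing map. The
  operator for the last vector acts first, so the induction is Laplace expansion along the last
  column.\<close>

lemma wedge_expansion: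
  assumes "K \<subseteq> {..<n}"
  shows "ap (lprod (\<lambda>j. gEv n (v j)) l) f (\<alpha>, \<gamma>, K)
    = (\<Sum>L\<in>{L. L \<subseteq> K \<and> card L = l}. wsign2 L (K - L) * DL v l L * f (\<alpha>, \<gamma>, K - L))"
  using assms
proof (induction l arbitrary: f)
  case 0
  then have fin: "finite K" using finite_subset by blast
  then show ?case by (simp add: ap_op DL_0 wsign2_def subsets_card_0)
next
  case (Suc l)
  have fin: "finite L" if "L \<subseteq> K" for L using Suc.prems that by (meson finite_lessThan finite_subset)
  let ?F = "\<lambda>L i. wsign2 L (K - L) * DL v l L * (wsign i (K - L) * v l i * f (\<alpha>, \<gamma>, K - L - {i}))"
  have "ap (lprod (\<lambda>j. gEv n (v j)) (Suc l)) f (\<alpha>, \<gamma>, K)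
      = (\<Sum>L\<in>{L. L \<subseteq> K \<and> card L = l}. wsign2 L (K - L) * DL v l L * ap (gEv n (v l)) f (\<alpha>, \<gamma>, K - L))"
    using Suc.IH[OF Suc.prems] by (simp add: ap_op)
  also have "\<dots> = (\<Sum>L\<in>{L. L \<subseteq> K \<and> card L = l}. \<Sum>i\<in>K - L. ?F L i)"
    using Suc.prems by (intro sum.cong refl, subst ap_gEv) (auto simp: sum_distrib_left)
  also have "\<dots> = (\<Sum>L\<in>{L. L \<subseteq> K \<and> card L = Suc l}. \<Sum>i\<in>L. ?F (L - {i}) i)"
    by (rule sum_card_insert) (simp add: fin)
  also have "\<dots> = (\<Sum>L\<in>{L. L \<subseteq> K \<and> card L = Suc l}. wsign2 L (K - L) * DL v (Suc l) L * f (\<alpha>, \<gamma>, K - L))"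
  proof (intro sum.cong refl)
    fix L assume "L \<in> {L. L \<subseteq> K \<and> card L = Suc l}"
    then have L: "L \<subseteq> K" "card L = Suc l" by auto
    have "?F (L - {i}) i = wsign2 L (K - L)
        * ((- 1) ^ card {j \<in> L. i < j} * v l i * DL v l (L - {i})) * f (\<alpha>, \<gamma>, K - L)"
      if i: "i \<in> L" for i
    proof -
      have e: "K - (L - {i}) = insert i (K - L)" "K - (L - {i}) - {i} = K - L"
        "insert i (L - {i}) = L" "{j \<in> L - {i}. i < j} = {j \<in> L. i < j}"
        using i L(1) by auto
      have s1: "wsign2 (L - {i}) (insert i (K - L)) = wsign2 (L - {i}) (K - L) * (- 1 :: 'a) ^ card {j \<in> L. i < j}"
        using wsign2_insert(2)[of "L - {i}" "K - L" i, unfolded e(4)] i fin L(1) by simp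
      have s2: "wsign2 L (K - L) = wsign2 (L - {i}) (K - L) * (wsign i (K - L) :: 'a)"
        using wsign2_insert(1)[of "L - {i}" "K - L" i, unfolded e(3)] i fin L(1) by simp
      have s3: "wsign i (insert i (K - L)) = (wsign i (K - L) :: 'a)"
        using i by (simp add: wsign_insert)
      show ?thesis unfolding e(2) unfolding e(1) s1 s3 unfolding s2 by (simp add: algebra_simps)
    qed
    then have "(\<Sum>i\<in>L. ?F (L - {i}) i) = (\<Sum>i\<in>L. wsign2 L (K - L)
        * ((- 1) ^ card {j \<in> L. i < j} * v l i * DL v l (L - {i})) * f (\<alpha>, \<gamma>, K - L))"
      by (intro sum.cong refl) blast
    then show "(\<Sum>i\<in>L. ?F (L - {i}) i) = wsign2 L (K - L) * DL v (Suc l) L * f (\<alpha>, \<gamma>, K - L)"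
      unfolding DL_Suc[OF fin[OF L(1)] L(2)] by (simp add: sum_distrib_left sum_distrib_right)
  qed
  finally show ?case .
qed

text \<open>Only membership of the value in the ideal of minors will be used, so the overall sign
  \<open>c\<close> stays unspecified.\<close>

lemma contraction_expansion:
  "\<exists>c. \<forall>f. ap (lprod (\<lambda>j. gIv n (v j)) m) f (\<alpha>, \<gamma>, {})
    = c * (\<Sum>L\<in>{L. L \<subseteq> {..<n} \<and> card L = m}. DL v m L * f (\<alpha>, \<gamma>, L))"
proof (induction m)
  case 0
  show ?case by (intro exI[of _ 1]) (simp add: ap_op DL_0 subsets_card_0)
next
  case (Suc m)
  have fin: "finite L" if "L \<subseteq> {..<n}" for L using that finite_subset by blast
  obtain c where c: "\<And>f. ap (lprod (\<lambda>j. gIv n (v j)) m) f (\<alpha>, \<gamma>, {})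
      = c * (\<Sum>L\<in>{L. L \<subseteq> {..<n} \<and> card L = m}. DL v m L * f (\<alpha>, \<gamma>, L))"
    using Suc.IH by blast
  have "ap (lprod (\<lambda>j. gIv n (v j)) (Suc m)) f (\<alpha>, \<gamma>, {})
      = c * (- 1) ^ m * (\<Sum>L\<in>{L. L \<subseteq> {..<n} \<and> card L = Suc m}. DL v (Suc m) L * f (\<alpha>, \<gamma>, L))" for f
  proof -
    let ?F = "\<lambda>L i. DL v m L * (wsign i L * v m i * f (\<alpha>, \<gamma>, insert i L))"
    have "(\<Sum>L\<in>{L. L \<subseteq> {..<n} \<and> card L = m}. DL v m L * ap (gIv n (v m)) f (\<alpha>, \<gamma>, L))
        = (\<Sum>L\<in>{L. L \<subseteq> {..<n} \<and> card L = m}. \<Sum>i\<in>{..<n} - L. ?F L i)"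
      by (simp add: ap_gIv sum_distrib_left)
    also have "\<dots> = (\<Sum>L\<in>{L. L \<subseteq> {..<n} \<and> card L = Suc m}. \<Sum>i\<in>L. ?F (L - {i}) i)"
      by (rule sum_card_insert) simp
    also have "\<dots> = (\<Sum>L\<in>{L. L \<subseteq> {..<n} \<and> card L = Suc m}. (- 1) ^ m * (DL v (Suc m) L * f (\<alpha>, \<gamma>, L)))"
    proof (intro sum.cong refl)
      fix L assume "L \<in> {L. L \<subseteq> {..<n} \<and> card L = Suc m}"
      then have L: "finite L" "card L = Suc m" using fin by auto
      have "?F (L - {i}) i = (- 1) ^ m
          * ((- 1) ^ card {j \<in> L. i < j} * v m i * DL v m (L - {i}) * f (\<alpha>, \<gamma>, L))"
        if i: "i \<in> L" for i
      proof -
        have "L - {i} = {j \<in> L. j < i} \<union> {j \<in> L. i < j}" by auto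
        moreover have "card (L - {i}) = m" using L i by simp
        ultimately have "m = card ({j \<in> L. j < i} \<union> {j \<in> L. i < j})" by simp
        also have "\<dots> = card {j \<in> L. j < i} + card {j \<in> L. i < j}"
          using L by (intro card_Un_disjoint) auto
        finally have "(- 1 :: 'a) ^ m * (- 1) ^ card {j \<in> L. i < j}
            = (- 1) ^ (card {j \<in> L. j < i} + 2 * card {j \<in> L. i < j})"
          by (simp add: mult_2 add.assoc flip: power_add)
        then have s: "(- 1 :: 'a) ^ m * (- 1) ^ card {j \<in> L. i < j} = (- 1) ^ card {j \<in> L. j < i}"
          by (simp add: power_add)
        have "wsign i (L - {i}) = (- 1 :: 'a) ^ m * (- 1) ^ card {j \<in> L. i < j}"
          unfolding s by (simp add: wsign_remove) (simp add: wsign_def)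
        then show ?thesis using i by (simp add: insert_absorb algebra_simps)
      qed
      then have "(\<Sum>i\<in>L. ?F (L - {i}) i) = (\<Sum>i\<in>L. (- 1) ^ m
          * ((- 1) ^ card {j \<in> L. i < j} * v m i * DL v m (L - {i}) * f (\<alpha>, \<gamma>, L)))"
        by (intro sum.cong refl) blast
      then show "(\<Sum>i\<in>L. ?F (L - {i}) i) = (- 1) ^ m * (DL v (Suc m) L * f (\<alpha>, \<gamma>, L))"
        unfolding DL_Suc[OF L] by (simp add: sum_distrib_left sum_distrib_right)
    qed
    finally show ?thesis by (simp add: ap_op c sum_distrib_left mult.assoc)
  qed
  then show ?case by blast
qed

section \<open>Grade and exactness\<close>

lemma is_ideal_gen: "is_ideal (gen X)"
  unfolding is_ideal_def gen_def
proof (intro conjI ballI allI; clarsimp)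
  show "\<exists>c. (\<Sum>x\<in>X. c x * x) = 0" by (rule exI[of _ "\<lambda>_. 0"]) simp
  show "\<exists>e. (\<Sum>x\<in>X. c x * x) + (\<Sum>x\<in>X. d x * x) = (\<Sum>x\<in>X. e x * x)" for c d
    by (rule exI[of _ "\<lambda>x. c x + d x"]) (simp add: sum.distrib algebra_simps)
  show "\<exists>e. r * (\<Sum>x\<in>X. c x * x) = (\<Sum>x\<in>X. e x * x)" for r c
    by (rule exI[of _ "\<lambda>x. r * c x"]) (simp add: sum_distrib_left algebra_simps)
qed

lemma gen_memI: "finite X \<Longrightarrow> x \<in> X \<Longrightarrow> x \<in> gen X"
  unfolding gen_def
  by (intro CollectI exI[of _ "\<lambda>y. if y = x then 1 else 0"]) (simp add: if_distrib[of "\<lambda>c. c * _"] cong: if_cong)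

lemma gen_least: "is_ideal Q \<Longrightarrow> X \<subseteq> Q \<Longrightarrow> gen X \<subseteq> Q"
  unfolding gen_def by (auto intro!: is_ideal_sum is_ideal_mult)

lemma gen_insert:
  assumes "finite X" shows "gen (insert a X) = adjoin (gen X) a"
proof
  have "X \<subseteq> adjoin (gen X) a"
    using gen_memI[OF assms] adjoin_superset by blast
  moreover have "a \<in> adjoin (gen X) a"
    using adjoin_generator[OF is_ideal_gen, of a 1 X] by simp
  ultimately show "gen (insert a X) \<subseteq> adjoin (gen X) a"
    by (intro gen_least is_ideal_adjoin is_ideal_gen) auto
  have "gen X \<subseteq> gen (insert a X)"
    using assms by (intro gen_least is_ideal_gen) (auto intro: gen_memI)
  moreover have "a \<in> gen (insert a X)" using assms by (intro gen_memI) auto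
  ultimately show "adjoin (gen X) a \<subseteq> gen (insert a X)"
    unfolding adjoin_def
    by (auto intro!: is_ideal_add[OF is_ideal_gen] is_ideal_mult_right[OF is_ideal_gen])
qed

lemma wreg_gen:
  assumes "finite X"
    and "\<And>i y. i < length ys \<Longrightarrow> ys ! i * y \<in> gen (X \<union> set (take i ys)) \<Longrightarrow> y \<in> gen (X \<union> set (take i ys))"
  shows "wreg (gen X) ys"
  using assms
proof (induction ys arbitrary: X)
  case (Cons a ys)
  have "\<forall>y. a * y \<in> gen X \<longrightarrow> y \<in> gen X" using Cons.prems(2)[of 0] by simp
  moreover have "wreg (gen (insert a X)) ys"
    using Cons.prems(1) Cons.prems(2)[of "Suc i" for i] by (intro Cons.IH) auto
  ultimately show ?case using Cons.prems(1) by (simp add: gen_insert)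
qed simp

lemma gen_empty: "gen {} = {0}"
  by (auto simp: gen_def)

lemma wreg_take: "wreg J xs \<Longrightarrow> wreg J (take k xs)"
proof (induction xs arbitrary: J k)
  case (Cons a xs)
  then show ?case by (cases k) auto
qed simp

lemma wreg_ones: "wreg J (replicate k 1)"
  by (induction k arbitrary: J) auto

lemma grade_wreg:
  assumes "enat k \<le> grade I"
  shows "\<exists>xs. length xs = k \<and> set xs \<subseteq> I \<and> wreg {0} xs"
proof (cases "I = UNIV")
  case True
  then show ?thesis using wreg_ones by (intro exI[of _ "replicate k 1"]) auto
next
  case False
  let ?S = "{enat (length xs) |xs. set xs \<subseteq> I \<and> regular_seq xs}"
  have "\<exists>xs. k \<le> length xs \<and> set xs \<subseteq> I \<and> wreg {0} xs"
  proof (cases k)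
    case 0
    then show ?thesis by (intro exI[of _ "[]"]) auto
  next
    case (Suc j)
    have "\<exists>xs. k \<le> length xs \<and> set xs \<subseteq> I \<and> regular_seq xs"
    proof (rule ccontr)
      assume "\<not> ?thesis"
      then have "\<And>xs. set xs \<subseteq> I \<Longrightarrow> regular_seq xs \<Longrightarrow> length xs \<le> j" using Suc by fastforce
      then have "Sup ?S \<le> enat j" by (intro Sup_least) auto
      moreover have "enat k \<le> Sup ?S" using assms False by (simp add: grade_def)
      ultimately have "enat k \<le> enat j" by (rule order_trans[rotated])
      then show False using Suc by simp
    qed
    then obtain xs where xs: "k \<le> length xs" "set xs \<subseteq> I" "regular_seq xs" by blast
    have "wreg (gen {}) xs"
    proof (rule wreg_gen)
      fix i y assume "i < length xs" "xs ! i * y \<in> gen ({} \<union> set (take i xs))"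
      then show "y \<in> gen ({} \<union> set (take i xs))"
        using xs(3) unfolding regular_seq_def Un_empty_left by blast
    qed simp
    then show ?thesis using xs unfolding gen_empty by blast
  qed
  then obtain xs where "k \<le> length xs" "set xs \<subseteq> I" "wreg {0} xs" by blast
  then show ?thesis
    by (intro exI[of _ "take k xs"]) (auto simp: wreg_take dest: in_set_takeD)
qed

lemma I_phi_eq: "I_phi \<phi> l n = gen {DL (\<lambda>j i. \<phi> i j) l L |L. L \<subseteq> {..<n} \<and> card L = l}"
  unfolding I_phi_def
  by (rule arg_cong[of _ _ gen], rule Collect_cong) (metis det_sub_rows finite_lessThan finite_subset)

lemma I_psi_eq: "I_psi \<psi> m n = gen {DL \<psi> m L |L. L \<subseteq> {..<n} \<and> card L = m}"
  unfolding I_psi_def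
  by (rule arg_cong[of _ _ gen], rule Collect_cong) (metis det_sub_columns finite_lessThan finite_subset)

lemma finite_minors: "finite {F L |L. L \<subseteq> {..<n::nat} \<and> card L = l}"
proof -
  have "{F L |L. L \<subseteq> {..<n::nat} \<and> card L = l} \<subseteq> F ` Pow {..<n}" by auto
  then show ?thesis by (rule finite_subset) simp
qed

lemma rad_rad: "rad (rad Q) = rad Q"
proof
  show "rad (rad Q) \<subseteq> rad Q"
    unfolding rad_def by (auto simp flip: power_mult)
  show "rad Q \<subseteq> rad (rad Q)"
    unfolding rad_def by clarsimp (metis power_one_right)
qed

lemma rad_mono: "P \<subseteq> Q \<Longrightarrow> rad P \<subseteq> rad Q"
  by (auto simp: rad_def)

lemma exact_of_radical:
  fixes B :: "nat \<Rightarrow> 'i set" and d :: "nat \<Rightarrow> ('i, 'a::comm_ring_1) op"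
  assumes "\<And>p f. on (B p) f \<Longrightarrow> on (B (Suc p)) (ap (d p) f)"
    and dd: "\<And>p. d (Suc p) * d p = 0"
    and xs: "wreg {0} xs" "set xs \<subseteq> rad {a. \<exists>N. nullh B d (\<delta> ^ N * a)}" "p < length xs"
    and f: "on (B p) f" "ap (d p) f = (\<lambda>_. 0)"
  shows "\<exists>M. case p of 0 \<Rightarrow> (\<lambda>x. \<delta> ^ M * f x) = (\<lambda>_. 0)
    | Suc q \<Rightarrow> \<exists>y. on (B q) y \<and> ap (d q) y = (\<lambda>x. \<delta> ^ M * f x)"
proof -
  have J: "is_ideal {0::'a}" by (auto simp: is_ideal_def)
  obtain ys where ys: "length ys = length xs" "set ys \<subseteq> {a. \<exists>N. nullh B d (\<delta> ^ N * a)}" "wreg {0} ys"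
    using wreg_in_radical[OF J xs(1,2)] by blast
  have "ap (d (Suc p)) (ap (d p) f) = (\<lambda>_. 0)" for p f
    using dd[of p] by (metis ap_op(1,6))
  moreover have "\<exists>N. nullh B d (\<delta> ^ N * a)" if "a \<in> set ys" for a using ys(2) that by auto
  ultimately have "\<exists>M. case p of 0 \<Rightarrow> \<forall>x. \<delta> ^ M * f x \<in> {0}
    | Suc q \<Rightarrow> \<exists>y. on (B q) y \<and> (\<forall>x. \<delta> ^ M * f x - ap (d q) y x \<in> {0})"
    using assms(1) J ys(1,3) xs(3) f by (intro exact_up_to_power[of B d "{0}" ys \<delta> p f]) auto
  then obtain M where "case p of 0 \<Rightarrow> \<forall>x. \<delta> ^ M * f x \<in> {0}
    | Suc q \<Rightarrow> \<exists>y. on (B q) y \<and> (\<forall>x. \<delta> ^ M * f x - ap (d q) y x \<in> {0})" ..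
  then show ?thesis by (intro exI[of _ M]) (auto simp: fun_eq_iff split: nat.splits)
qed

definition Xs :: "nat \<Rightarrow> nat \<Rightarrow> nat \<Rightarrow> nat \<Rightarrow> nat \<Rightarrow> nat \<Rightarrow> idx set" where
  "Xs l m n t p q = (if p \<le> t then Bt l m n (int t - int p) (int q) (int p - int q)
     else Bt l m n (int p - int t - 1) (int q) (int p + int l - 1 - int q))"

definition drow :: "nat \<Rightarrow> nat \<Rightarrow> (nat \<Rightarrow> nat \<Rightarrow> 'a::comm_ring_1) \<Rightarrow> nat \<Rightarrow> nat \<Rightarrow> (idx, 'a) op" where
  "drow l n \<phi> t p = (if p < t then \<Sum>j<l. dA j * gEv n (\<lambda>i. \<phi> i j)
     else if p = t then lprod (\<lambda>j. gEv n (\<lambda>i. \<phi> i j)) l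
     else \<Sum>j<l. uA j * gEv n (\<lambda>i. \<phi> i j))"

definition bcol :: "nat \<Rightarrow> nat \<Rightarrow> (nat \<Rightarrow> nat \<Rightarrow> 'a::comm_ring_1) \<Rightarrow> (idx, 'a) op" where
  "bcol m n \<psi> = (\<Sum>k<m. uC k * gIv n (\<psi> k))"

section \<open>Exactness of the rows and of the columns\<close>

lemma
  shows on_drow: "on (Xs l m n t p q) f \<Longrightarrow> on (Xs l m n t (Suc p) q) (ap (drow l n \<phi> t p) f)"
    and drow_drow: "drow l n \<phi> t (Suc p) * drow l n \<phi> t p = 0"
proof -
  interpret graded_koszul_ops l "\<lambda>j. gEv n (\<lambda>i. \<phi> i j)" uA dA "\<lambda>a c. Bt l m n a (int q) (c - int q)"
    by (rule row_ops)
  have "Cx t p = Xs l m n t p q" "dx t p = drow l n \<phi> t p" for p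
    by (simp_all add: Cx_def Xs_def dx_def drow_def dD_def dS_def X_def)
  then show "on (Xs l m n t p q) f \<Longrightarrow> on (Xs l m n t (Suc p) q) (ap (drow l n \<phi> t p) f)"
    "drow l n \<phi> t (Suc p) * drow l n \<phi> t p = 0"
    using on_dx[of t p f] dx_dx[of t p] by simp_all
qed

lemma row_null:
  assumes "L \<subseteq> {..<n}" "card L = l"
  shows "nullh (\<lambda>p. Xs l m n t p q) (drow l n \<phi> t) (DL (\<lambda>j i. \<phi> i j) l L ^ l)"
proof -
  obtain \<sigma> where "\<And>j k. j < l \<Longrightarrow> k < l \<Longrightarrow>
      (\<Sum>i<n. \<phi> i j * \<sigma> k i) = (if j = k then DL (\<lambda>j i. \<phi> i j) l L else 0)"
    using minor_dual[OF assms, of "\<lambda>j i. \<phi> i j"] by blast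
  then interpret graded_koszul_homotopy l "\<lambda>j. gEv n (\<lambda>i. \<phi> i j)" uA dA
    "\<lambda>a c. Bt l m n a (int q) (c - int q)" "\<lambda>k. gIv n (\<sigma> k)" "DL (\<lambda>j i. \<phi> i j) l L"
    by (rule row_homotopy)
  have "Cx t = (\<lambda>p. Xs l m n t p q)" "dx t = drow l n \<phi> t"
    by (auto simp: Cx_def Xs_def dx_def drow_def dD_def dS_def X_def)
  then show ?thesis using nullh_power[of t] by simp
qed

text \<open>A power of every minor is null-homotopic, so \<open>I_phi\<close> lies in the radical of
  the ideal of null-homotopic elements, and a weakly regular sequence in \<open>I_phi\<close> yields
  one of the same length in that ideal. With 1 in place of \<open>\<delta>\<close> exactness holds
  on the nose.\<close>

lemma row_exactness:
  assumes "enat p < grade (I_phi \<phi> l n)" "on (Xs l m n t p q) f" "ap (drow l n \<phi> t p) f = (\<lambda>_. 0)"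
  shows "case p of 0 \<Rightarrow> f = (\<lambda>_. 0) | Suc p' \<Rightarrow> \<exists>y. on (Xs l m n t p' q) y \<and> ap (drow l n \<phi> t p') y = f"
proof -
  have "enat (Suc p) \<le> grade (I_phi \<phi> l n)" using assms(1) by (simp add: Suc_ile_eq)
  then obtain xs where xs: "length xs = Suc p" "set xs \<subseteq> I_phi \<phi> l n" "wreg {0} xs"
    using grade_wreg by blast
  let ?Q = "{a. \<exists>N. nullh (\<lambda>p. Xs l m n t p q) (drow l n \<phi> t) (1 ^ N * a)}"
  have "I_phi \<phi> l n \<subseteq> rad ?Q"
    unfolding I_phi_eq
  proof (intro gen_least is_ideal_rad is_ideal_nullh subsetI)
    fix a assume "a \<in> {DL (\<lambda>j i. \<phi> i j) l L |L. L \<subseteq> {..<n} \<and> card L = l}"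
    then obtain L where a: "a = DL (\<lambda>j i. \<phi> i j) l L" and L: "L \<subseteq> {..<n}" "card L = l" by blast
    have "a ^ l \<in> ?Q" using row_null[OF L, of m t q \<phi>] by (simp add: a)
    then show "a \<in> rad ?Q" unfolding rad_def by blast
  qed
  then have "set xs \<subseteq> rad ?Q" using xs(2) by blast
  then have "\<exists>M. case p of 0 \<Rightarrow> (\<lambda>x. 1 ^ M * f x) = (\<lambda>_. 0)
    | Suc p' \<Rightarrow> \<exists>y. on (Xs l m n t p' q) y \<and> ap (drow l n \<phi> t p') y = (\<lambda>x. 1 ^ M * f x)"
    using xs assms(2,3)
    by (intro exact_of_radical[of "\<lambda>p. Xs l m n t p q" "drow l n \<phi> t" xs 1 p f] on_drow drow_drow) auto
  then show ?thesis by (cases p) auto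
qed

lemma column_exactness:
  assumes "wreg {0} xs" "set xs \<subseteq> rad (I_psi \<psi> m n)" "t < p"
    and "q + 2 + nat (int n - int m - (int p + int l - 1)) < length xs"
    and f: "on (Xs l m n t p (Suc q)) f" "ap (bcol m n \<psi>) f = (\<lambda>_. 0)"
  shows "\<exists>w. on (Xs l m n t p q) w \<and> ap (bcol m n \<psi>) w = f"
proof -
  \<comment> \<open>The least \<open>u \<ge> 0\<close> with \<open>n \<le> s\<close>. The first
    symmetric term of \<open>Cx u\<close>, in position \<open>u + 1\<close>, then has exterior
    degree \<open>p + l - 1\<close> and is the bottom of the column; row \<open>q\<close> is
    position \<open>q + u + 1\<close>.\<close>
  define u where "u = nat (int n - int m - (int p + int l - 1))"
  define s where "s = int p + int l - 1 + int u + int m"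
  define a where "a = int p - int t - 1"
  have s: "int n \<le> s" by (simp add: s_def u_def)
  interpret graded_koszul_ops m "\<lambda>k. gIv n (\<psi> k)" uC dC "\<lambda>x c. Bt l m n a x (s - c)"
    by (rule column_ops[OF s])
  let ?Q = "{a. \<exists>N. nullh (Cx u) (dx u) (1 ^ N * a)}"
  have "DL \<psi> m L \<in> rad ?Q" if L: "L \<subseteq> {..<n}" "card L = m" for L
  proof -
    obtain \<tau> where "\<And>j k. j < m \<Longrightarrow> k < m \<Longrightarrow> (\<Sum>i<n. \<psi> j i * \<tau> k i) = (if j = k then DL \<psi> m L else 0)"
      using minor_dual[OF L, of \<psi>] by blast
    from column_homotopy[OF s this]
    interpret graded_koszul_homotopy m "\<lambda>k. gIv n (\<psi> k)" uC dC "\<lambda>x c. Bt l m n a x (s - c)"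
      "\<lambda>k. gEv n (\<tau> k)" "DL \<psi> m L" .
    show ?thesis using nullh_power[of u] by (auto simp: rad_def)
  qed
  then have "I_psi \<psi> m n \<subseteq> rad ?Q"
    unfolding I_psi_eq by (intro gen_least is_ideal_rad is_ideal_nullh) auto
  then have xs: "set xs \<subseteq> rad ?Q" using assms(2) rad_mono rad_rad by blast
  have C: "Cx u (Suc (q + u + 1)) = Xs l m n t p (Suc q)" "Cx u (q + u + 1) = Xs l m n t p q"
    unfolding Cx_def Xs_def using assms(3) by (simp_all add: s_def a_def algebra_simps)
  have d: "dx u (Suc (q + u + 1)) = bcol m n \<psi>" "dx u (q + u + 1) = bcol m n \<psi>"
    by (auto simp: dx_def bcol_def dS_def)
  have len: "Suc (q + u + 1) < length xs" using assms(4) by (simp add: u_def)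
  have f': "on (Cx u (Suc (q + u + 1))) f" "ap (dx u (Suc (q + u + 1))) f = (\<lambda>_. 0)"
    unfolding C d by (rule f)+
  have "\<exists>w. on (Cx u (q + u + 1)) w \<and> ap (dx u (q + u + 1)) w = f"
    using exact_of_radical[OF on_dx dx_dx assms(1) xs len f'] by simp
  then show ?thesis unfolding C d by simp
qed

text \<open>Inverting \<open>\<delta>\<close> makes \<open>\<psi>\<close> a map from a module of rank \<open>n - l\<close>. The grade of its ideal of
  maximal minors exceeds the generic value \<open>n - l - m + 1\<close>, so this ideal is the unit ideal: the last
  differential of the associated complex is surjective. The splitting is realised over the given ring
  by adjoining to \<open>\<psi>\<close> the functionals \<open>\<sigma>\<close> dual to the columns of \<open>\<phi>\<close>.\<close>

lemma phi_minor_in_radical: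
  fixes \<phi> \<psi> :: "nat \<Rightarrow> nat \<Rightarrow> 'a::comm_ring_1"
  assumes complex: "\<And>k j. k < m \<Longrightarrow> j < l \<Longrightarrow> (\<Sum>i<n. \<psi> k i * \<phi> i j) = 0"
    and xs: "wreg {0} xs" "set xs \<subseteq> I_psi \<psi> m n" "nat (int n - int m - int l) + 1 < length xs"
    and L: "L \<subseteq> {..<n}" "card L = l"
  shows "DL (\<lambda>j i. \<phi> i j) l L \<in> rad (I_psi \<psi> m n)"
proof -
  let ?\<delta> = "DL (\<lambda>j i. \<phi> i j) l L"
  \<comment> \<open>Now \<open>n \<le> s\<close>, the term in position \<open>u + 1\<close> is the
    ring itself and the next one is 0. Exactness there demands a sequence longer than
    \<open>u + 1\<close>.\<close>
  define u where "u = nat (int n - int m - int l)"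
  define s where "s = int u + int m + int l"
  have s: "int n \<le> s" by (simp add: s_def u_def)
  obtain \<sigma> where \<sigma>: "\<And>j k. j < l \<Longrightarrow> k < l \<Longrightarrow>
      (\<Sum>i<n. \<phi> i j * \<sigma> k i) = (if j = k then ?\<delta> else 0)"
    using minor_dual[OF L, of "\<lambda>j i. \<phi> i j"] by blast
  define \<Psi> where "\<Psi> k = (if k < m then \<psi> k else \<sigma> (k - m))" for k
  interpret graded_koszul_ops "m + l" "\<lambda>k. gIv n (\<Psi> k)" uC dC "\<lambda>a c. Bt l (m + l) n 0 a (s - c)"
    by (rule column_ops[OF s])
  let ?Q = "{a. \<exists>N. nullh (Cx u) (dx u) (?\<delta> ^ N * a)}"
  have "DL \<psi> m K \<in> rad ?Q" if K: "K \<subseteq> {..<n}" "card K = m" for K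
  proof -
    let ?\<Delta> = "DL \<psi> m K"
    obtain \<tau> where \<tau>: "\<And>j k. j < m \<Longrightarrow> k < m \<Longrightarrow>
        (\<Sum>i<n. \<psi> j i * \<tau> k i) = (if j = k then ?\<Delta> else 0)"
      using minor_dual[OF K, of \<psi>] by blast
    \<comment> \<open>Vectors dual to \<open>\<Psi>\<close> up to the factor
      \<open>\<delta> * \<Delta>\<close>. Subtracting columns of \<open>\<phi>\<close> from
      \<open>\<delta> * \<tau> k\<close> makes all \<open>\<sigma> j\<close> vanish on it, and
      \<open>\<psi>\<close> does not notice since it kills these columns.\<close>
    define T where "T k i = (if k < m then ?\<delta> * \<tau> k i - (\<Sum>j<l. (\<Sum>i<n. \<sigma> j i * \<tau> k i) * \<phi> i j)
      else ?\<Delta> * \<phi> i (k - m))" for k i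
    have lin: "(\<Sum>i<n. v i * T k i) = ?\<delta> * (\<Sum>i<n. v i * \<tau> k i)
        - (\<Sum>j<l. (\<Sum>i<n. \<sigma> j i * \<tau> k i) * (\<Sum>i<n. v i * \<phi> i j))" if "k < m" for v k
    proof -
      have "(\<Sum>i<n. v i * T k i) = (\<Sum>i<n. ?\<delta> * (v i * \<tau> k i))
          - (\<Sum>i<n. \<Sum>j<l. (\<Sum>i<n. \<sigma> j i * \<tau> k i) * (v i * \<phi> i j))"
        using that by (simp add: T_def right_diff_distrib sum_subtractf sum_distrib_left mult.left_commute)
      also have "(\<Sum>i<n. \<Sum>j<l. (\<Sum>i<n. \<sigma> j i * \<tau> k i) * (v i * \<phi> i j))
          = (\<Sum>j<l. (\<Sum>i<n. \<sigma> j i * \<tau> k i) * (\<Sum>i<n. v i * \<phi> i j))"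
        by (subst sum.swap) (simp add: sum_distrib_left)
      finally show ?thesis by (simp add: sum_distrib_left)
    qed
    have \<sigma>\<phi>: "(\<Sum>i<n. \<sigma> k i * \<phi> i j) = (if k = j then ?\<delta> else 0)" if "j < l" "k < l" for j k
      using \<sigma>[OF that] by (auto simp: mult.commute)
    have dual: "(\<Sum>i<n. \<Psi> j i * T k i) = (if j = k then ?\<delta> * ?\<Delta> else 0)"
      if jk: "j < m + l" "k < m + l" for j k
    proof (cases "k < m")
      case k: True
      show ?thesis
      proof (cases "j < m")
        case True
        then show ?thesis using k by (simp add: lin \<Psi>_def \<tau> complex)
      next
        case False
        define j' where "j' = j - m"
        have j': "j' < l" using False jk by (simp add: j'_def)
        have "(\<Sum>i<n. \<sigma> j' i * T k i) = ?\<delta> * (\<Sum>i<n. \<sigma> j' i * \<tau> k i)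
            - (\<Sum>x<l. (\<Sum>i<n. \<sigma> x i * \<tau> k i) * (if j' = x then ?\<delta> else 0))"
          unfolding lin[OF k] by (intro arg_cong2[of _ _ _ _ minus] refl sum.cong) (simp add: \<sigma>\<phi> j')
        also have "(\<Sum>x<l. (\<Sum>i<n. \<sigma> x i * \<tau> k i) * (if j' = x then ?\<delta> else 0))
            = (\<Sum>x<l. if x = j' then (\<Sum>i<n. \<sigma> x i * \<tau> k i) * ?\<delta> else 0)"
          by (intro sum.cong) auto
        also have "\<dots> = ?\<delta> * (\<Sum>i<n. \<sigma> j' i * \<tau> k i)" using j' by (simp add: mult.commute)
        finally show ?thesis using False k by (simp add: \<Psi>_def j'_def)
      qed
    next
      case k: False
      have "(\<Sum>i<n. \<Psi> j i * T k i) = ?\<Delta> * (\<Sum>i<n. \<Psi> j i * \<phi> i (k - m))"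
        using k by (simp add: T_def sum_distrib_left mult.left_commute)
      then show ?thesis using k jk by (auto simp: \<Psi>_def complex \<sigma>\<phi>)
    qed
    interpret graded_koszul_homotopy "m + l" "\<lambda>k. gIv n (\<Psi> k)" uC dC
      "\<lambda>a c. Bt l (m + l) n 0 a (s - c)" "\<lambda>k. gEv n (T k)" "?\<delta> * ?\<Delta>"
      by (rule column_homotopy[OF s dual])
    have "nullh (Cx u) (dx u) (?\<delta> ^ (m + l) * ?\<Delta> ^ (m + l))"
      using nullh_power[of u] by (simp add: power_mult_distrib)
    then show ?thesis unfolding rad_def by blast
  qed
  then have "I_psi \<psi> m n \<subseteq> rad ?Q"
    unfolding I_psi_eq by (intro gen_least is_ideal_rad is_ideal_nullh) auto
  then have rad: "set xs \<subseteq> rad ?Q" using xs(2) by blast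
  \<comment> \<open>The generator 1 of the last nonzero term, a cycle for degree reasons.\<close>
  define f :: "idx \<Rightarrow> 'a"
    where "f = (\<lambda>(\<alpha>, \<gamma>, J). if \<alpha> = (\<lambda>_. 0) \<and> \<gamma> = (\<lambda>_. 0) \<and> J = {} then 1 else 0)"
  have f: "on (Cx u (Suc u)) f"
    unfolding Cx_def by (auto simp: s_def on_def Bt_def MonZ_def f_def)
  have "on (Cx u (Suc (Suc u))) (ap (dx u (Suc u)) f)" by (rule on_dx[OF f])
  moreover have "Cx u (Suc (Suc u)) = {}" unfolding Cx_def by (auto simp: s_def intro!: Bt_empty)
  ultimately have df: "ap (dx u (Suc u)) f = (\<lambda>_. 0)" by (simp add: on_empty)
  obtain M y where y: "ap (dx u u) y = (\<lambda>x. ?\<delta> ^ M * f x)"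
    using exact_of_radical[of "Cx u" "dx u" xs ?\<delta> "Suc u" f, OF on_dx dx_dx xs(1) rad _ f df] xs(3)
    by (auto simp: u_def)
  have split: "lprod g (a + k) = lprod g a * lprod (\<lambda>j. g (a + j)) k" for g :: "nat \<Rightarrow> (idx, 'a) op" and a k
    by (induction k) (simp_all add: mult.assoc)
  have \<psi>: "lprod (\<lambda>k. gIv n (\<Psi> k)) k = lprod (\<lambda>k. gIv n (\<psi> k)) k" if "k \<le> m" for k
    using that by (induction k) (simp_all add: \<Psi>_def)
  \<comment> \<open>The map into the last term contracts with all of \<open>\<Psi>\<close>. The
    contractions with \<open>\<psi>\<close> come last, so the value is a combination of maximal
    minors of \<open>\<psi>\<close>.\<close>
  have "?\<delta> ^ M = ap (dx u u) y (\<lambda>_. 0, \<lambda>_. 0, {})" unfolding y by (simp add: f_def)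
  also have "\<dots> = ap (lprod (\<lambda>k. gIv n (\<psi> k)) m)
      (ap (lprod (\<lambda>j. gIv n (\<Psi> (m + j))) l) y) (\<lambda>_. 0, \<lambda>_. 0, {})"
    by (simp add: dx_def X_def split \<psi> ap_op)
  also have "\<dots> \<in> I_psi \<psi> m n"
  proof -
    have "DL \<psi> m K \<in> I_psi \<psi> m n" if "K \<subseteq> {..<n}" "card K = m" for K
      unfolding I_psi_eq by (rule gen_memI[OF finite_minors]) (use that in blast)
    then have "c * (\<Sum>K\<in>{K. K \<subseteq> {..<n} \<and> card K = m}. DL \<psi> m K * z K) \<in> I_psi \<psi> m n" for c z
      unfolding I_psi_def
      by (intro is_ideal_mult is_ideal_sum is_ideal_mult_right is_ideal_gen) auto
    moreover obtain c where "\<And>z. ap (lprod (\<lambda>j. gIv n (\<psi> j)) m) z (\<lambda>_. 0, \<lambda>_. 0, {})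
        = c * (\<Sum>K\<in>{K. K \<subseteq> {..<n} \<and> card K = m}. DL \<psi> m K * z (\<lambda>_. 0, \<lambda>_. 0, K))"
      using contraction_expansion[of n \<psi> m "\<lambda>_. 0" "\<lambda>_. 0"] by blast
    ultimately show ?thesis by simp
  qed
  finally show ?thesis by (auto simp: rad_def)
qed

section \<open>The bicomplex of the two maps\<close>

lemma on_sum: "(\<And>i. i \<in> A \<Longrightarrow> on S (f i)) \<Longrightarrow> on S (\<lambda>x. \<Sum>i\<in>A. f i x :: 'a::comm_ring_1)"
  by (auto simp: on_def intro!: sum.neutral)

lemma on_bcol: "on (Xs l m n t p q) f \<Longrightarrow> on (Xs l m n t p (Suc q)) (ap (bcol m n \<psi>) f)"
proof -
  have "on (Bt l m n a (b + 1) (c - 1)) (ap (bcol m n \<psi>) f)" if "on (Bt l m n a b c) f" for a b c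
    unfolding bcol_def ap_sum_op ap_op using that by (intro on_sum on_uC on_gIv) auto
  from this[of "int t - int p" "int q" "int p - int q"]
    this[of "int p - int t - 1" "int q" "int p + int l - 1 - int q"]
  show "on (Xs l m n t p q) f \<Longrightarrow> on (Xs l m n t p (Suc q)) (ap (bcol m n \<psi>) f)"
    by (auto simp: Xs_def algebra_simps split: if_splits)
qed

lemma bcol_bcol: "bcol m n \<psi> * bcol m n \<psi> = 0"
proof -
  interpret graded_koszul_ops m "\<lambda>k. gIv n (\<psi> k)" uC dC "\<lambda>a c. Bt 0 m n 0 a (int n - c)"
    by (rule column_ops) simp
  show ?thesis using dS_dS by (simp add: bcol_def dS_def)
qed

lemma mult_commute_mult: "a * t = t * a \<Longrightarrow> b * t = t * b \<Longrightarrow> a * b * t = t * (a * b)"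
  for a b t :: "'r::semigroup_mult"
  by (metis mult.assoc)

lemma mult_anticommute_mult: "a * t = t * a \<Longrightarrow> a * s = - (s * a) \<Longrightarrow> a * (t * s) = - (t * s * a)"
  for a s t :: "'r::ring_1"
proof -
  assume "a * t = t * a" "a * s = - (s * a)"
  then have "a * (t * s) = t * (a * s)" by (metis mult.assoc)
  also have "\<dots> = - (t * s * a)" unfolding \<open>a * s = - (s * a)\<close> by (simp add: mult.assoc)
  finally show ?thesis .
qed

text \<open>Since \<open>\<psi>\<close> kills the columns of \<open>\<phi>\<close>, wedging with
  such a column anticommutes with contraction by a row of \<open>\<psi>\<close>. The splicing map
  consists of \<open>l\<close> wedges, whence the sign \<open>(-1)^l\<close> at
  \<open>p = t\<close>.\<close>

lemma bcol_drow:
  assumes "\<And>k j. k < m \<Longrightarrow> j < l \<Longrightarrow> (\<Sum>i<n. \<psi> k i * \<phi> i j) = 0"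
  shows "bcol m n \<psi> * drow l n \<phi> t p
    = scal (if p = t then (- 1) ^ l else - 1) * (drow l n \<phi> t p * bcol m n \<psi>)"
proof -
  let ?e = "\<lambda>j. gEv n (\<lambda>i. \<phi> i j)"
  have anti: "bcol m n \<psi> * ?e j = - (?e j * bcol m n \<psi>)" if j: "j < l" for j
  proof -
    have "uC k * gIv n (\<psi> k) * ?e j = - (?e j * (uC k * gIv n (\<psi> k)))" if k: "k < m" for k
    proof -
      have "?e j * gIv n (\<psi> k) + gIv n (\<psi> k) * ?e j = 0"
        using gEv_gIv[of n "\<lambda>i. \<phi> i j" "\<psi> k"] assms[OF k j] by (simp add: mult.commute scal_0)
      then have a: "gIv n (\<psi> k) * ?e j = - (?e j * gIv n (\<psi> k))"
        by (simp add: eq_neg_iff_add_eq_0 add.commute)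
      have "uC k * ?e j = ?e j * uC k" by (rule commute_vec) (simp add: shift_commute_exterior)
      then have "uC k * (?e j * gIv n (\<psi> k)) = ?e j * (uC k * gIv n (\<psi> k))" by (simp flip: mult.assoc)
      then show ?thesis by (simp add: a mult.assoc)
    qed
    then show ?thesis
      unfolding bcol_def sum_distrib_left sum_distrib_right sum_negf[symmetric] by (intro sum.cong refl) blast
  qed
  have com: "bcol m n \<psi> * uA j = uA j * bcol m n \<psi>" "bcol m n \<psi> * dA j = dA j * bcol m n \<psi>" for j
  proof -
    have "uC k * gIv n (\<psi> k) * uA j = uA j * (uC k * gIv n (\<psi> k))"
      "uC k * gIv n (\<psi> k) * dA j = dA j * (uC k * gIv n (\<psi> k))" for k
      by (rule mult_commute_mult; simp add: shift_relations commute_covec shift_commute_exterior)+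
    then show "bcol m n \<psi> * uA j = uA j * bcol m n \<psi>" "bcol m n \<psi> * dA j = dA j * bcol m n \<psi>"
      by (simp_all add: bcol_def sum_distrib_left sum_distrib_right)
  qed
  have scal_m1: "scal (- 1) * T = - T" for T :: "(idx, 'a) op"
    by (rule op_eqI) (simp add: ap_op ap_scal)
  have scal_m1p: "scal ((- 1) ^ k) = ((- 1) ^ k :: (idx, 'a) op)" for k
    using scal_m1[of 1] by (simp add: scal_power)
  have "bcol m n \<psi> * (dA j * ?e j) = - (dA j * ?e j * bcol m n \<psi>)"
    "bcol m n \<psi> * (uA j * ?e j) = - (uA j * ?e j * bcol m n \<psi>)" if "j < l" for j
    by (rule mult_anticommute_mult; simp add: com anti that)+
  then show ?thesis
    unfolding drow_def using anticommute_lprod[of l "bcol m n \<psi>" ?e] anti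
    by (simp add: scal_m1 scal_m1p sum_distrib_left sum_distrib_right sum_negf)
qed

lemma bicomplex_koszul:
  assumes "\<And>k j. k < m \<Longrightarrow> j < l \<Longrightarrow> (\<Sum>i<n. \<psi> k i * \<phi> i j) = 0"
  shows "bicomplex (Xs l m n t) (drow l n \<phi> t) (bcol m n \<psi>)
    (\<lambda>p. if p = t then (- 1) ^ l else - 1) t (grade (I_phi \<phi> l n))"
proof
  show "bcol m n \<psi> * drow l n \<phi> t p
    = scal (if p = t then (- 1) ^ l else - 1) * (drow l n \<phi> t p * bcol m n \<psi>)" for p
    by (rule bcol_drow[OF assms])
  show "(if p = t then (- 1) ^ l else - 1) * (if p = t then (- 1) ^ l else - 1) = (1::'a)" for p
    by (simp flip: power_add mult_2)
  show "Xs l m n t p q = {}" if "p \<le> t" "p < q" for p q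
    using that by (simp add: Xs_def Bt_empty)
  show "f = (\<lambda>_. 0)" if "0 < grade (I_phi \<phi> l n)" "on (Xs l m n t 0 q) f"
    "ap (drow l n \<phi> t 0) f = (\<lambda>_. 0)" for q and f :: "idx \<Rightarrow> 'a"
    using row_exactness[of 0 \<phi> l n m t q f] that by (simp add: zero_enat_def)
  show "\<exists>y. on (Xs l m n t p q) y \<and> ap (drow l n \<phi> t p) y = f" if "enat (Suc p) < grade (I_phi \<phi> l n)"
    "on (Xs l m n t (Suc p) q) f" "ap (drow l n \<phi> t (Suc p)) f = (\<lambda>_. 0)" for p q and f :: "idx \<Rightarrow> 'a"
    using row_exactness[of "Suc p" \<phi> l n m t q f] that by simp
qed (simp_all add: on_drow on_bcol drow_drow bcol_bcol)

section \<open>Comparison with the coordinate description\<close>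

text \<open>Places coordinate vectors of D_phi(t) in the bottom row of the bicomplex;
  \<open>embS\<close> places those of S_t(F) at position (t, t).\<close>

definition emb :: "((nat \<Rightarrow> nat) \<times> nat set \<Rightarrow> 'a::comm_ring_1) \<Rightarrow> idx \<Rightarrow> 'a" where
  "emb v = (\<lambda>(\<alpha>, \<gamma>, J). if \<gamma> = (\<lambda>_. 0) then v (\<alpha>, J) else 0)"

definition embS :: "((nat \<Rightarrow> nat) \<Rightarrow> 'a::comm_ring_1) \<Rightarrow> idx \<Rightarrow> 'a" where
  "embS u = (\<lambda>(\<alpha>, \<gamma>, J). if \<alpha> = (\<lambda>_. 0) \<and> J = {} then u \<gamma> else 0)"

lemma Mon_MonZ: "Mon k d = MonZ k (int d)"
  unfolding Mon_def MonZ_def of_nat_eq_iff by simp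

lemma MonZ_0: "MonZ k 0 = {\<lambda>_. 0}"
proof -
  have "\<alpha> = (\<lambda>_. 0)" if "\<forall>i\<ge>k. \<alpha> i = 0" "(\<Sum>i<k. \<alpha> i) = 0" for \<alpha> :: "nat \<Rightarrow> nat"
  proof
    fix i show "\<alpha> i = 0" using that by (cases "i < k") auto
  qed
  then show ?thesis by (auto simp: MonZ_def simp del: of_nat_sum sum_eq_0_iff)
qed

lemma finite_Mon: "finite (Mon k d)"
proof -
  have "Mon k d \<subseteq> {\<alpha>. \<forall>i. (i \<in> {..<k} \<longrightarrow> \<alpha> i \<in> {..d}) \<and> (i \<notin> {..<k} \<longrightarrow> \<alpha> i = 0)}"
    unfolding Mon_def by (auto intro: member_le_sum)
  moreover have "finite {\<alpha> :: nat \<Rightarrow> nat. \<forall>i. (i \<in> {..<k} \<longrightarrow> \<alpha> i \<in> {..d}) \<and> (i \<notin> {..<k} \<longrightarrow> \<alpha> i = 0)}"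
    by (rule finite_set_of_finite_funs) auto
  ultimately show ?thesis by (rule finite_subset)
qed

lemma finite_Bas: "finite (Bas l n t p)"
  by (rule finite_subset[of _ "Mon l (if p \<le> t then t - p else p - t - 1) \<times> Pow {..<n}"])
    (auto simp: Bas_def finite_Mon)

lemma Xs_0: "(\<alpha>, \<gamma>, J) \<in> Xs l m n t p 0 \<longleftrightarrow> \<gamma> = (\<lambda>_. 0) \<and> (\<alpha>, J) \<in> Bas l n t p"
proof (cases "p \<le> t")
  case True
  then show ?thesis by (auto simp: Xs_def Bt_def Bas_def Mon_MonZ MonZ_0 of_nat_diff)
next
  case False
  then have "int (p - t - 1) = int p - int t - 1" "int (card J) = int p + int l - 1 \<longleftrightarrow> card J = p + l - 1"
    by auto
  then show ?thesis using False by (auto simp: Xs_def Bt_def Bas_def Mon_MonZ MonZ_0 algebra_simps)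
qed

lemma on_emb: "on (Xs l m n t p 0) (emb v) \<longleftrightarrow> v \<in> Vec l n t p"
  by (auto simp: on_def Vec_def emb_def Xs_0 split: if_splits)

lemma emb_inject: "emb v = emb w \<longleftrightarrow> v = w"
proof
  assume e: "emb v = emb w"
  show "v = w"
  proof
    fix x show "v x = w x" using fun_cong[OF e, of "(fst x, \<lambda>_. 0, snd x)"] by (simp add: emb_def)
  qed
qed simp

lemma emb_zero: "emb (\<lambda>_. 0) = (\<lambda>_. 0)"
  by (auto simp: emb_def)

lemma on_imp_emb: "on (Xs l m n t p 0) f \<Longrightarrow> \<exists>v. f = emb v"
  by (rule exI[of _ "\<lambda>(\<alpha>, J). f (\<alpha>, \<lambda>_. 0, J)"]) (rule ext, auto simp: on_def emb_def Xs_0)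

lemma ap_bcol: "ap (bcol m n \<psi>) f (\<alpha>, \<gamma>, K)
    = (\<Sum>k<m. if 0 < \<gamma> k then ap (gIv n (\<psi> k)) f (\<alpha>, \<gamma>(k := \<gamma> k - 1), K) else 0)"
  by (simp add: bcol_def ap_sum_op ap_op ap_gens)

lemma gIv_emb: "ap (gIv n w) (emb v) (\<alpha>, \<gamma>, K) = (if \<gamma> = (\<lambda>_. 0)
    then \<Sum>i<n. if i \<notin> K then wsign i K * w i * v (\<alpha>, insert i K) else 0 else 0)"
  by (cases "\<gamma> = (\<lambda>_. 0)")
    (auto intro!: sum.cong sum.neutral simp: gIv_def ap_sum_op ap_op ap_scal ap_gens emb_def mult_ac)

lemma Nmod_iff: "v \<in> Nmod \<psi> l n m t p
    \<longleftrightarrow> on (Xs l m n t p 0) (emb v) \<and> ap (bcol m n \<psi>) (emb v) = (\<lambda>_. 0)"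
proof -
  have "ap (bcol m n \<psi>) (emb v) = (\<lambda>_. 0) \<longleftrightarrow> (\<forall>\<alpha> K. \<forall>k<m. ap (gIv n (\<psi> k)) (emb v) (\<alpha>, \<lambda>_. 0, K) = 0)"
  proof (intro iffI allI impI)
    fix \<alpha> K k assume z: "ap (bcol m n \<psi>) (emb v) = (\<lambda>_. 0)" and k: "k < m"
    \<comment> \<open>Evaluation at the degree 1 exponent of \<open>k\<close> isolates the
      contraction with the \<open>k\<close>-th row of \<open>\<psi>\<close>.\<close>
    let ?\<gamma> = "(\<lambda>_. 0)(k := 1) :: nat \<Rightarrow> nat"
    have "0 = ap (bcol m n \<psi>) (emb v) (\<alpha>, ?\<gamma>, K)" using z by simp
    also have "\<dots> = (\<Sum>k'<m. if k' = k then ap (gIv n (\<psi> k)) (emb v) (\<alpha>, \<lambda>_. 0, K) else 0)"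
      unfolding ap_bcol by (intro sum.cong refl) (auto simp: fun_upd_idem)
    also have "\<dots> = ap (gIv n (\<psi> k)) (emb v) (\<alpha>, \<lambda>_. 0, K)" using k by simp
    finally show "ap (gIv n (\<psi> k)) (emb v) (\<alpha>, \<lambda>_. 0, K) = 0" ..
  next
    assume z: "\<forall>\<alpha> K. \<forall>k<m. ap (gIv n (\<psi> k)) (emb v) (\<alpha>, \<lambda>_. 0, K) = 0"
    have "ap (bcol m n \<psi>) (emb v) (\<alpha>, \<gamma>, K) = 0" for \<alpha> \<gamma> K
      unfolding ap_bcol
    proof (intro sum.neutral ballI)
      fix k assume "k \<in> {..<m}"
      then show "(if 0 < \<gamma> k then ap (gIv n (\<psi> k)) (emb v) (\<alpha>, \<gamma>(k := \<gamma> k - 1), K) else 0) = 0"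
        using z by (cases "\<gamma>(k := \<gamma> k - 1) = (\<lambda>_. 0)") (simp_all add: gIv_emb)
    qed
    then show "ap (bcol m n \<psi>) (emb v) = (\<lambda>_. 0)" by auto
  qed
  then show ?thesis by (simp add: Nmod_def on_emb gIv_emb)
qed

lemma sum_single:
  assumes "finite S" "\<And>c. c \<notin> S \<Longrightarrow> v c = (0::'a::comm_ring_1)"
  shows "(\<Sum>c\<in>S. (if P \<and> c = c0 then x else 0) * v c) = (if P then x * v c0 else 0)"
proof -
  have "(\<Sum>c\<in>S. (if P \<and> c = c0 then x else 0) * v c) = (\<Sum>c\<in>S. if c = c0 then if P then x * v c else 0 else 0)"
    by (intro sum.cong) auto
  then show ?thesis using assms by auto
qed

lemma dmap_emb:
  assumes v: "v \<in> Vec l n t p"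
  shows "emb (dmap \<phi> l n t p v) = ap (drow l n \<phi> t p) (emb v)"
proof (rule ext, clarify)
  fix \<beta> \<gamma> K
  let ?B = "Bas l n t p"
  note single = sum_single[of ?B v, OF finite_Bas]
  have v0: "v c = 0" if "c \<notin> ?B" for c using v that unfolding Vec_def by blast
  have on: "on (Xs l m n t (Suc p) 0) (ap (drow l n \<phi> t p) (emb v))" for m
    using v by (intro on_drow) (simp add: on_emb)
  show "emb (dmap \<phi> l n t p v) (\<beta>, \<gamma>, K) = ap (drow l n \<phi> t p) (emb v) (\<beta>, \<gamma>, K)"
  proof (cases "\<gamma> = (\<lambda>_. 0) \<and> (\<beta>, K) \<in> Bas l n t (Suc p)")
    case False
    then show ?thesis using on by (auto simp: on_def Xs_0 emb_def dmap_def)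
  next
    case True
    then have \<gamma>: "\<gamma> = (\<lambda>_. 0)" and K: "K \<subseteq> {..<n}" and \<beta>: "(\<beta>, K) \<in> Bas l n t (Suc p)"
      by (auto simp: Bas_def)
    have wedge: "(\<Sum>i<n. if i \<in> K then wsign i (K - {i}) * w i * v (\<alpha>, K - {i}) else 0)
        = ap (gEv n w) (emb v) (\<alpha>, \<lambda>_. 0, K)" for w \<alpha>
    proof -
      have "{..<n} \<inter> K = K" using K by blast
      then show ?thesis
        unfolding ap_gEv[OF K] by (simp add: emb_def wsign_remove flip: sum.inter_restrict)
    qed
    have "(\<Sum>c\<in>?B. dcoef \<phi> l n t p (\<beta>, K) c * v c) = ap (drow l n \<phi> t p) (emb v) (\<beta>, \<lambda>_. 0, K)"
    proof -
      consider "p < t" | "p = t" | "t < p" by linarith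
      then show ?thesis
      proof cases
        case 1
        \<comment> \<open>For fixed \<open>i\<close>, \<open>j\<close> and target at most one source
          basis element contributes; solving for it collapses the matrix product to the pullback
          form of the operators.\<close>
        have cond: "(case c of (\<alpha>, J) \<Rightarrow> if 0 < \<alpha> j \<and> \<beta> = \<alpha>(j := \<alpha> j - 1) \<and> i \<notin> J \<and> K = insert i J
              then wsign i J * \<phi> i j else 0)
            = (if i \<in> K \<and> c = (\<beta>(j := Suc (\<beta> j)), K - {i}) then wsign i (K - {i}) * \<phi> i j else 0)" for c i j
          by (auto split: prod.splits)
        have "(\<Sum>c\<in>?B. dcoef \<phi> l n t p (\<beta>, K) c * v c)
            = (\<Sum>c\<in>?B. \<Sum>j<l. \<Sum>i<n. (if i \<in> K \<and> c = (\<beta>(j := Suc (\<beta> j)), K - {i})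
                then wsign i (K - {i}) * \<phi> i j else 0) * v c)"
          unfolding cond[symmetric] using 1
          by (intro sum.cong refl) (simp add: dcoef_def sum_distrib_right split: prod.splits)
        also have "\<dots> = (\<Sum>j<l. \<Sum>i<n. \<Sum>c\<in>?B. (if i \<in> K \<and> c = (\<beta>(j := Suc (\<beta> j)), K - {i})
                then wsign i (K - {i}) * \<phi> i j else 0) * v c)"
          by (subst sum.swap) (intro sum.cong refl sum.swap)
        also have "\<dots> = (\<Sum>j<l. \<Sum>i<n. if i \<in> K then wsign i (K - {i}) * \<phi> i j
            * v (\<beta>(j := Suc (\<beta> j)), K - {i}) else 0)"
          by (intro sum.cong refl single v0)
        finally show ?thesis
          unfolding wedge using 1 by (simp add: drow_def ap_sum_op ap_op ap_gens)
      next
        case 3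
        have cond: "(case c of (\<alpha>, J) \<Rightarrow> if \<beta> = \<alpha>(j := Suc (\<alpha> j)) \<and> i \<notin> J \<and> K = insert i J
              then wsign i J * \<phi> i j else 0)
            = (if (0 < \<beta> j \<and> i \<in> K) \<and> c = (\<beta>(j := \<beta> j - 1), K - {i}) then wsign i (K - {i}) * \<phi> i j else 0)" for c i j
          by (auto split: prod.splits)
        have "(\<Sum>c\<in>?B. dcoef \<phi> l n t p (\<beta>, K) c * v c)
            = (\<Sum>c\<in>?B. \<Sum>j<l. \<Sum>i<n. (if (0 < \<beta> j \<and> i \<in> K) \<and> c = (\<beta>(j := \<beta> j - 1), K - {i})
                then wsign i (K - {i}) * \<phi> i j else 0) * v c)"
          unfolding cond[symmetric] using 3
          by (intro sum.cong refl) (simp add: dcoef_def sum_distrib_right split: prod.splits)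
        also have "\<dots> = (\<Sum>j<l. \<Sum>i<n. \<Sum>c\<in>?B. (if (0 < \<beta> j \<and> i \<in> K) \<and> c = (\<beta>(j := \<beta> j - 1), K - {i})
                then wsign i (K - {i}) * \<phi> i j else 0) * v c)"
          by (subst sum.swap) (intro sum.cong refl sum.swap)
        also have "\<dots> = (\<Sum>j<l. \<Sum>i<n. if 0 < \<beta> j \<and> i \<in> K then wsign i (K - {i}) * \<phi> i j
            * v (\<beta>(j := \<beta> j - 1), K - {i}) else 0)"
          by (intro sum.cong refl single v0)
        also have "\<dots> = (\<Sum>j<l. if 0 < \<beta> j then \<Sum>i<n. if i \<in> K then wsign i (K - {i}) * \<phi> i j
            * v (\<beta>(j := \<beta> j - 1), K - {i}) else 0 else 0)"
          by (intro sum.cong refl) auto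
        finally show ?thesis
          unfolding wedge using 3 by (simp add: drow_def ap_sum_op ap_op ap_gens)
      next
        case 2
        have \<beta>0: "\<beta> = (\<lambda>_. 0)" using \<beta> 2 by (simp add: Bas_def Mon_MonZ MonZ_0)
        have fin: "finite {L. L \<subseteq> {..<n} \<and> card L = l}"
          by (rule finite_subset[of _ "Pow {..<n}"]) auto
        have cond: "(case c of (\<alpha>, J) \<Rightarrow> if L \<inter> J = {} \<and> K = L \<union> J then wsign2 L J * D else 0)
            = (if L \<subseteq> K \<and> c = (\<beta>, K - L) then wsign2 L (K - L) * D else 0)" if "c \<in> ?B" for c L D
          using that 2 by (auto simp: Bas_def Mon_MonZ MonZ_0 \<beta>0 split: prod.splits)
        let ?D = "\<lambda>L. det_sub \<phi> (sorted_list_of_set L) [0..<l]"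
        have "(\<Sum>c\<in>?B. dcoef \<phi> l n t p (\<beta>, K) c * v c)
            = (\<Sum>c\<in>?B. \<Sum>L\<in>{L. L \<subseteq> {..<n} \<and> card L = l}. (if L \<subseteq> K \<and> c = (\<beta>, K - L)
                then wsign2 L (K - L) * ?D L else 0) * v c)"
          using 2 by (intro sum.cong refl, subst cond[symmetric])
            (simp_all add: dcoef_def sum_distrib_right split: prod.splits)
        also have "\<dots> = (\<Sum>L\<in>{L. L \<subseteq> {..<n} \<and> card L = l}. \<Sum>c\<in>?B. (if L \<subseteq> K \<and> c = (\<beta>, K - L)
                then wsign2 L (K - L) * ?D L else 0) * v c)"
          by (rule sum.swap)
        also have "\<dots> = (\<Sum>L\<in>{L. L \<subseteq> {..<n} \<and> card L = l}. if L \<subseteq> K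
            then wsign2 L (K - L) * ?D L * v (\<beta>, K - L) else 0)"
          by (intro sum.cong refl single v0)
        also have "\<dots> = (\<Sum>L\<in>{L. L \<subseteq> K \<and> card L = l}. wsign2 L (K - L) * ?D L * v (\<beta>, K - L))"
          using K fin by (intro sum.mono_neutral_cong_right) auto
        also have "\<dots> = (\<Sum>L\<in>{L. L \<subseteq> K \<and> card L = l}.
            wsign2 L (K - L) * DL (\<lambda>j i. \<phi> i j) l L * emb v (\<beta>, \<lambda>_. 0, K - L))"
        proof (intro sum.cong refl)
          fix L assume "L \<in> {L. L \<subseteq> K \<and> card L = l}"
          moreover from this have "finite L" using K by (intro finite_subset[of L "{..<n}"]) auto
          ultimately show "wsign2 L (K - L) * ?D L * v (\<beta>, K - L)
              = wsign2 L (K - L) * DL (\<lambda>j i. \<phi> i j) l L * emb v (\<beta>, \<lambda>_. 0, K - L)"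
            by (simp add: det_sub_rows emb_def)
        qed
        finally show ?thesis using 2 by (simp add: drow_def wedge_expansion[OF K])
      qed
    qed
    then show ?thesis using \<beta> by (simp add: emb_def \<gamma> dmap_def)
  qed
qed

section \<open>S_t(C) as the cokernel of the column map into position (t, t)\<close>

lemma on_embS: "on (Xs l m n t t t) (embS u) \<longleftrightarrow> u \<in> SVec m t"
proof -
  have "(\<alpha>, \<gamma>, J) \<in> Xs l m n t t t \<longleftrightarrow> \<alpha> = (\<lambda>_. 0) \<and> \<gamma> \<in> Mon m t \<and> J = {}" for \<alpha> \<gamma> J
    by (auto simp: Xs_def Bt_def Mon_MonZ MonZ_0 dest: finite_subset)
  then show ?thesis by (auto simp: on_def SVec_def embS_def split: if_splits)
qed

lemma embS_eqI:
  assumes "on (Xs l m n t t t) f" "on (Xs l m n t t t) g"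
    and "\<And>\<gamma>. \<gamma> \<in> Mon m t \<Longrightarrow> f (\<lambda>_. 0, \<gamma>, {}) = g (\<lambda>_. 0, \<gamma>, {})"
  shows "f = g"
proof (rule ext, clarify)
  fix \<alpha> \<gamma> J
  show "f (\<alpha>, \<gamma>, J) = g (\<alpha>, \<gamma>, J)"
  proof (cases "(\<alpha>, \<gamma>, J) \<in> Xs l m n t t t")
    case True
    then have "\<alpha> = (\<lambda>_. 0)" "\<gamma> \<in> Mon m t" "J = {}"
      by (auto simp: Xs_def Bt_def Mon_MonZ MonZ_0 dest: finite_subset)
    then show ?thesis using assms(3) by simp
  next
    case False
    then show ?thesis using assms(1,2) by (simp add: on_def)
  qed
qed

lemma on_imp_embS: "on (Xs l m n t t t) f \<Longrightarrow> \<exists>u. f = embS u"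
proof (rule exI[of _ "\<lambda>\<gamma>. f (\<lambda>_. 0, \<gamma>, {})"], rule ext, clarify)
  fix \<alpha> \<gamma> J
  assume f: "on (Xs l m n t t t) f"
  show "f (\<alpha>, \<gamma>, J) = embS (\<lambda>\<gamma>. f (\<lambda>_. 0, \<gamma>, {})) (\<alpha>, \<gamma>, J)"
  proof (cases "\<alpha> = (\<lambda>_. 0) \<and> J = {}")
    case False
    then have "(\<alpha>, \<gamma>, J) \<notin> Xs l m n t t t"
      by (auto simp: Xs_def Bt_def MonZ_0 dest: finite_subset)
    then show ?thesis using f False by (auto simp: on_def embS_def)
  qed (simp add: embS_def)
qed

lemma bcol_at_singletons: "ap (bcol m n \<psi>) w (\<alpha>, \<gamma>, {})
    = (\<Sum>k<m. \<Sum>i<n. if 0 < \<gamma> k then \<psi> k i * w (\<alpha>, \<gamma>(k := \<gamma> k - 1), {i}) else 0)"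
  unfolding ap_bcol by (intro sum.cong refl) (simp add: ap_gIv wsign_def)

lemma Mon_downI: "\<gamma> \<in> Mon m t \<Longrightarrow> 0 < \<gamma> k \<Longrightarrow> k < m \<Longrightarrow> \<gamma>(k := \<gamma> k - 1) \<in> Mon m (t - 1)"
proof -
  assume *: "\<gamma> \<in> Mon m t" "0 < \<gamma> k" "k < m"
  have "\<gamma> k \<le> (\<Sum>i<m. \<gamma> i)" by (rule member_le_sum) (use * in auto)
  then have "int (t - 1) + int (\<gamma> k) - int (\<gamma> k - 1) = int t" using * by (simp add: Mon_def)
  then show ?thesis using * by (simp add: Mon_MonZ MonZ_upd)
qed

lemma SRel_sum:
  assumes "\<gamma> \<in> Mon m t"
  shows "(\<Sum>i<n. \<Sum>\<delta>\<in>Mon m (t - 1). c i \<delta> * (\<Sum>k<m. if \<gamma> = \<delta>(k := Suc (\<delta> k)) then \<psi> k i else 0))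
    = (\<Sum>k<m. \<Sum>i<n. if 0 < \<gamma> k then \<psi> k i * c i (\<gamma>(k := \<gamma> k - 1)) else (0::'a::comm_ring_1))"
proof -
  have cond: "\<gamma> = \<delta>(k := Suc (\<delta> k)) \<longleftrightarrow> 0 < \<gamma> k \<and> \<delta> = \<gamma>(k := \<gamma> k - 1)" for k \<delta>
    by (auto simp: fun_eq_iff)
  have "(\<Sum>i<n. \<Sum>\<delta>\<in>Mon m (t - 1). c i \<delta> * (\<Sum>k<m. if \<gamma> = \<delta>(k := Suc (\<delta> k)) then \<psi> k i else 0))
      = (\<Sum>i<n. \<Sum>\<delta>\<in>Mon m (t - 1). \<Sum>k<m. if \<delta> = \<gamma>(k := \<gamma> k - 1) then
          if 0 < \<gamma> k then \<psi> k i * c i \<delta> else 0 else 0)"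
    unfolding cond sum_distrib_left by (intro sum.cong refl) (simp add: mult.commute)
  also have "\<dots> = (\<Sum>i<n. \<Sum>k<m. \<Sum>\<delta>\<in>Mon m (t - 1). if \<delta> = \<gamma>(k := \<gamma> k - 1) then
          if 0 < \<gamma> k then \<psi> k i * c i \<delta> else 0 else 0)"
    by (intro sum.cong refl sum.swap)
  also have "\<dots> = (\<Sum>i<n. \<Sum>k<m. if 0 < \<gamma> k then \<psi> k i * c i (\<gamma>(k := \<gamma> k - 1)) else 0)"
    using Mon_downI[OF assms] by (intro sum.cong refl) (auto simp: sum.delta[OF finite_Mon])
  also have "\<dots> = (\<Sum>k<m. \<Sum>i<n. if 0 < \<gamma> k then \<psi> k i * c i (\<gamma>(k := \<gamma> k - 1)) else 0)"
    by (rule sum.swap)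
  finally show ?thesis .
qed

text \<open>Position (t, t - 1) carries G (x) S_{t-1}(F), and the column map from there is
  multiplication of linear forms psi(g) with S_{t-1}(F).\<close>

lemma SRel_iff:
  assumes "1 \<le> t"
  shows "u \<in> SRel \<psi> n m t \<longleftrightarrow> (\<exists>w. on (Xs l m n t t (t - 1)) w \<and> embS u = ap (bcol m n \<psi>) w)"
proof
  assume "u \<in> SRel \<psi> n m t"
  then obtain c where u: "u = (\<lambda>\<gamma>. if \<gamma> \<in> Mon m t then \<Sum>i<n. \<Sum>\<delta>\<in>Mon m (t - 1). c i \<delta> *
      (\<Sum>k<m. if \<gamma> = \<delta>(k := Suc (\<delta> k)) then \<psi> k i else 0) else 0)"
    using assms by (auto simp: SRel_def)
  define w where "w = (\<lambda>(\<alpha> :: nat \<Rightarrow> nat, \<gamma>, J).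
    if \<alpha> = (\<lambda>_. 0) \<and> \<gamma> \<in> Mon m (t - 1) \<and> (\<exists>i<n. J = {i}) then c (the_elem J) \<gamma> else 0)"
  have w: "on (Xs l m n t t (t - 1)) w"
    using assms by (auto simp: on_def w_def Xs_def Bt_def MonZ_0 Mon_MonZ of_nat_diff)
  have "embS u = ap (bcol m n \<psi>) w"
  proof (rule embS_eqI)
    show "on (Xs l m n t t t) (embS u)" by (simp add: on_embS SVec_def u)
    show "on (Xs l m n t t t) (ap (bcol m n \<psi>) w)" using on_bcol[OF w] assms by simp
    fix \<gamma> assume \<gamma>: "\<gamma> \<in> Mon m t"
    have "embS u (\<lambda>_. 0, \<gamma>, {})
        = (\<Sum>k<m. \<Sum>i<n. if 0 < \<gamma> k then \<psi> k i * c i (\<gamma>(k := \<gamma> k - 1)) else 0)"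
      using \<gamma> SRel_sum[OF \<gamma>] by (simp add: embS_def u)
    also have "\<dots> = ap (bcol m n \<psi>) w (\<lambda>_. 0, \<gamma>, {})"
      unfolding bcol_at_singletons using Mon_downI[OF \<gamma>] by (intro sum.cong refl) (simp add: w_def)
    finally show "embS u (\<lambda>_. 0, \<gamma>, {}) = ap (bcol m n \<psi>) w (\<lambda>_. 0, \<gamma>, {})" .
  qed
  then show "\<exists>w. on (Xs l m n t t (t - 1)) w \<and> embS u = ap (bcol m n \<psi>) w" using w by blast
next
  assume "\<exists>w. on (Xs l m n t t (t - 1)) w \<and> embS u = ap (bcol m n \<psi>) w"
  then obtain w where w: "on (Xs l m n t t (t - 1)) w" "embS u = ap (bcol m n \<psi>) w" by blast
  have "on (Xs l m n t t t) (embS u)" using on_bcol[OF w(1)] assms by (simp add: w(2))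
  then have u: "u \<in> SVec m t" by (simp add: on_embS)
  have "u = (\<lambda>\<gamma>. if \<gamma> \<in> Mon m t then \<Sum>i<n. \<Sum>\<delta>\<in>Mon m (t - 1). w (\<lambda>_. 0, \<delta>, {i}) *
      (\<Sum>k<m. if \<gamma> = \<delta>(k := Suc (\<delta> k)) then \<psi> k i else 0) else 0)"
  proof
    fix \<gamma>
    show "u \<gamma> = (if \<gamma> \<in> Mon m t then \<Sum>i<n. \<Sum>\<delta>\<in>Mon m (t - 1). w (\<lambda>_. 0, \<delta>, {i}) *
      (\<Sum>k<m. if \<gamma> = \<delta>(k := Suc (\<delta> k)) then \<psi> k i else 0) else 0)"
    proof (cases "\<gamma> \<in> Mon m t")
      case True
      have "u \<gamma> = ap (bcol m n \<psi>) w (\<lambda>_. 0, \<gamma>, {})" unfolding w(2)[symmetric] by (simp add: embS_def)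
      then show ?thesis using True
        by (simp only: if_True bcol_at_singletons SRel_sum[OF True, where c = "\<lambda>i \<delta>. w (\<lambda>_. 0, \<delta>, {i})"])
    next
      case False
      then show ?thesis using u by (simp add: SVec_def)
    qed
  qed
  then show "u \<in> SRel \<psi> n m t"
    unfolding SRel_def using assms by (auto intro: exI[of _ "\<lambda>i \<delta>. w (\<lambda>_. 0, \<delta>, {i})"])
qed

section \<open>The cohomology of N(t)\<close>

theorem mainTheorem7:
  fixes phi :: "nat \<Rightarrow> nat \<Rightarrow> 'a::comm_ring_1" and psi :: "nat \<Rightarrow> nat \<Rightarrow> 'a"
    and l n m t :: nat
  assumes noeth: "noetherian TYPE('a)"
    and complex: "\<And>k j. k < m \<Longrightarrow> j < l \<Longrightarrow> (\<Sum>i<n. psi k i * phi i j) = 0"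
    and mn: "m \<le> n" and ln: "l \<le> n"
  defines "g \<equiv> grade (I_psi psi m n)"
    and "h \<equiv> grade (I_phi phi l n)"
    and "\<rho> \<equiv> int n - int m - int l"
  shows "(\<forall>i. i \<le> 2 \<and> enat i < h \<longrightarrow> cohom_vanishes phi psi l n m t i)
     \<and> (enat (nat \<bar>\<rho>\<bar> + 1) < g \<longrightarrow>
          ((1 \<le> t \<and> enat (2 * t + 1) \<le> h \<longrightarrow>
              (\<exists>M. induces_injection phi psi l n m t (2 * t + 1) M
                 \<and> (enat (2 * t + 1) < h \<longrightarrow> induces_surjection phi psi l n m t (2 * t + 1) M)))
           \<and> (\<forall>i. 2 * t + 2 \<le> i \<and> enat i < h \<and> enat (i + nat \<bar>\<rho>\<bar>) < enat (2 * t + 1) + g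
                 \<longrightarrow> cohom_vanishes phi psi l n m t i)))"
proof -
  interpret bicomplex "Xs l m n t" "drow l n phi t" "bcol m n psi" "\<lambda>p. if p = t then (- 1) ^ l else - 1" t h
    unfolding h_def by (rule bicomplex_koszul[OF complex])
  have Zyc: "v \<in> Zyc phi psi l n m t p \<longleftrightarrow> cocyc p (emb v)" for v p
  proof -
    have "dmap phi l n t p v = (\<lambda>_. 0) \<longleftrightarrow> ap (drow l n phi t p) (emb v) = (\<lambda>_. 0)" if "v \<in> Vec l n t p"
      using dmap_emb[OF that, of phi] emb_inject[of "dmap phi l n t p v" "\<lambda>_. 0"] by (simp add: emb_zero)
    then show ?thesis by (auto simp: Zyc_def Nmod_iff cocyc_def on_emb)
  qed
  have Bdy: "v \<in> Bdy phi psi l n m t p \<longleftrightarrow> cobdy p (emb v)" for v p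
  proof (cases p)
    case 0
    then show ?thesis using emb_inject[of v "\<lambda>_. 0"] by (simp add: Bdy_def cobdy_def emb_zero)
  next
    case (Suc c)
    have "v \<in> dmap phi l n t c ` Nmod psi l n m t c \<longleftrightarrow> (\<exists>y. on (Xs l m n t c 0) y
        \<and> ap (bcol m n psi) y = (\<lambda>_. 0) \<and> ap (drow l n phi t c) y = emb v)"
    proof
      assume "v \<in> dmap phi l n t c ` Nmod psi l n m t c"
      then obtain y where y: "v = dmap phi l n t c y" "y \<in> Nmod psi l n m t c" by blast
      then have "y \<in> Vec l n t c" by (simp add: Nmod_def)
      with y show "\<exists>y. on (Xs l m n t c 0) y \<and> ap (bcol m n psi) y = (\<lambda>_. 0) \<and> ap (drow l n phi t c) y = emb v"
        by (intro exI[of _ "emb y"]) (simp add: Nmod_iff dmap_emb)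
    next
      assume "\<exists>y. on (Xs l m n t c 0) y \<and> ap (bcol m n psi) y = (\<lambda>_. 0) \<and> ap (drow l n phi t c) y = emb v"
      then obtain y where y: "on (Xs l m n t c 0) (emb y)" "ap (bcol m n psi) (emb y) = (\<lambda>_. 0)"
        "ap (drow l n phi t c) (emb y) = emb v" using on_imp_emb by metis
      then have "emb v = emb (dmap phi l n t c y)" by (simp add: dmap_emb on_emb)
      then have "v = dmap phi l n t c y" by (simp add: emb_inject)
      then show "v \<in> dmap phi l n t c ` Nmod psi l n m t c" using y by (auto simp: Nmod_iff)
    qed
    then show ?thesis by (simp add: Suc Bdy_def cobdy_def)
  qed
  have vanishes: "cohom_vanishes phi psi l n m t i" if "\<And>z. cocyc i z \<Longrightarrow> cobdy i z" for i
    using that by (auto simp: cohom_vanishes_def Zyc Bdy)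
  have low: "\<forall>i. i \<le> 2 \<and> enat i < h \<longrightarrow> cohom_vanishes phi psi l n m t i"
    using cocyc_cobdy_low vanishes by blast
  have "(1 \<le> t \<and> enat (2 * t + 1) \<le> h \<longrightarrow>
              (\<exists>M. induces_injection phi psi l n m t (2 * t + 1) M
                 \<and> (enat (2 * t + 1) < h \<longrightarrow> induces_surjection phi psi l n m t (2 * t + 1) M)))
           \<and> (\<forall>i. 2 * t + 2 \<le> i \<and> enat i < h \<and> enat (i + nat \<bar>\<rho>\<bar>) < enat (2 * t + 1) + g
                 \<longrightarrow> cohom_vanishes phi psi l n m t i)"
    if g: "enat (nat \<bar>\<rho>\<bar> + 1) < g"
  proof -
    \<comment> \<open>The radical containment asks for more than \<open>max 0 \<rho> + 1\<close>
      entries, and \<open>\<bar>\<rho>\<bar> + 2\<close> are available.\<close>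
    have "enat (nat \<bar>\<rho>\<bar> + 2) \<le> g" using g by (metis Suc_ile_eq add_2_eq_Suc' Suc_eq_plus1)
    then obtain xs where xs: "length xs = nat \<bar>\<rho>\<bar> + 2" "set xs \<subseteq> I_psi psi m n" "wreg {0} xs"
      using grade_wreg unfolding g_def by blast
    have "nat (int n - int m - int l) + 1 < length xs" unfolding xs(1) \<rho>_def by linarith
    then have minors: "I_phi phi l n \<subseteq> rad (I_psi psi m n)"
      unfolding I_phi_eq
      using phi_minor_in_radical[where \<phi> = phi and \<psi> = psi, OF complex xs(3,2)] is_ideal_gen
      by (intro gen_least is_ideal_rad) (auto simp: I_psi_def)
    have I_psi_rad: "I_psi psi m n \<subseteq> rad (I_psi psi m n)"
      unfolding rad_def by clarsimp (metis power_one_right)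
    \<comment> \<open>The associated parameter is \<open>u = max 0 (\<rho> - p + 1)\<close>. If it
      is 0, the sequence is taken in \<open>I_phi\<close>, which \<open>minors\<close> allows, and
      \<open>h\<close> bounds its length; otherwise it is taken in \<open>I_psi\<close> and
      \<open>g\<close> bounds it.\<close>
    have column: "column_exact p q"
      if tp: "t < p" and h_bound: "\<rho> < int p \<Longrightarrow> enat (q + 2) < h"
        and g_bound: "int p \<le> \<rho> \<Longrightarrow> enat (q + 3 + nat (\<rho> - int p)) < g" for p q
    proof -
      define u where "u = nat (int n - int m - (int p + int l - 1))"
      obtain ys where ys: "q + 2 + u < length ys" "set ys \<subseteq> rad (I_psi psi m n)" "wreg {0} ys"
      proof (cases "\<rho> < int p")
        case True
        then have u: "u = 0" by (simp add: u_def \<rho>_def)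
        have "enat (Suc (q + 2)) \<le> h" using h_bound[OF True] by (simp add: Suc_ile_eq)
        then obtain ys where "length ys = Suc (q + 2)" "set ys \<subseteq> I_phi phi l n" "wreg {0} ys"
          using grade_wreg unfolding h_def by blast
        then show ?thesis using minors u by (intro that[of ys]) auto
      next
        case False
        then have u: "q + 2 + u = q + 3 + nat (\<rho> - int p)" by (simp add: u_def \<rho>_def)
        have "enat (Suc (q + 2 + u)) \<le> g" unfolding u Suc_ile_eq using g_bound False by simp
        then obtain ys where "length ys = Suc (q + 2 + u)" "set ys \<subseteq> I_psi psi m n" "wreg {0} ys"
          using grade_wreg unfolding g_def by blast
        then show ?thesis using I_psi_rad by (intro that[of ys]) auto
      qed
      show ?thesis
        unfolding column_exact_def
        using column_exactness[OF ys(3,2) tp, of q] ys(1) by (simp add: u_def)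
    qed
    show ?thesis
    proof (intro conjI impI allI)
      fix i assume i: "2 * t + 2 \<le> i \<and> enat i < h \<and> enat (i + nat \<bar>\<rho>\<bar>) < enat (2 * t + 1) + g"
      then obtain c where c: "i = Suc c" by (cases i) auto
      show "cohom_vanishes phi psi l n m t i"
        unfolding c
      proof (rule vanishes, rule cocyc_cobdy_high)
        show "2 * t + 1 \<le> c" "enat (Suc c) < h" using i c by auto
        fix r assume r: "r < c - t - 1"
        show "column_exact (c - Suc r) r"
        proof (rule column)
          show "t < c - Suc r" using r by linarith
          show "enat (r + 2) < h"
            by (rule le_less_trans[of _ "enat i"]) (use i c r in auto)
          assume le: "int (c - Suc r) \<le> \<rho>"
          \<comment> \<open>The left side is \<open>2 * r + 4 + \<rho> - c\<close>. As
            \<open>r \<le> c - t - 2\<close>, it is at most \<open>\<rho> + i - 1 - 2 * t\<close>;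
            this extreme case is the origin of the upper bound on \<open>i\<close>.\<close>
          show "enat (r + 3 + nat (\<rho> - int (c - Suc r))) < g"
          proof (cases g)
            case (enat g')
            then have "i + nat \<bar>\<rho>\<bar> < 2 * t + 1 + g'" using i by simp
            moreover have "nat (\<rho> - int (c - Suc r)) + c = nat \<bar>\<rho>\<bar> + Suc r" using le r by linarith
            ultimately show ?thesis using r c enat by simp
          qed simp
        qed
      qed
    next
      assume th: "1 \<le> t \<and> enat (2 * t + 1) \<le> h"
      \<comment> \<open>The columns met when the diagonal zigzag is built. The strongest demand on
        \<open>g\<close> occurs at \<open>r = t - 1\<close> and is
        \<open>\<rho> + 1 < g\<close>.\<close>
      have col1: "column_exact (2 * t - r) r" if "r < t" for r
      proof (rule column)
        show "t < 2 * t - r" using that by linarith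
        show "enat (r + 2) < h"
          by (rule less_le_trans[of _ "enat (2 * t + 1)"]) (use th that in auto)
        assume "int (2 * t - r) \<le> \<rho>"
        then show "enat (r + 3 + nat (\<rho> - int (2 * t - r))) < g"
          using that by (intro le_less_trans[OF _ g]) simp
      qed
      \<comment> \<open>The columns one position further left, which show that zigzags starting in a
        \<open>b\<close>-image end in coboundaries.\<close>
      have col2: "column_exact (2 * t - Suc r) r" if "r < t - 1" for r
      proof (rule column)
        show "t < 2 * t - Suc r" using that by linarith
        show "enat (r + 2) < h"
          by (rule less_le_trans[of _ "enat (2 * t + 1)"]) (use th that in auto)
        assume "int (2 * t - Suc r) \<le> \<rho>"
        then show "enat (r + 3 + nat (\<rho> - int (2 * t - Suc r))) < g"
          using that by (intro le_less_trans[OF _ g]) simp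
      qed
      \<comment> \<open>The zigzag is only a relation, so one endpoint is chosen for each monomial
        and the choice is extended linearly; zigzags are closed under linear combinations.\<close>
      define e where "e \<gamma> = embS (\<lambda>\<gamma>'. if \<gamma>' = \<gamma> then 1 else 0 :: 'a)" for \<gamma>
      have "\<exists>z. zigzag (2 * t) t (e \<gamma>) (emb z)" if \<gamma>: "\<gamma> \<in> Mon m t" for \<gamma>
      proof -
        have "on (Xs l m n t t t) (e \<gamma>)" using \<gamma> by (auto simp: e_def on_embS SVec_def)
        then obtain z where z: "zigzag (2 * t) t (e \<gamma>) z" using diagonal_zigzag col1 by blast
        then have "on (Xs l m n t (Suc (2 * t)) 0) z" using diagonal_cocyc by (auto simp: cocyc_def)
        then show ?thesis using z on_imp_emb by blast
      qed
      then obtain z where z: "\<And>\<gamma>. \<gamma> \<in> Mon m t \<Longrightarrow> zigzag (2 * t) t (e \<gamma>) (emb (z \<gamma>))" by metis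
      define M where "M b \<gamma> = z \<gamma> b" for b \<gamma>
      have M: "zigzag (2 * t) t (embS u) (emb (lin_apply m t M u))" if u: "u \<in> SVec m t" for u
      proof -
        have "(\<lambda>x. \<Sum>\<gamma>\<in>Mon m t. u \<gamma> * e \<gamma> x) = embS u"
        proof (rule ext, clarify)
          fix \<alpha> \<gamma> J
          have "(\<Sum>\<gamma>'\<in>Mon m t. u \<gamma>' * e \<gamma>' (\<alpha>, \<gamma>, J))
              = (\<Sum>\<gamma>'\<in>Mon m t. if \<gamma>' = \<gamma> then if \<alpha> = (\<lambda>_. 0) \<and> J = {} then u \<gamma>' else 0 else 0)"
            by (intro sum.cong) (auto simp: e_def embS_def)
          also have "\<dots> = embS u (\<alpha>, \<gamma>, J)" using u by (auto simp: embS_def SVec_def finite_Mon)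
          finally show "(\<Sum>\<gamma>'\<in>Mon m t. u \<gamma>' * e \<gamma>' (\<alpha>, \<gamma>, J)) = embS u (\<alpha>, \<gamma>, J)" .
        qed
        moreover have "(\<lambda>x. \<Sum>\<gamma>\<in>Mon m t. u \<gamma> * emb (z \<gamma>) x) = emb (lin_apply m t M u)"
          by (auto simp: emb_def lin_apply_def M_def mult.commute)
        ultimately show ?thesis using zigzag_sum[of t "2 * t" "Mon m t" e "\<lambda>\<gamma>. emb (z \<gamma>)" u] z by simp
      qed
      have "induces_injection phi psi l n m t (2 * t + 1) M"
        unfolding induces_injection_def
      proof (intro conjI ballI impI)
        fix u :: "(nat \<Rightarrow> nat) \<Rightarrow> 'a" assume "u \<in> SVec m t"
        then show "lin_apply m t M u \<in> Zyc phi psi l n m t (2 * t + 1)"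
          using diagonal_cocyc[OF M] by (simp add: Zyc)
      next
        fix u assume "u \<in> SRel psi n m t"
        then obtain w where w: "on (Xs l m n t t (t - 1)) w" "embS u = ap (bcol m n psi) w"
          using SRel_iff th by blast
        have t: "Suc (t - 1) = t" "2 * t - Suc (t - 1) = t" using th by auto
        have "on (Xs l m n t t t) (embS u)" using on_b[OF w(1)] t(1) by (simp add: w(2))
        then have uS: "u \<in> SVec m t" by (simp add: on_embS)
        have "zigzag (2 * t) (Suc (t - 1)) (ap (bcol m n psi) w) (emb (lin_apply m t M u))"
          using M[OF uS] unfolding t(1) w(2) .
        then have "cobdy (Suc (2 * t)) (emb (lin_apply m t M u))"
          by (rule zigzag_image_cobdy) (use w(1) t(2) col2 in auto)
        then show "lin_apply m t M u \<in> Bdy phi psi l n m t (2 * t + 1)" by (simp add: Bdy)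
      next
        fix u :: "(nat \<Rightarrow> nat) \<Rightarrow> 'a" assume u: "u \<in> SVec m t" "lin_apply m t M u \<in> Bdy phi psi l n m t (2 * t + 1)"
        \<comment> \<open>Injectivity uses row exactness only in positions up to
          \<open>2 * t\<close>, so \<open>h = 2 * t + 1\<close> is allowed. Surjectivity has to lift
          the cocycle itself, in position \<open>2 * t + 1\<close>.\<close>
        have "enat (2 * t) < enat (2 * t + 1)" by simp
        then have "enat (2 * t) < h" using th by (meson less_le_trans)
        then have "\<exists>w. on (Xs l m n t t (t - 1)) w \<and> embS u = ap (bcol m n psi) w"
          using diagonal_cobdyD[OF M[OF u(1)]] u(2) th by (simp add: Bdy)
        then show "u \<in> SRel psi n m t" using SRel_iff th by blast
      qed
      moreover have "induces_surjection phi psi l n m t (2 * t + 1) M" if h: "enat (2 * t + 1) < h"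
        unfolding induces_surjection_def
      proof
        fix v assume "v \<in> Zyc phi psi l n m t (2 * t + 1)"
        then obtain y where y: "zigzag (2 * t) t y (emb v)"
          using zigzag_exists_down[of "2 * t" "emb v" t] h by (auto simp: Zyc)
        then have on: "on (Xs l m n t t t) y" using zigzag_on[OF y] by simp
        then obtain u where u: "y = embS u" using on_imp_embS by blast
        then have uS: "u \<in> SVec m t" using on by (simp add: on_embS)
        \<comment> \<open>Both zigzags start at \<open>embS u\<close>, so the difference of their
          ends is reached from 0. Reading 0 as the \<open>b\<close>-image of 0 makes that difference
          a coboundary.\<close>
        have "zigzag (2 * t) t (\<lambda>x. (- 1) * embS u x + embS u x)
            (\<lambda>x. (- 1) * emb (lin_apply m t M u) x + emb v x)"
          by (rule zigzag_combination[OF M[OF uS]]) (use y u in simp)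
        moreover have "(\<lambda>x. (- 1) * emb (lin_apply m t M u) x + emb v x) = emb (v - lin_apply m t M u)"
          by (auto simp: emb_def)
        moreover have "Suc (t - 1) = t" "ap (bcol m n psi) (\<lambda>_. 0) = (\<lambda>x. (- 1) * embS u x + embS u x)"
          using th by (simp_all add: ap_zero)
        ultimately have "zigzag (2 * t) (Suc (t - 1)) (ap (bcol m n psi) (\<lambda>_. 0)) (emb (v - lin_apply m t M u))"
          by (simp only:)
        then have "cobdy (Suc (2 * t)) (emb (v - lin_apply m t M u))"
          by (rule zigzag_image_cobdy) (use col2 in \<open>auto simp: on_zero\<close>)
        then show "\<exists>u\<in>SVec m t. v - lin_apply m t M u \<in> Bdy phi psi l n m t (2 * t + 1)"
          using uS by (auto simp: Bdy)
      qed
      ultimately show "\<exists>M. induces_injection phi psi l n m t (2 * t + 1) M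
          \<and> (enat (2 * t + 1) < h \<longrightarrow> induces_surjection phi psi l n m t (2 * t + 1) M)" by blast
    qed
  qed
  with low show ?thesis by blast
qed

end
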